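(* Let $A$ be an $n \times n$ matrix with entries in $\{0,1\}$, let $d \ge 1$, and let $\{\rho_{ij}\}_{1\le i,j\le n}$ be independent random $d\times d$ complex matrices, all drawn either from the Haar measure or all from the Gaussian measure. Let $M$ be the $n\times n$ matrix with entries $M_{ij}=\rho_{ij}A_{ij}\in\mathcal{A}_d$, and set $X=\lvert \operatorname{tr}\det M\rvert^2$ and $X_s=\lvert\operatorname{tr}\operatorname{sdet}M\rvert^2$. Then, for both the Haar and the Gaussian measure, \[ \frac{\mathbb{E}[X^2]}{\mathbb{E}[X]^2}=\left(1+O\!\left(\frac1d\right)\right)^n . \] In the symmetrized case, \[ \frac{\mathbb{E}[X_s^2]}{\mathbb{E}[X_s]^2}\le 2^{2n}\,n^{-d+O(1)} \quad\text{if } d=O(1), \] and more generally \[ \frac{\mathbb{E}[X_s^2]}{\mathbb{E}[X_s]^2}=O\!\left(e^{4n^2/d}\right). \]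
   Context: $\mathcal{A}_d$ denotes the algebra of $d\times d$ complex matrices. The Haar measure is the uniform (Haar) probability distribution on the unitary group $\mathsf{U}(d)$. In the Gaussian measure, each entry of the $d\times d$ matrix is drawn independently from the complex Gaussian distribution with mean $0$ and variance $1/d$, i.e. its real and imaginary parts are independent real Gaussians with mean $0$ and variance $1/(2d)$. For an $n\times n$ matrix $M$ with entries in $\mathcal{A}_d$, the (Cayley) determinant is $\det M=\sum_{\alpha\in S_n}(-1)^{\alpha}\prod_{i=1}^n M_{i,\alpha i}$, where $(-1)^\alpha$ is the sign of $\alpha$ and the product is taken in the order $i=1,2,\dots,n$ (left to right). The symmetrized determinant is $\operatorname{sdet}M=\frac{1}{n!}\sum_{\alpha,\alpha'\in S_n}(-1)^{\alpha'\alpha^{-1}}\prod_{i=1}^n M_{\alpha i,\alpha' i}$, again with the product in the order $i=1,\dots,n$. Both take values in $\mathcal{A}_d$, and $\operatorname{tr}$ is the matrix trace. Expectations are over the random $\rho_{ij}$.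
   Formalization: With a uniform constant, E[X²]/E[X]² = (1+O(1/d))^n fails (n=1, A=(1): the ratio is 2 for all d≥2); it is proved as stated for n ≥ d, and for all n, d with an extra factor between 1 and an absolute constant; ratios are considered only when the expectation is nonzero. *)

theory Defs
  imports
    "HOL-Probability.Probability"
    "HOL-Combinatorics.Permutations"
    "Jordan_Normal_Form.Schur_Decomposition"
begin

hide_const (open) Finite_Cartesian_Product.mat Finite_Cartesian_Product.vec Determinants.trace

definition trace :: "complex mat \<Rightarrow> complex" where
  "trace M = (\<Sum>a<dim_row M. M $$ (a, a))"

(* The library's matrix type does not fix dimensions, so it has no unit and no zero of its own;
   finite sums and ordered products of d x d matrices take the size d as an argument. *)
definition mat_sum :: "nat \<Rightarrow> 'i set \<Rightarrow> ('i \<Rightarrow> complex mat) \<Rightarrow> complex mat" where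
  "mat_sum d I F = mat d d (\<lambda>ab. \<Sum>i\<in>I. F i $$ ab)"

(* F 0 * (F 1 * (... * F (n - 1))): indices increase from left to right. *)
definition mat_prod :: "nat \<Rightarrow> nat \<Rightarrow> (nat \<Rightarrow> complex mat) \<Rightarrow> complex mat" where
  "mat_prod d n F = foldr (*) (map F [0..<n]) (1\<^sub>m d)"

(* For a square matrix M over the algebra of d x d complex matrices;
   rows and columns are numbered from 0. *)
definition cayley_det :: "nat \<Rightarrow> complex mat mat \<Rightarrow> complex mat" where
  "cayley_det d M = (let n = dim_row M in
     mat_sum d {\<alpha>. \<alpha> permutes {..<n}}
       (\<lambda>\<alpha>. of_int (sign \<alpha>) \<cdot>\<^sub>m mat_prod d n (\<lambda>i. M $$ (i, \<alpha> i))))"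

definition sdet :: "nat \<Rightarrow> complex mat mat \<Rightarrow> complex mat" where
  "sdet d M = (let n = dim_row M in
     (1 / fact n) \<cdot>\<^sub>m
       mat_sum d ({\<alpha>. \<alpha> permutes {..<n}} \<times> {\<alpha>. \<alpha> permutes {..<n}})
         (\<lambda>(\<alpha>, \<alpha>'). of_int (sign (\<alpha>' \<circ> inv_into UNIV \<alpha>)) \<cdot>\<^sub>m
            mat_prod d n (\<lambda>i. M $$ (\<alpha> i, \<alpha>' i))))"

(* Borel sigma-algebra on the d x d complex matrices, generated by the entries. *)
definition mat_borel :: "nat \<Rightarrow> complex mat measure" where
  "mat_borel d = vimage_algebra (carrier_mat d d)
     (\<lambda>M. \<lambda>ab\<in>{..<d} \<times> {..<d}. M $$ ab)
     (\<Pi>\<^sub>M ab\<in>{..<d} \<times> {..<d}. (borel :: complex measure))"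

definition unitary_group :: "nat \<Rightarrow> complex mat set" where
  "unitary_group d =
     {U \<in> carrier_mat d d. U * mat_adjoint U = 1\<^sub>m d \<and> mat_adjoint U * U = 1\<^sub>m d}"

(* Haar measure on U(d), regarded as a measure on all d x d matrices concentrated on U(d):
   the unique bi-invariant probability measure there. *)
definition haar_measure :: "nat \<Rightarrow> complex mat measure \<Rightarrow> bool" where
  "haar_measure d \<mu> \<longleftrightarrow>
     prob_space \<mu> \<and> sets \<mu> = sets (mat_borel d) \<and> emeasure \<mu> (unitary_group d) = 1 \<and>
     (\<forall>U\<in>unitary_group d. distr \<mu> (mat_borel d) (\<lambda>M. U * M) = \<mu> \<and>
                           distr \<mu> (mat_borel d) (\<lambda>M. M * U) = \<mu>)"

(* Complex Gaussian with mean 0 and variance v: real and imaginary parts are independent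
   real Gaussians with variance v / 2; normal_density takes the standard deviation. *)
definition complex_gaussian :: "real \<Rightarrow> complex measure" where
  "complex_gaussian v =
     (let N = density lborel (\<lambda>x. ennreal (normal_density 0 (sqrt (v / 2)) x))
      in distr (N \<Otimes>\<^sub>M N) borel (\<lambda>(x, y). Complex x y))"

definition gaussian_measure :: "nat \<Rightarrow> complex mat measure" where
  "gaussian_measure d =
     distr (\<Pi>\<^sub>M ab\<in>{..<d} \<times> {..<d}. complex_gaussian (1 / real d)) (mat_borel d) (mat d d)"

definition haar_or_gaussian :: "nat \<Rightarrow> complex mat measure \<Rightarrow> bool" where
  "haar_or_gaussian d \<mu> \<longleftrightarrow> haar_measure d \<mu> \<or> \<mu> = gaussian_measure d"

(* Joint law of a family rho (i, j), i, j < n, of independent random matrices with common law mu. *)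
definition iid_family :: "nat \<Rightarrow> complex mat measure \<Rightarrow> (nat \<times> nat \<Rightarrow> complex mat) measure" where
  "iid_family n \<mu> = (\<Pi>\<^sub>M ij\<in>{..<n} \<times> {..<n}. \<mu>)"

definition zero_one_mat :: "nat \<Rightarrow> complex mat \<Rightarrow> bool" where
  "zero_one_mat n A \<longleftrightarrow> A \<in> carrier_mat n n \<and> (\<forall>i<n. \<forall>j<n. A $$ (i, j) \<in> {0, 1})"

definition random_mat :: "complex mat \<Rightarrow> (nat \<times> nat \<Rightarrow> complex mat) \<Rightarrow> complex mat mat" where
  "random_mat A \<rho> = mat (dim_row A) (dim_col A) (\<lambda>ij. A $$ ij \<cdot>\<^sub>m \<rho> ij)"

definition X_det :: "nat \<Rightarrow> complex mat \<Rightarrow> (nat \<times> nat \<Rightarrow> complex mat) \<Rightarrow> real" where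
  "X_det d A \<rho> = (cmod (trace (cayley_det d (random_mat A \<rho>))))\<^sup>2"

definition X_sdet :: "nat \<Rightarrow> complex mat \<Rightarrow> (nat \<times> nat \<Rightarrow> complex mat) \<Rightarrow> real" where
  "X_sdet d A \<rho> = (cmod (trace (sdet d (random_mat A \<rho>))))\<^sup>2"

definition critical_ratio :: "'a measure \<Rightarrow> ('a \<Rightarrow> real) \<Rightarrow> real" where
  "critical_ratio P X = (\<integral>\<omega>. (X \<omega>)\<^sup>2 \<partial>P) / (\<integral>\<omega>. X \<omega> \<partial>P)\<^sup>2"

end

theory Submission
  imports Defs "HOL-Number_Theory.Cong"
begin

text \<open>
  Both traces are linear in each row of the random entries. The second moment of such a form is
  \<open>1 / d\<^sup>n\<close> times the squared norm of its coefficients. For the fourth moment, the kernel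
  \<open>E[\<rho> \<otimes> \<rho> \<otimes> cnj \<rho> \<otimes> cnj \<rho>]\<close> of one row is dominated, as a positive semidefinite form, by
  \<open>K\<close> times the Gaussian one, where \<open>K = 1\<close> in the Gaussian case and \<open>K = d / (d - 1)\<close> in the Haar
  case (\<open>d \<ge> 2\<close>); tensoring the rows gives the factor \<open>K\<^sup>n\<close>. By Wick's rule the Gaussian fourth moment
  is a sum over sets \<open>S\<close> of rows in which the two factors of a pair are exchanged, so the permanent
  of \<open>A\<close> cancels in the ratio and only a count of index words is left.

  For the determinant, every change between \<open>S\<close> and its complement along the rows costs a factor
  \<open>1 / d\<close>, which gives \<open>2 (1 + 1/d)\<^sup>n\<close>. For the symmetrized determinant, Cauchy-Schwarz gives \<open>2\<^sup>n\<close>,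
  which suffices for bounded \<open>d\<close>. In general, \<open>S\<close> and the orders of the two exchanged words are
  encoded, up to \<open>2n\<^sup>2\<close> choices, in a permutation of the \<open>2n\<close> letters, and summing
  \<open>d\<close> to the number of cycles over all permutations gives \<open>\<Prod>(d + i)\<close> over \<open>i < 2n\<close>.
\<close>

section \<open>Families with balanced moments\<close>

text \<open>The entries of one Haar matrix are dependent and their row kernel has negative entries,
  so neither Wick's rule nor an entrywise comparison is available. An inequality of quadratic forms
  is, and it is stable under tensoring. The value of \<open>K\<close> comes from the weights of a
  unitary fourth moment: 1/(d^2 - 1) for the two Wick pairings and -1/(d (d^2 - 1)) for the two with
  crossed columns. In absolute value they add up to 1/(d (d - 1)), against the Gaussian 1/d^2. The
  permanent cancels because a column choice has a coefficient of modulus 0 or 1: the sum of the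
  moduli is the sum of their squares, and the column factors of an exchanged pair are bounded by 1.
  In the symmetrized case the factor n^2 of the encoding is paid for by cyclicity of the trace: a
  word that closes up in one order does so in its n rotations, so the squared norm in the second
  moment is at least n d^n / n!. The factor 2 of the determinant bound fits into (1 + O(1/d))^n if n
  is at least d, and is kept apart otherwise. For bounded d, the base 2 K is at most 3 once d is at
  least 3, and the gap to 4 pays for every fixed power of n.\<close>

definition circ_monomial :: "('t \<Rightarrow> 'a \<Rightarrow> complex) \<Rightarrow> 't list \<Rightarrow> 't list \<Rightarrow> 'a \<Rightarrow> complex" where
  "circ_monomial e xs ys \<omega> = (\<Prod>x\<leftarrow>xs. e x \<omega>) * (\<Prod>y\<leftarrow>ys. cnj (e y \<omega>))"

text \<open>The last clause bounds the fourth moments by \<open>K\<close> times their value for independent complex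
  Gaussians of variance \<open>v\<close>, for which it holds with equality and \<open>K = 1\<close>.\<close>

definition circular_block ::
  "'a measure \<Rightarrow> 't set \<Rightarrow> ('t \<Rightarrow> 'a \<Rightarrow> complex) \<Rightarrow> real \<Rightarrow> real \<Rightarrow> bool" where
  "circular_block M T e v K \<longleftrightarrow> prob_space M \<and> finite T \<and>
     (\<forall>xs ys. set xs \<subseteq> T \<longrightarrow> set ys \<subseteq> T \<longrightarrow> length xs \<le> 2 \<longrightarrow> length ys \<le> 2 \<longrightarrow>
        integrable M (circ_monomial e xs ys)) \<and>
     (\<forall>xs ys. set xs \<subseteq> T \<longrightarrow> set ys \<subseteq> T \<longrightarrow> length xs \<le> 2 \<longrightarrow> length ys \<le> 2 \<longrightarrow>
        length xs \<noteq> length ys \<longrightarrow> integral\<^sup>L M (circ_monomial e xs ys) = 0) \<and>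
     (\<forall>t\<in>T. \<forall>u\<in>T. integral\<^sup>L M (circ_monomial e [t] [u]) = (if t = u then of_real v else 0)) \<and>
     (\<forall>c. (\<integral>\<omega>. (cmod (\<Sum>t\<in>T. \<Sum>t'\<in>T. c t t' * e t \<omega> * e t' \<omega>))\<^sup>2 \<partial>M)
        \<le> K * v\<^sup>2 / 2 * (\<Sum>t\<in>T. \<Sum>t'\<in>T. (cmod (c t t' + c t' t))\<^sup>2))"

lemma circular_blockD:
  assumes "circular_block M T e v K"
  shows "prob_space M" "finite T"
    "\<And>xs ys. set xs \<subseteq> T \<Longrightarrow> set ys \<subseteq> T \<Longrightarrow> length xs \<le> 2 \<Longrightarrow> length ys \<le> 2 \<Longrightarrow>
        integrable M (circ_monomial e xs ys)"
    "\<And>xs ys. set xs \<subseteq> T \<Longrightarrow> set ys \<subseteq> T \<Longrightarrow> length xs \<le> 2 \<Longrightarrow> length ys \<le> 2 \<Longrightarrow>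
        length xs \<noteq> length ys \<Longrightarrow> integral\<^sup>L M (circ_monomial e xs ys) = 0"
    "\<And>t u. t \<in> T \<Longrightarrow> u \<in> T \<Longrightarrow> integral\<^sup>L M (circ_monomial e [t] [u]) = (if t = u then of_real v else 0)"
    "\<And>c. (\<integral>\<omega>. (cmod (\<Sum>t\<in>T. \<Sum>t'\<in>T. c t t' * e t \<omega> * e t' \<omega>))\<^sup>2 \<partial>M)
        \<le> K * v\<^sup>2 / 2 * (\<Sum>t\<in>T. \<Sum>t'\<in>T. (cmod (c t t' + c t' t))\<^sup>2)"
  using assms unfolding circular_block_def by blast+

lemma cmod_sum2_square:
  fixes c :: "'t \<Rightarrow> 't \<Rightarrow> complex"
  shows "complex_of_real ((cmod (\<Sum>t\<in>T. \<Sum>t'\<in>T. c t t' * e t \<omega> * e t' \<omega>))\<^sup>2) =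
    (\<Sum>x\<in>T\<times>T. \<Sum>y\<in>T\<times>T. c (fst x) (snd x) * cnj (c (fst y) (snd y)) *
       circ_monomial e [fst x, snd x] [fst y, snd y] \<omega>)"
proof -
  have "(\<Sum>t\<in>T. \<Sum>t'\<in>T. c t t' * e t \<omega> * e t' \<omega>) =
      (\<Sum>x\<in>T\<times>T. c (fst x) (snd x) * e (fst x) \<omega> * e (snd x) \<omega>)"
    by (simp add: sum.cartesian_product case_prod_beta)
  then show ?thesis
    unfolding complex_norm_square
    by (simp add: sum_product cnj_sum circ_monomial_def mult_ac)
qed

text \<open>Expands a fourth moment into a form whose kernel consists of moments of degree (2, 2);
  the bounds with \<open>K\<close> are statements about this kernel.\<close>

lemma quartic_form_eq:
  fixes c :: "'t \<Rightarrow> 't \<Rightarrow> complex"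
  assumes "\<And>t t' u u'. t \<in> T \<Longrightarrow> t' \<in> T \<Longrightarrow> u \<in> T \<Longrightarrow> u' \<in> T \<Longrightarrow>
    integrable M (circ_monomial e [t, t'] [u, u'])"
  shows "complex_of_real (\<integral>\<omega>. (cmod (\<Sum>t\<in>T. \<Sum>t'\<in>T. c t t' * e t \<omega> * e t' \<omega>))\<^sup>2 \<partial>M) =
    (\<Sum>x\<in>T\<times>T. \<Sum>y\<in>T\<times>T. c (fst x) (snd x) * cnj (c (fst y) (snd y)) *
       integral\<^sup>L M (circ_monomial e [fst x, snd x] [fst y, snd y]))"
proof -
  have int: "integrable M (\<lambda>\<omega>. c (fst x) (snd x) * cnj (c (fst y) (snd y)) *
       circ_monomial e [fst x, snd x] [fst y, snd y] \<omega>)" if "x \<in> T \<times> T" "y \<in> T \<times> T" for x y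
    using that by (intro integrable_mult_right assms) auto
  have "complex_of_real (\<integral>\<omega>. (cmod (\<Sum>t\<in>T. \<Sum>t'\<in>T. c t t' * e t \<omega> * e t' \<omega>))\<^sup>2 \<partial>M)
     = (\<integral>\<omega>. complex_of_real ((cmod (\<Sum>t\<in>T. \<Sum>t'\<in>T. c t t' * e t \<omega> * e t' \<omega>))\<^sup>2) \<partial>M)"
    by (rule integral_complex_of_real[symmetric])
  also have "\<dots> = (\<integral>\<omega>. (\<Sum>x\<in>T\<times>T. \<Sum>y\<in>T\<times>T. c (fst x) (snd x) * cnj (c (fst y) (snd y)) *
       circ_monomial e [fst x, snd x] [fst y, snd y] \<omega>) \<partial>M)"
    unfolding cmod_sum2_square ..
  also have "\<dots> = (\<Sum>x\<in>T\<times>T. \<Sum>y\<in>T\<times>T. c (fst x) (snd x) * cnj (c (fst y) (snd y)) *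
       integral\<^sup>L M (circ_monomial e [fst x, snd x] [fst y, snd y]))"
    by (subst Bochner_Integration.integral_sum, intro Bochner_Integration.integrable_sum int, assumption+,
        intro sum.cong refl, subst Bochner_Integration.integral_sum, rule int, assumption+, simp)
  finally show ?thesis .
qed

section \<open>Monomials in independent coordinates\<close>

definition proj_list :: "'j \<Rightarrow> ('j \<times> 't) list \<Rightarrow> 't list" where
  "proj_list j xs = map snd (filter (\<lambda>x. fst x = j) xs)"

lemma proj_list_simps [simp]:
  "proj_list j [] = []"
  "proj_list j (x # xs) = (if fst x = j then snd x # proj_list j xs else proj_list j xs)"
  by (auto simp: proj_list_def)

lemma length_proj_list_le: "length (proj_list j xs) \<le> length xs"
  by (simp add: proj_list_def)

lemma set_proj_list: "set xs \<subseteq> J \<times> T \<Longrightarrow> set (proj_list j xs) \<subseteq> T"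
  by (auto simp: proj_list_def)

text \<open>The total degree is distributed over the coordinates, so an unbalanced monomial is
  already unbalanced on some coordinate, where independence makes its moment vanish.\<close>

lemma length_eq_sum_proj_list:
  "finite J \<Longrightarrow> set xs \<subseteq> J \<times> T \<Longrightarrow> length xs = (\<Sum>j\<in>J. length (proj_list j xs))"
proof (induction xs)
  case (Cons x xs)
  have "(\<Sum>j\<in>J. length (proj_list j (x # xs))) =
      (\<Sum>j\<in>J. length (proj_list j xs) + (if fst x = j then 1 else 0))"
    by (intro sum.cong) auto
  also have "\<dots> = (\<Sum>j\<in>J. length (proj_list j xs)) + 1"
    using Cons.prems by (subst sum.distrib) auto
  finally show ?case using Cons by simp
qed simp

definition prod_coord :: "('t \<Rightarrow> 'a \<Rightarrow> complex) \<Rightarrow> 'j \<times> 't \<Rightarrow> ('j \<Rightarrow> 'a) \<Rightarrow> complex" where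
  "prod_coord e x \<omega> = e (snd x) (\<omega> (fst x))"

lemma circ_monomial_prod_coord:
  assumes J: "finite J" and xs: "set xs \<subseteq> J \<times> T" and ys: "set ys \<subseteq> J \<times> T"
  shows "circ_monomial (prod_coord e) xs ys \<omega> = (\<Prod>j\<in>J. circ_monomial e (proj_list j xs) (proj_list j ys) (\<omega> j))"
proof -
  \<comment> \<open>\<open>F\<close> is the identity for the plain factors and \<open>cnj\<close>
    for the conjugated ones, so one induction serves both lists.\<close>
  have *: "(\<Prod>x\<leftarrow>zs. F (prod_coord e x \<omega>)) = (\<Prod>j\<in>J. \<Prod>x\<leftarrow>proj_list j zs. F (e x (\<omega> j)))"
    if "set zs \<subseteq> J \<times> T" for zs and F :: "complex \<Rightarrow> complex"
    using that
  proof (induction zs)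
    case (Cons z zs)
    have z: "fst z \<in> J" and zs: "set zs \<subseteq> J \<times> T" using Cons.prems by auto
    have "(\<Prod>j\<in>J. \<Prod>x\<leftarrow>proj_list j (z # zs). F (e x (\<omega> j))) =
      (\<Prod>j\<in>J. (if fst z = j then F (e (snd z) (\<omega> j)) else 1) * (\<Prod>x\<leftarrow>proj_list j zs. F (e x (\<omega> j))))"
      by (intro prod.cong refl) simp
    also have "\<dots> = F (prod_coord e z \<omega>) * (\<Prod>j\<in>J. \<Prod>x\<leftarrow>proj_list j zs. F (e x (\<omega> j)))"
      using z J by (simp add: prod.distrib prod_coord_def)
    also have "\<dots> = (\<Prod>x\<leftarrow>z # zs. F (prod_coord e x \<omega>))" by (simp add: Cons.IH[OF zs])
    finally show ?case by (rule sym)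
  qed simp
  show ?thesis unfolding circ_monomial_def prod.distrib
    using *[OF xs, of "\<lambda>x. x"] *[OF ys, of cnj] by simp
qed

context
  fixes M :: "'a measure" and T :: "'t set" and e v K and J :: "'j set"
  assumes blk: "circular_block M T e v K" and J: "finite J"
begin

lemma product_monomial_moments:
  assumes xs: "set xs \<subseteq> J \<times> T" "length xs \<le> 2" and ys: "set ys \<subseteq> J \<times> T" "length ys \<le> 2"
  shows "integrable (Pi\<^sub>M J (\<lambda>_. M)) (circ_monomial (prod_coord e) xs ys)"
    "integral\<^sup>L (Pi\<^sub>M J (\<lambda>_. M)) (circ_monomial (prod_coord e) xs ys) =
      (\<Prod>j\<in>J. integral\<^sup>L M (circ_monomial e (proj_list j xs) (proj_list j ys)))"
proof -
  interpret M: prob_space M by (rule circular_blockD(1)[OF blk])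
  interpret product_prob_space "\<lambda>_::'j. M" by standard
  have i: "integrable M (circ_monomial e (proj_list j xs) (proj_list j ys))" for j
    using assms length_proj_list_le[of j xs] length_proj_list_le[of j ys] set_proj_list[of xs J T j] set_proj_list[of ys J T j]
    by (intro circular_blockD(3)[OF blk]) auto
  have eq: "circ_monomial (prod_coord e) xs ys = (\<lambda>\<omega>. \<Prod>j\<in>J. circ_monomial e (proj_list j xs) (proj_list j ys) (\<omega> j))"
    using circ_monomial_prod_coord[OF J xs(1) ys(1)] by auto
  show "integrable (Pi\<^sub>M J (\<lambda>_. M)) (circ_monomial (prod_coord e) xs ys)"
    unfolding eq by (rule product_integrable_prod[OF J i])
  show "integral\<^sup>L (Pi\<^sub>M J (\<lambda>_. M)) (circ_monomial (prod_coord e) xs ys) =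
      (\<Prod>j\<in>J. integral\<^sup>L M (circ_monomial e (proj_list j xs) (proj_list j ys)))"
    unfolding eq by (rule product_integral_prod[OF J i])
qed

lemma integral_monomial_Nil: "integral\<^sup>L M (circ_monomial e [] []) = 1"
proof -
  interpret M: prob_space M by (rule circular_blockD(1)[OF blk])
  show ?thesis by (simp add: circ_monomial_def[abs_def] M.prob_space)
qed

lemma product_monomial_unbalanced:
  assumes xs: "set xs \<subseteq> J \<times> T" "length xs \<le> 2" and ys: "set ys \<subseteq> J \<times> T" "length ys \<le> 2"
    and j: "j \<in> J" "length (proj_list j xs) \<noteq> length (proj_list j ys)"
  shows "integral\<^sup>L (Pi\<^sub>M J (\<lambda>_. M)) (circ_monomial (prod_coord e) xs ys) = 0"
proof -
  have "integral\<^sup>L M (circ_monomial e (proj_list j xs) (proj_list j ys)) = 0"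
    using assms length_proj_list_le[of j xs] length_proj_list_le[of j ys] set_proj_list[of xs J T j] set_proj_list[of ys J T j]
    by (intro circular_blockD(4)[OF blk]) auto
  then show ?thesis unfolding product_monomial_moments(2)[OF xs ys] using J j by auto
qed

lemma product_monomial_second:
  assumes "x \<in> J \<times> T" "y \<in> J \<times> T"
  shows "integral\<^sup>L (Pi\<^sub>M J (\<lambda>_. M)) (circ_monomial (prod_coord e) [x] [y]) = (if x = y then of_real v else 0)"
proof (cases "fst x = fst y")
  case True
  have "integral\<^sup>L (Pi\<^sub>M J (\<lambda>_. M)) (circ_monomial (prod_coord e) [x] [y]) =
      (\<Prod>j\<in>J. if fst x = j then integral\<^sup>L M (circ_monomial e [snd x] [snd y]) else 1)"
    using assms True
    by (subst product_monomial_moments(2)) (auto simp: integral_monomial_Nil intro!: prod.cong)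
  also have "\<dots> = integral\<^sup>L M (circ_monomial e [snd x] [snd y])" using assms J by auto
  finally show ?thesis using assms True circular_blockD(5)[OF blk, of "snd x" "snd y"] by (auto simp: prod_eq_iff)
next
  case False
  then show ?thesis using assms by (subst product_monomial_unbalanced[of _ _ "fst x"]) auto
qed

text \<open>Independence leaves two possibilities. Letters on one coordinate give the fourth moment
  of that coordinate. Letters on two different coordinates must each meet a conjugated letter there;
  the two matchings give exactly the Wick terms, without any factor \<open>K\<close>.\<close>

lemma product_monomial_fourth:
  assumes "x \<in> J \<times> T" "x' \<in> J \<times> T" "y \<in> J \<times> T" "y' \<in> J \<times> T"
  shows "integral\<^sup>L (Pi\<^sub>M J (\<lambda>_. M)) (circ_monomial (prod_coord e) [x,x'] [y,y']) =
    (if fst x = fst x' then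
       (if fst y = fst x \<and> fst y' = fst x then integral\<^sup>L M (circ_monomial e [snd x, snd x'] [snd y, snd y']) else 0)
     else of_real (v\<^sup>2) * ((if x = y \<and> x' = y' then 1 else 0) + (if x = y' \<and> x' = y then 1 else 0)))"
proof -
  have mem: "fst x \<in> J" "fst x' \<in> J" "fst y \<in> J" "fst y' \<in> J" "snd x \<in> T" "snd x' \<in> T" "snd y \<in> T" "snd y' \<in> T"
    using assms by auto
  have sub: "set [x,x'] \<subseteq> J \<times> T" "length [x,x'] \<le> 2" "set [y,y'] \<subseteq> J \<times> T" "length [y,y'] \<le> 2"
    using assms by auto
  note unb = product_monomial_unbalanced[OF sub]
  note full = product_monomial_moments(2)[OF sub]
  note two = circular_blockD(5)[OF blk]
  have two_prod: "(\<Prod>j\<in>J. if fst x = j then a else if fst x' = j then b else 1) = a * b"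
    if "fst x \<noteq> fst x'" for a b :: complex
  proof -
    have "(\<Prod>j\<in>J. if fst x = j then a else if fst x' = j then b else 1)
       = (\<Prod>j\<in>J. (if fst x = j then a else 1) * (if fst x' = j then b else 1))"
      using that by (intro prod.cong) auto
    then show ?thesis using mem J by (simp add: prod.distrib)
  qed
  consider (same) "fst x = fst x'" "fst y = fst x" "fst y' = fst x"
    | (same0) "fst x = fst x'" "\<not> (fst y = fst x \<and> fst y' = fst x)"
    | (str) "fst x \<noteq> fst x'" "fst y = fst x" "fst y' = fst x'"
    | (swp) "fst x \<noteq> fst x'" "fst y = fst x'" "fst y' = fst x"
    | (none) "fst x \<noteq> fst x'" "\<not> (fst y = fst x \<and> fst y' = fst x')" "\<not> (fst y = fst x' \<and> fst y' = fst x)"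
    by blast
  then show ?thesis
  proof cases
    case same
    have "integral\<^sup>L (Pi\<^sub>M J (\<lambda>_. M)) (circ_monomial (prod_coord e) [x,x'] [y,y']) =
      (\<Prod>j\<in>J. if fst x = j then integral\<^sup>L M (circ_monomial e [snd x,snd x'] [snd y,snd y']) else 1)"
      unfolding full using same by (intro prod.cong refl) (simp add: integral_monomial_Nil)
    then show ?thesis using same mem J by simp
  next
    case same0
    then show ?thesis using mem by (subst unb[of "fst x"]) auto
  next
    case str
    have "integral\<^sup>L (Pi\<^sub>M J (\<lambda>_. M)) (circ_monomial (prod_coord e) [x,x'] [y,y']) =
      (\<Prod>j\<in>J. if fst x = j then integral\<^sup>L M (circ_monomial e [snd x] [snd y])
             else if fst x' = j then integral\<^sup>L M (circ_monomial e [snd x'] [snd y']) else 1)"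
      unfolding full using str(1) by (intro prod.cong refl) (force simp add: str(2,3) integral_monomial_Nil)
    also have "\<dots> = integral\<^sup>L M (circ_monomial e [snd x] [snd y]) * integral\<^sup>L M (circ_monomial e [snd x'] [snd y'])"
      by (rule two_prod[OF str(1)])
    also have "\<dots> = (if snd x = snd y then of_real v else 0) * (if snd x' = snd y' then of_real v else 0)"
      by (simp only: two mem)
    finally have I: "integral\<^sup>L (Pi\<^sub>M J (\<lambda>_. M)) (circ_monomial (prod_coord e) [x,x'] [y,y']) = \<dots>" .
    have "x = y \<longleftrightarrow> snd x = snd y" "x' = y' \<longleftrightarrow> snd x' = snd y'" "x \<noteq> y'"
      using str by (auto simp: prod_eq_iff)
    then show ?thesis unfolding I using str(1) by (simp add: power2_eq_square)
  next
    case swp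
    have "integral\<^sup>L (Pi\<^sub>M J (\<lambda>_. M)) (circ_monomial (prod_coord e) [x,x'] [y,y']) =
      (\<Prod>j\<in>J. if fst x = j then integral\<^sup>L M (circ_monomial e [snd x] [snd y'])
             else if fst x' = j then integral\<^sup>L M (circ_monomial e [snd x'] [snd y]) else 1)"
      unfolding full using swp(1) by (intro prod.cong refl) (force simp add: swp(2,3) integral_monomial_Nil)
    also have "\<dots> = integral\<^sup>L M (circ_monomial e [snd x] [snd y']) * integral\<^sup>L M (circ_monomial e [snd x'] [snd y])"
      by (rule two_prod[OF swp(1)])
    also have "\<dots> = (if snd x = snd y' then of_real v else 0) * (if snd x' = snd y then of_real v else 0)"
      by (simp only: two mem)
    finally have I: "integral\<^sup>L (Pi\<^sub>M J (\<lambda>_. M)) (circ_monomial (prod_coord e) [x,x'] [y,y']) = \<dots>" .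
    have "x = y' \<longleftrightarrow> snd x = snd y'" "x' = y \<longleftrightarrow> snd x' = snd y" "x \<noteq> y"
      using swp by (auto simp: prod_eq_iff)
    then show ?thesis unfolding I using swp(1) by (simp add: power2_eq_square)
  next
    \<comment> \<open>The coordinates \<open>fst x\<close> and \<open>fst x'\<close> carry one plain
      letter each. If neither matching holds, one of them does not carry exactly one conjugated
      letter.\<close>
    case none
    then have "length (proj_list (fst x) [x,x']) \<noteq> length (proj_list (fst x) [y,y'])
       \<or> length (proj_list (fst x') [x,x']) \<noteq> length (proj_list (fst x') [y,y'])"
      by (cases "fst y = fst x"; cases "fst y' = fst x"; cases "fst y = fst x'"; cases "fst y' = fst x'") simp_all
    then have "integral\<^sup>L (Pi\<^sub>M J (\<lambda>_. M)) (circ_monomial (prod_coord e) [x,x'] [y,y']) = 0"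
      by (elim disjE) (rule unb[OF mem(1)], assumption, rule unb[OF mem(2)], assumption)
    moreover have "(x = y \<and> x' = y') = False" "(x = y' \<and> x' = y) = False" "(fst x = fst x') = False"
      using none by metis+
    ultimately show ?thesis by (simp only: if_False add_0 mult_zero_right)
  qed
qed

end

text \<open>Exchanging \<open>x\<close> and \<open>y\<close> changes neither \<open>P\<close> nor
  the conjugated factor, so averaging the two versions replaces \<open>c x y\<close> by half of its
  symmetrization.\<close>

lemma symmetrized_square_sum:
  fixes c :: "'t \<Rightarrow> 't \<Rightarrow> complex"
  assumes "\<And>x y. P x y = P y x"
  shows "(\<Sum>x\<in>T. \<Sum>y\<in>T. if P x y then c x y * cnj (c x y + c y x) else 0) =
    of_real ((\<Sum>x\<in>T. \<Sum>y\<in>T. if P x y then (cmod (c x y + c y x))\<^sup>2 else 0) / 2)"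
proof -
  let ?S = "\<Sum>x\<in>T. \<Sum>y\<in>T. if P x y then c x y * cnj (c x y + c y x) else 0"
  have "?S = (\<Sum>y\<in>T. \<Sum>x\<in>T. if P x y then c x y * cnj (c x y + c y x) else 0)"
    by (rule sum.swap)
  also have "\<dots> = (\<Sum>x\<in>T. \<Sum>y\<in>T. if P x y then c y x * cnj (c x y + c y x) else 0)"
    using assms by (intro sum.cong refl) (auto simp: add.commute)
  finally have "2 * ?S = (\<Sum>x\<in>T. \<Sum>y\<in>T. if P x y then c x y * cnj (c x y + c y x) else 0)
     + (\<Sum>x\<in>T. \<Sum>y\<in>T. if P x y then c y x * cnj (c x y + c y x) else 0)" by simp
  also have "\<dots> = (\<Sum>x\<in>T. \<Sum>y\<in>T. if P x y then (c x y + c y x) * cnj (c x y + c y x) else 0)"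
    unfolding sum.distrib[symmetric] by (intro sum.cong refl) (auto simp: algebra_simps)
  also have "\<dots> = of_real (\<Sum>x\<in>T. \<Sum>y\<in>T. if P x y then (cmod (c x y + c y x))\<^sup>2 else 0)"
    unfolding of_real_sum by (intro sum.cong refl) (simp only: complex_norm_square if_distrib[of of_real] of_real_0)
  finally have "?S * 2 = of_real (\<Sum>x\<in>T. \<Sum>y\<in>T. if P x y then (cmod (c x y + c y x))\<^sup>2 else 0)"
    by (simp only: mult.commute)
  then show ?thesis unfolding of_real_divide by (simp only: eq_divide_eq) simp
qed

text \<open>The quartic form splits according to whether the two letters share a coordinate. Shared
  coordinates fall under the hypothesis on \<open>M\<close>, one at a time; distinct coordinates
  contribute their Gaussian value. Hence \<open>K\<close> does not grow with the number of
  coordinates.\<close>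

lemma circular_block_product:
  assumes blk: "circular_block M T e v K" and J: "finite J" and K: "K \<ge> 1"
  shows "circular_block (Pi\<^sub>M J (\<lambda>_. M)) (J \<times> T) (prod_coord e) v K"
proof -
  interpret M: prob_space M by (rule circular_blockD(1)[OF blk])
  have T: "finite T" by (rule circular_blockD(2)[OF blk])
  have ps: "prob_space (Pi\<^sub>M J (\<lambda>_. M))" by (intro prob_space_PiM) (rule M.prob_space_axioms)
  have unb: "integral\<^sup>L (Pi\<^sub>M J (\<lambda>_. M)) (circ_monomial (prod_coord e) xs ys) = 0"
    if "set xs \<subseteq> J \<times> T" "set ys \<subseteq> J \<times> T" "length xs \<le> 2" "length ys \<le> 2" "length xs \<noteq> length ys" for xs ys
  proof -
    have "(\<Sum>j\<in>J. length (proj_list j xs)) \<noteq> (\<Sum>j\<in>J. length (proj_list j ys))"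
      using length_eq_sum_proj_list[OF J that(1)] length_eq_sum_proj_list[OF J that(2)] that(5) by simp
    then obtain j where "j \<in> J" "length (proj_list j xs) \<noteq> length (proj_list j ys)"
      by (meson sum.cong)
    then show ?thesis using that by (intro product_monomial_unbalanced[OF blk J])
  qed
  have fourth: "(\<integral>\<omega>. (cmod (\<Sum>x\<in>J\<times>T. \<Sum>x'\<in>J\<times>T. c x x' * prod_coord e x \<omega> * prod_coord e x' \<omega>))\<^sup>2 \<partial>Pi\<^sub>M J (\<lambda>_. M))
      \<le> K * v\<^sup>2 / 2 * (\<Sum>x\<in>J\<times>T. \<Sum>x'\<in>J\<times>T. (cmod (c x x' + c x' x))\<^sup>2)" (is "?E \<le> _") for c
  proof -
    let ?A = "\<lambda>t t' u u'. integral\<^sup>L M (circ_monomial e [t,t'] [u,u'])"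
    let ?N = "\<lambda>x x'. (cmod (c x x' + c x' x))\<^sup>2"
    have ind: "a * (b * ((if p then 1 else 0) + (if q then 1 else 0))) =
        (if p then b * a else 0) + (if q then b * a else 0)" for a b :: complex and p q
      by (simp add: algebra_simps)
    \<comment> \<open>The part of the form in which all four letters live on coordinate
      \<open>j\<close>.\<close>
    define Q where "Q j = (\<integral>\<omega>. (cmod (\<Sum>t\<in>T. \<Sum>t'\<in>T. c (j,t) (j,t') * e t \<omega> * e t' \<omega>))\<^sup>2 \<partial>M)" for j
    have row: "(\<Sum>y\<in>(J\<times>T)\<times>(J\<times>T). c x x' * cnj (c (fst y) (snd y)) *
          integral\<^sup>L (Pi\<^sub>M J (\<lambda>_. M)) (circ_monomial (prod_coord e) [x,x'] [fst y, snd y])) =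
        (if fst x = fst x' then \<Sum>u\<in>T\<times>T. c x x' * cnj (c (fst x, fst u) (fst x, snd u)) * ?A (snd x) (snd x') (fst u) (snd u)
         else of_real (v\<^sup>2) * (c x x' * cnj (c x x' + c x' x)))" (is "?L = _")
      if x: "x \<in> J \<times> T" "x' \<in> J \<times> T" for x x'
    proof (cases "fst x = fst x'")
      case True
      let ?g = "\<lambda>y. c x x' * cnj (c (fst y) (snd y)) * ?A (snd x) (snd x') (snd (fst y)) (snd (snd y))"
      let ?i = "\<lambda>u. ((fst x, fst u), (fst x, snd u))"
      have "?L = (\<Sum>y\<in>(J\<times>T)\<times>(J\<times>T). if fst (fst y) = fst x \<and> fst (snd y) = fst x then ?g y else 0)"
      proof (intro sum.cong refl)
        fix y assume "y \<in> (J\<times>T)\<times>(J\<times>T)"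
        then have y: "fst y \<in> J \<times> T" "snd y \<in> J \<times> T" by auto
        show "c x x' * cnj (c (fst y) (snd y)) *
          integral\<^sup>L (Pi\<^sub>M J (\<lambda>_. M)) (circ_monomial (prod_coord e) [x,x'] [fst y, snd y]) =
          (if fst (fst y) = fst x \<and> fst (snd y) = fst x then ?g y else 0)"
          unfolding product_monomial_fourth[OF blk J x y] using True by simp
      qed
      also have "\<dots> = (\<Sum>y\<in>?i ` (T\<times>T). ?g y)"
        using T J x by (subst sum.inter_filter[symmetric]) (auto intro!: sum.cong simp: image_iff)
      also have "\<dots> = (\<Sum>u\<in>T\<times>T. ?g (?i u))"
        by (subst sum.reindex) (auto simp: inj_on_def)
      finally show ?thesis using True by simp
    next
      case False
      let ?C = "\<lambda>y. of_real (v\<^sup>2) * (c x x' * cnj (c (fst y) (snd y)))"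
      have "?L = (\<Sum>y\<in>(J\<times>T)\<times>(J\<times>T). (if y = (x,x') then ?C y else 0) + (if y = (x',x) then ?C y else 0))"
      proof (intro sum.cong refl)
        fix y assume "y \<in> (J\<times>T)\<times>(J\<times>T)"
        then have y: "fst y \<in> J \<times> T" "snd y \<in> J \<times> T" by auto
        have eqs: "y = (x,x') \<longleftrightarrow> x = fst y \<and> x' = snd y" "y = (x',x) \<longleftrightarrow> x = snd y \<and> x' = fst y"
          by (auto simp: prod_eq_iff)
        show "c x x' * cnj (c (fst y) (snd y)) *
          integral\<^sup>L (Pi\<^sub>M J (\<lambda>_. M)) (circ_monomial (prod_coord e) [x,x'] [fst y, snd y]) =
          (if y = (x,x') then ?C y else 0) + (if y = (x',x) then ?C y else 0)"
          unfolding product_monomial_fourth[OF blk J x y] eqs using False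
          by (simp only: if_False ind)
      qed
      also have "\<dots> = ?C (x,x') + ?C (x',x)"
      proof -
        have "finite ((J\<times>T)\<times>(J\<times>T))" "(x,x') \<in> (J\<times>T)\<times>(J\<times>T)" "(x',x) \<in> (J\<times>T)\<times>(J\<times>T)"
          using T J x by auto
        then show ?thesis by (simp only: sum.distrib sum.delta if_True)
      qed
      also have "\<dots> = of_real (v\<^sup>2) * (c x x' * cnj (c x x' + c x' x))"
        by (simp only: fst_conv snd_conv complex_cnj_add distrib_left)
      finally show ?thesis by (simp only: False if_False)
    qed
    have "complex_of_real ?E = (\<Sum>z\<in>(J\<times>T)\<times>(J\<times>T). \<Sum>y\<in>(J\<times>T)\<times>(J\<times>T). c (fst z) (snd z) * cnj (c (fst y) (snd y)) *
          integral\<^sup>L (Pi\<^sub>M J (\<lambda>_. M)) (circ_monomial (prod_coord e) [fst z, snd z] [fst y, snd y]))"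
      by (rule quartic_form_eq) (intro product_monomial_moments[OF blk J], auto)
    also have "\<dots> = (\<Sum>x\<in>J\<times>T. \<Sum>x'\<in>J\<times>T. \<Sum>y\<in>(J\<times>T)\<times>(J\<times>T). c x x' * cnj (c (fst y) (snd y)) *
          integral\<^sup>L (Pi\<^sub>M J (\<lambda>_. M)) (circ_monomial (prod_coord e) [x, x'] [fst y, snd y]))"
      by (simp only: sum.cartesian_product' fst_conv snd_conv)
    also have "\<dots> = (\<Sum>x\<in>J\<times>T. \<Sum>x'\<in>J\<times>T.
        (if fst x = fst x' then \<Sum>u\<in>T\<times>T. c x x' * cnj (c (fst x, fst u) (fst x, snd u)) * ?A (snd x) (snd x') (fst u) (snd u) else 0)
         + of_real (v\<^sup>2) * (if fst x \<noteq> fst x' then c x x' * cnj (c x x' + c x' x) else 0))"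
      by (intro sum.cong refl) (simp add: row)
    also have "\<dots> = (\<Sum>x\<in>J\<times>T. \<Sum>x'\<in>J\<times>T.
        (if fst x = fst x' then \<Sum>u\<in>T\<times>T. c x x' * cnj (c (fst x, fst u) (fst x, snd u)) * ?A (snd x) (snd x') (fst u) (snd u) else 0))
         + of_real (v\<^sup>2) * (\<Sum>x\<in>J\<times>T. \<Sum>x'\<in>J\<times>T. if fst x \<noteq> fst x' then c x x' * cnj (c x x' + c x' x) else 0)"
      (is "_ = ?same + _")
      by (simp only: sum.distrib sum_distrib_left)
    also have "?same = (\<Sum>j\<in>J. \<Sum>t\<in>T. \<Sum>k\<in>J. if j = k then \<Sum>t'\<in>T. \<Sum>u\<in>T\<times>T. c (j,t) (j,t') * cnj (c (j, fst u) (j, snd u)) * ?A t t' (fst u) (snd u) else 0)"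
      unfolding sum.cartesian_product'[of _ J T] fst_conv snd_conv
      by (intro sum.cong refl) auto
    also have "\<dots> = (\<Sum>j\<in>J. \<Sum>t\<in>T. \<Sum>t'\<in>T. \<Sum>u\<in>T\<times>T. c (j,t) (j,t') * cnj (c (j, fst u) (j, snd u)) * ?A t t' (fst u) (snd u))"
      using J by (intro sum.cong refl) (simp add: sum.delta)
    also have "\<dots> = (\<Sum>j\<in>J. of_real (Q j))"
    proof (intro sum.cong refl)
      fix j
      have "complex_of_real (Q j) = (\<Sum>x\<in>T\<times>T. \<Sum>y\<in>T\<times>T. c (j, fst x) (j, snd x) * cnj (c (j, fst y) (j, snd y)) *
        integral\<^sup>L M (circ_monomial e [fst x, snd x] [fst y, snd y]))"
        unfolding Q_def by (rule quartic_form_eq) (rule circular_blockD(3)[OF blk], auto)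
      then show "(\<Sum>t\<in>T. \<Sum>t'\<in>T. \<Sum>u\<in>T\<times>T. c (j,t) (j,t') * cnj (c (j, fst u) (j, snd u)) * ?A t t' (fst u) (snd u)) = of_real (Q j)"
        unfolding sum.cartesian_product'[of _ T T] fst_conv snd_conv by simp
    qed
    also have "(\<Sum>x\<in>J\<times>T. \<Sum>x'\<in>J\<times>T. if fst x \<noteq> fst x' then c x x' * cnj (c x x' + c x' x) else 0) =
       of_real ((\<Sum>x\<in>J\<times>T. \<Sum>x'\<in>J\<times>T. if fst x \<noteq> fst x' then ?N x x' else 0) / 2)"
      by (rule symmetrized_square_sum) auto
    finally have "complex_of_real ?E = of_real ((\<Sum>j\<in>J. Q j) + v\<^sup>2 * ((\<Sum>x\<in>J\<times>T. \<Sum>x'\<in>J\<times>T. if fst x \<noteq> fst x' then ?N x x' else 0) / 2))"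
      by simp
    then have "?E = (\<Sum>j\<in>J. Q j) + v\<^sup>2 / 2 * (\<Sum>x\<in>J\<times>T. \<Sum>x'\<in>J\<times>T. if fst x \<noteq> fst x' then ?N x x' else 0)"
      unfolding of_real_eq_iff by simp
    also have "\<dots> \<le> (\<Sum>j\<in>J. K * v\<^sup>2 / 2 * (\<Sum>t\<in>T. \<Sum>t'\<in>T. ?N (j,t) (j,t')))
        + K * v\<^sup>2 / 2 * (\<Sum>x\<in>J\<times>T. \<Sum>x'\<in>J\<times>T. if fst x \<noteq> fst x' then ?N x x' else 0)"
    proof (intro add_mono sum_mono mult_right_mono sum_nonneg)
      show "Q j \<le> K * v\<^sup>2 / 2 * (\<Sum>t\<in>T. \<Sum>t'\<in>T. ?N (j,t) (j,t'))" for j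
        unfolding Q_def by (rule circular_blockD(6)[OF blk])
      \<comment> \<open>Off the diagonal blocks the moment equals the bound for
        \<open>K = 1\<close>.\<close>
      show "v\<^sup>2 / 2 \<le> K * v\<^sup>2 / 2" using K mult_right_mono[of 1 K "v\<^sup>2"] by simp
    qed auto
    also have "(\<Sum>j\<in>J. K * v\<^sup>2 / 2 * (\<Sum>t\<in>T. \<Sum>t'\<in>T. ?N (j,t) (j,t'))) =
       K * v\<^sup>2 / 2 * (\<Sum>x\<in>J\<times>T. \<Sum>x'\<in>J\<times>T. if fst x = fst x' then ?N x x' else 0)"
    proof -
      have "(\<Sum>x\<in>J\<times>T. \<Sum>x'\<in>J\<times>T. if fst x = fst x' then ?N x x' else 0) =
        (\<Sum>j\<in>J. \<Sum>t\<in>T. \<Sum>k\<in>J. if j = k then \<Sum>t'\<in>T. ?N (j,t) (j,t') else 0)"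
        unfolding sum.cartesian_product'[of _ J T] fst_conv snd_conv by (intro sum.cong refl) auto
      also have "\<dots> = (\<Sum>j\<in>J. \<Sum>t\<in>T. \<Sum>t'\<in>T. ?N (j,t) (j,t'))" using J by (simp add: sum.delta)
      finally show ?thesis by (simp only: sum_distrib_left)
    qed
    also have "K * v\<^sup>2 / 2 * (\<Sum>x\<in>J\<times>T. \<Sum>x'\<in>J\<times>T. if fst x = fst x' then ?N x x' else 0) +
       K * v\<^sup>2 / 2 * (\<Sum>x\<in>J\<times>T. \<Sum>x'\<in>J\<times>T. if fst x \<noteq> fst x' then ?N x x' else 0) =
       K * v\<^sup>2 / 2 * (\<Sum>x\<in>J\<times>T. \<Sum>x'\<in>J\<times>T. ?N x x')"
      unfolding distrib_left[symmetric] sum.distrib[symmetric]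
      by (intro arg_cong2[where f="(*)"] sum.cong refl) simp
    finally show ?thesis .
  qed
  show ?thesis
    unfolding circular_block_def
    by (intro conjI allI impI ballI ps finite_cartesian_product J T fourth product_monomial_second[OF blk J])
       (rule product_monomial_moments(1)[OF blk J] unb; assumption)+
qed

section \<open>Gaussian matrices\<close>

lemma circ_monomial_measurable:
  assumes "\<And>x. x \<in> set xs \<union> set ys \<Longrightarrow> e x \<in> borel_measurable N"
  shows "circ_monomial e xs ys \<in> borel_measurable N"
proof -
  have "(\<lambda>\<omega>. \<Prod>x\<leftarrow>zs. F (e x \<omega>)) \<in> borel_measurable N"
    if "set zs \<subseteq> set xs \<union> set ys" and F: "F \<in> borel_measurable borel" for zs and F :: "complex \<Rightarrow> complex"
    using that(1)
  proof (induction zs)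
    case (Cons z zs)
    then show ?case
      using measurable_compose[OF assms[of z] F] by (auto intro!: borel_measurable_times)
  qed simp
  from this[of xs "\<lambda>x. x"] this[of ys cnj] show ?thesis
    unfolding circ_monomial_def[abs_def]
    by (intro borel_measurable_times) (simp_all add: borel_measurable_continuous_onI continuous_on_cnj)
qed

text \<open>The conditions concern only the joint law of the coordinates, so they pass to an image
  measure, together with a renaming \<open>g\<close> of the indices. This turns a family of scalars
  into the entries of a random matrix.\<close>

lemma circular_block_distr:
  assumes blk: "circular_block M T e v K"
    and \<phi>: "\<phi> \<in> measurable M N"
    and g: "bij_betw g T' T"
    and e'_meas: "\<And>t. t \<in> T' \<Longrightarrow> e' t \<in> borel_measurable N"
    and e': "\<And>t \<omega>. t \<in> T' \<Longrightarrow> \<omega> \<in> space M \<Longrightarrow> e' t (\<phi> \<omega>) = e (g t) \<omega>"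
  shows "circular_block (distr M N \<phi>) T' e' v K"
proof -
  interpret M: prob_space M by (rule circular_blockD(1)[OF blk])
  have T: "finite T" by (rule circular_blockD(2)[OF blk])
  have T': "finite T'" using T bij_betw_finite[OF g] by simp
  have gT: "g t \<in> T" if "t \<in> T'" for t using g that by (auto simp: bij_betw_def)
  have meas: "circ_monomial e' xs ys \<in> borel_measurable N" if "set xs \<subseteq> T'" "set ys \<subseteq> T'" for xs ys
    using that by (intro circ_monomial_measurable e'_meas) auto
  have eq: "circ_monomial e' xs ys (\<phi> \<omega>) = circ_monomial e (map g xs) (map g ys) \<omega>"
    if "set xs \<subseteq> T'" "set ys \<subseteq> T'" "\<omega> \<in> space M" for xs ys \<omega>
  proof -
    have "map (\<lambda>x. F (e' x (\<phi> \<omega>))) zs = map ((\<lambda>x. F (e x \<omega>)) \<circ> g) zs" if "set zs \<subseteq> T'"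
      for zs and F :: "complex \<Rightarrow> complex"
      using that \<open>\<omega> \<in> space M\<close> e' by (intro map_cong) auto
    from this[OF that(1), of "\<lambda>x. x"] this[OF that(2), of cnj] show ?thesis
      unfolding circ_monomial_def map_map by (simp only:)
  qed
  have int: "integrable (distr M N \<phi>) (circ_monomial e' xs ys) \<longleftrightarrow> integrable M (circ_monomial e (map g xs) (map g ys))"
    if "set xs \<subseteq> T'" "set ys \<subseteq> T'" for xs ys
    unfolding integrable_distr_eq[OF \<phi> meas[OF that]]
    by (intro Bochner_Integration.integrable_cong refl eq that)
  have val: "integral\<^sup>L (distr M N \<phi>) (circ_monomial e' xs ys) = integral\<^sup>L M (circ_monomial e (map g xs) (map g ys))"
    if "set xs \<subseteq> T'" "set ys \<subseteq> T'" for xs ys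
    unfolding integral_distr[OF \<phi> meas[OF that]]
    by (intro Bochner_Integration.integral_cong refl eq that)
  \<comment> \<open>\<open>h\<close> inverts \<open>g\<close> and pulls a coefficient array on
    \<open>T'\<close> back to one on \<open>T\<close>.\<close>
  define h where "h = inv_into T' g"
  have h: "h t \<in> T'" "g (h t) = t" if "t \<in> T" for t
    using g that unfolding h_def by (auto simp: bij_betw_def inv_into_into f_inv_into_f)
  have hg: "h (g t) = t" if "t \<in> T'" for t using g that unfolding h_def by (auto simp: bij_betw_def)
  have sum_g: "(\<Sum>t\<in>T'. F t) = (\<Sum>t\<in>T. F (h t))" for F :: "_ \<Rightarrow> 'z :: comm_monoid_add"
    using g h hg by (intro sum.reindex_bij_witness[of _ h g]) (auto simp: gT)
  have fourth: "(\<integral>\<omega>. (cmod (\<Sum>t\<in>T'. \<Sum>t'\<in>T'. c t t' * e' t \<omega> * e' t' \<omega>))\<^sup>2 \<partial>distr M N \<phi>)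
        \<le> K * v\<^sup>2 / 2 * (\<Sum>t\<in>T'. \<Sum>t'\<in>T'. (cmod (c t t' + c t' t))\<^sup>2)" for c
  proof -
    have "(\<integral>\<omega>. (cmod (\<Sum>t\<in>T'. \<Sum>t'\<in>T'. c t t' * e' t \<omega> * e' t' \<omega>))\<^sup>2 \<partial>distr M N \<phi>)
      = (\<integral>\<omega>. (cmod (\<Sum>t\<in>T'. \<Sum>t'\<in>T'. c t t' * e' t (\<phi> \<omega>) * e' t' (\<phi> \<omega>)))\<^sup>2 \<partial>M)"
      using e'_meas by (intro integral_distr[OF \<phi>]) measurable
    also have "\<dots> = (\<integral>\<omega>. (cmod (\<Sum>t\<in>T'. \<Sum>t'\<in>T'. c t t' * e (g t) \<omega> * e (g t') \<omega>))\<^sup>2 \<partial>M)"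
      by (intro Bochner_Integration.integral_cong arg_cong[where f="\<lambda>z. (cmod z)\<^sup>2"] sum.cong refl) (simp add: e')
    also have "\<dots> = (\<integral>\<omega>. (cmod (\<Sum>t\<in>T. \<Sum>t'\<in>T. c (h t) (h t') * e t \<omega> * e t' \<omega>))\<^sup>2 \<partial>M)"
      by (intro Bochner_Integration.integral_cong arg_cong[where f="\<lambda>z. (cmod z)\<^sup>2"] refl) (simp add: sum_g h)
    also have "\<dots> \<le> K * v\<^sup>2 / 2 * (\<Sum>t\<in>T. \<Sum>t'\<in>T. (cmod (c (h t) (h t') + c (h t') (h t)))\<^sup>2)"
      by (rule circular_blockD(6)[OF blk])
    finally show ?thesis by (simp add: sum_g)
  qed
  have gsub: "set (map g xs) \<subseteq> T" if "set xs \<subseteq> T'" for xs using that gT by auto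
  show ?thesis unfolding circular_block_def
  proof (intro conjI allI impI ballI)
    show "prob_space (distr M N \<phi>)" by (rule M.prob_space_distr[OF \<phi>])
    show "integral\<^sup>L (distr M N \<phi>) (circ_monomial e' [t] [u]) = (if t = u then of_real v else 0)"
      if "t \<in> T'" "u \<in> T'" for t u
      using that val[of "[t]" "[u]"] circular_blockD(5)[OF blk, of "g t" "g u"] gT g
      by (auto simp: bij_betw_def inj_on_def)
    show "integrable (distr M N \<phi>) (circ_monomial e' xs ys)"
      if "set xs \<subseteq> T'" "set ys \<subseteq> T'" "length xs \<le> 2" "length ys \<le> 2" for xs ys
      unfolding int[OF that(1,2)] using that by (intro circular_blockD(3)[OF blk] gsub) auto
    show "integral\<^sup>L (distr M N \<phi>) (circ_monomial e' xs ys) = 0"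
      if "set xs \<subseteq> T'" "set ys \<subseteq> T'" "length xs \<le> 2" "length ys \<le> 2" "length xs \<noteq> length ys" for xs ys
      unfolding val[OF that(1,2)] using that by (intro circular_blockD(4)[OF blk] gsub) auto
  qed (fact T' fourth)+
qed

lemma (in pair_sigma_finite)
  fixes f g :: "_ \<Rightarrow> real"
  assumes f: "integrable M1 f" and g: "integrable M2 g"
  shows integrable_pair_times: "integrable (M1 \<Otimes>\<^sub>M M2) (\<lambda>(x, y). f x * g y)"
    and integral_pair_times: "(\<integral>(x, y). f x * g y \<partial>(M1 \<Otimes>\<^sub>M M2)) = integral\<^sup>L M1 f * integral\<^sup>L M2 g"
proof -
  note [measurable] = borel_measurable_integrable[OF f] borel_measurable_integrable[OF g]
  show *: "integrable (M1 \<Otimes>\<^sub>M M2) (\<lambda>(x, y). f x * g y)"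
  proof (rule Fubini_integrable)
    show "integrable M1 (\<lambda>x. \<integral>y. norm (case (x, y) of (x, y) \<Rightarrow> f x * g y) \<partial>M2)"
      using f by (simp add: abs_mult)
    show "AE x in M1. integrable M2 (\<lambda>y. case (x, y) of (x, y) \<Rightarrow> f x * g y)"
      using g by simp
  qed measurable
  show "(\<integral>(x, y). f x * g y \<partial>(M1 \<Otimes>\<^sub>M M2)) = integral\<^sup>L M1 f * integral\<^sup>L M2 g"
    unfolding integral_fst'[OF *, symmetric] by simp
qed

section \<open>Moments of a complex Gaussian variable\<close>

definition normal_moment :: "real \<Rightarrow> nat \<Rightarrow> real" where
  "normal_moment v k = (\<integral>x. x ^ k \<partial>density lborel (\<lambda>x. ennreal (normal_density 0 (sqrt (v / 2)) x)))"

lemma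
  assumes v: "v > 0"
  shows integrable_normal_power:
      "integrable (density lborel (\<lambda>x. ennreal (normal_density 0 (sqrt (v / 2)) x))) (\<lambda>x. x ^ k)"
    and normal_moment_0: "normal_moment v 0 = 1"
    and normal_moment_1: "normal_moment v 1 = 0"
    and normal_moment_2: "normal_moment v 2 = v / 2"
    and normal_moment_3: "normal_moment v 3 = 0"
    and normal_moment_4: "normal_moment v 4 = 3 * v\<^sup>2 / 4"
proof -
  have s: "sqrt (v / 2) > 0" using v by simp
  have eq: "normal_moment v k = (\<integral>x. normal_density 0 (sqrt (v/2)) x * x ^ k \<partial>lborel)" for k
    unfolding normal_moment_def by (subst integral_real_density) (auto simp: normal_density_nonneg)
  show "integrable (density lborel (\<lambda>x. ennreal (normal_density 0 (sqrt (v / 2)) x))) (\<lambda>x. x ^ k)"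
    using integrable_normal_moment[OF s, of 0 k]
    by (subst integrable_real_density) (auto simp: normal_density_nonneg)
  show "normal_moment v 0 = 1" using integral_normal_moment_even[OF s, of 0 0] by (simp add: eq)
  show "normal_moment v 1 = 0" using integral_normal_moment_odd[OF s, of 0 0] by (simp add: eq)
  show "normal_moment v 2 = v / 2" using integral_normal_moment_even[OF s, of 0 1] v by (simp add: eq)
  show "normal_moment v 3 = 0" using integral_normal_moment_odd[OF s, of 0 1] by (simp add: eq eval_nat_numeral)
  have "normal_moment v 4 = fact 4 / ((2 / (v/2))^2 * fact 2)"
    using integral_normal_moment_even[OF s, of 0 2] v by (simp add: eq)
  then show "normal_moment v 4 = 3 * v\<^sup>2 / 4"
    using v by (simp add: fact_numeral power2_eq_square field_simps)
qed

text \<open>The binomial expansion of x + \<i> y and of its conjugate separates the independent real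
  and imaginary parts, which reduces every mixed moment to real normal moments.\<close>

lemma
  assumes v: "v > 0"
  shows integrable_complex_gaussian_monomial:
      "integrable (complex_gaussian v) (\<lambda>z. z ^ p * cnj z ^ q)"
    and integral_complex_gaussian_monomial:
      "(\<integral>z. z ^ p * cnj z ^ q \<partial>complex_gaussian v) =
        (\<Sum>k\<le>p. \<Sum>l\<le>q. of_nat (p choose k) * of_nat (q choose l) * \<i> ^ (p - k) * (- \<i>) ^ (q - l) *
           of_real (normal_moment v (k + l) * normal_moment v ((p - k) + (q - l))))"
    and prob_space_complex_gaussian: "prob_space (complex_gaussian v)"
proof -
  let ?N = "density lborel (\<lambda>x. ennreal (normal_density 0 (sqrt (v / 2)) x))"
  have s: "sqrt (v / 2) > 0" using v by simp
  interpret N: prob_space ?N by (rule prob_space_normal_density[OF s])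
  interpret NN: pair_prob_space ?N ?N ..
  have C[measurable]: "(\<lambda>(x, y). Complex x y) \<in> measurable (?N \<Otimes>\<^sub>M ?N) borel"
  proof -
    have "(\<lambda>w. complex_of_real (fst w) + \<i> * complex_of_real (snd w)) \<in> measurable (borel \<Otimes>\<^sub>M borel) borel"
      by measurable
    then have "(\<lambda>w. complex_of_real (fst w) + \<i> * complex_of_real (snd w)) \<in> measurable (?N \<Otimes>\<^sub>M ?N) borel"
      by (subst measurable_cong_sets[OF sets_pair_measure_cong refl]) auto
    then show ?thesis by (simp add: case_prod_beta Complex_eq)
  qed
  have mono_meas: "(\<lambda>z. z ^ p * cnj z ^ q) \<in> borel_measurable borel"
    by (intro borel_measurable_continuous_onI continuous_intros)
  have cg: "complex_gaussian v = distr (?N \<Otimes>\<^sub>M ?N) borel (\<lambda>(x, y). Complex x y)"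
    by (simp add: complex_gaussian_def Let_def)
  show "prob_space (complex_gaussian v)" unfolding cg by (rule NN.prob_space_distr[OF C])
  have binom: "(a + b * c) ^ p * (a + b' * c) ^ q =
     (\<Sum>k\<le>p. \<Sum>l\<le>q. of_nat (p choose k) * of_nat (q choose l) * b ^ (p - k) * b' ^ (q - l) *
           (a ^ (k + l) * c ^ ((p - k) + (q - l))))" for a b b' c :: complex
    unfolding binomial_ring sum_product
    by (intro sum.cong refl) (simp only: power_add power_mult_distrib mult_ac)
  have "Complex x y ^ p * cnj (Complex x y) ^ q =
     (\<Sum>k\<le>p. \<Sum>l\<le>q. of_nat (p choose k) * of_nat (q choose l) * \<i> ^ (p - k) * (- \<i>) ^ (q - l) *
           of_real (x ^ (k + l) * y ^ ((p - k) + (q - l))))" for x y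
  proof -
    have 1: "Complex x y = of_real x + \<i> * of_real y" "cnj (Complex x y) = of_real x + (- \<i>) * of_real y"
      by (simp_all add: complex_eq_iff)
    show ?thesis unfolding 1(2) unfolding 1(1) binom by (simp only: of_real_mult of_real_power)
  qed
  then have exp: "(\<lambda>w. (case w of (x, y) \<Rightarrow> Complex x y) ^ p * cnj (case w of (x, y) \<Rightarrow> Complex x y) ^ q) =
     (\<lambda>w. \<Sum>k\<le>p. \<Sum>l\<le>q. of_nat (p choose k) * of_nat (q choose l) * \<i> ^ (p - k) * (- \<i>) ^ (q - l) *
           of_real (case w of (x, y) \<Rightarrow> x ^ (k + l) * y ^ ((p - k) + (q - l))))"
    by (auto simp: fun_eq_iff)
  have int: "integrable (?N \<Otimes>\<^sub>M ?N) (\<lambda>w. complex_of_real (case w of (x, y) \<Rightarrow> x ^ i * y ^ j))" for i j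
    by (intro integrable_of_real NN.integrable_pair_times integrable_normal_power v)
  have val: "(\<integral>w. complex_of_real (case w of (x, y) \<Rightarrow> x ^ i * y ^ j) \<partial>(?N \<Otimes>\<^sub>M ?N)) =
      of_real (normal_moment v i * normal_moment v j)" for i j
    unfolding integral_complex_of_real normal_moment_def
    by (intro arg_cong[where f=of_real] NN.integral_pair_times integrable_normal_power v)
  show "integrable (complex_gaussian v) (\<lambda>z. z ^ p * cnj z ^ q)"
    unfolding cg integrable_distr_eq[OF C mono_meas] exp
    by (intro Bochner_Integration.integrable_sum integrable_mult_right int)
  show "(\<integral>z. z ^ p * cnj z ^ q \<partial>complex_gaussian v) =
        (\<Sum>k\<le>p. \<Sum>l\<le>q. of_nat (p choose k) * of_nat (q choose l) * \<i> ^ (p - k) * (- \<i>) ^ (q - l) *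
           of_real (normal_moment v (k + l) * normal_moment v ((p - k) + (q - l))))"
    unfolding cg integral_distr[OF C mono_meas] exp
    by (subst Bochner_Integration.integral_sum, intro Bochner_Integration.integrable_sum integrable_mult_right int,
        intro sum.cong refl, subst Bochner_Integration.integral_sum, intro integrable_mult_right int,
        intro sum.cong refl, simp only: integral_mult_right_zero val)
qed

text \<open>With the single index \<open>()\<close> the symmetrized coefficient is twice
  \<open>c\<close>, and the fourth-moment clause becomes E|z|^4 = 2 v^2, with equality.\<close>

lemma circular_block_complex_gaussian:
  assumes v: "v > 0"
  shows "circular_block (complex_gaussian v) {()} (\<lambda>_ z. z) v 1"
proof -
  have m: "circ_monomial (\<lambda>_ z. z) xs ys = (\<lambda>z. z ^ length xs * cnj z ^ length ys)" for xs ys :: "unit list"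
    by (auto simp: fun_eq_iff circ_monomial_def prod_list_replicate map_replicate_const)
  note nm = normal_moment_0[OF v] normal_moment_1[OF v] normal_moment_2[OF v] normal_moment_3[OF v] normal_moment_4[OF v]
    normal_moment_1[OF v, unfolded One_nat_def]
  have small: "n = 0 \<or> n = 1 \<or> n = 2" if "n \<le> 2" for n :: nat using that by auto
  have zero: "(\<integral>z. z ^ p * cnj z ^ q \<partial>complex_gaussian v) = 0" if "p \<le> 2" "q \<le> 2" "p \<noteq> q" for p q
    using small[OF that(1)] small[OF that(2)] that(3) unfolding integral_complex_gaussian_monomial[OF v]
    by (elim disjE) (simp_all add: numeral_2_eq_2 nm nm[unfolded numeral_2_eq_2 numeral_3_eq_3])
  have one: "(\<integral>z. z ^ 1 * cnj z ^ 1 \<partial>complex_gaussian v) = of_real v"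
    unfolding integral_complex_gaussian_monomial[OF v] by (simp add: nm nm[unfolded numeral_2_eq_2])
  have two: "(\<integral>z. z ^ 2 * cnj z ^ 2 \<partial>complex_gaussian v) = of_real (2 * v\<^sup>2)"
  proof -
    have nm2: "normal_moment v (Suc (Suc 0)) = v / 2" "normal_moment v (Suc (Suc (Suc 0))) = 0"
      "normal_moment v (Suc (Suc (Suc (Suc 0)))) = 3 * v\<^sup>2 / 4"
      using nm by (simp_all add: eval_nat_numeral)
    show ?thesis
      unfolding integral_complex_gaussian_monomial[OF v]
      by (simp add: numeral_2_eq_2 nm nm2)
  qed
  have four: "(\<integral>z. (cmod (z * z))\<^sup>2 \<partial>complex_gaussian v) = 2 * v\<^sup>2"
  proof -
    have "complex_of_real (\<integral>z. (cmod (z * z))\<^sup>2 \<partial>complex_gaussian v) = (\<integral>z. z ^ 2 * cnj z ^ 2 \<partial>complex_gaussian v)"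
      unfolding integral_complex_of_real[symmetric] complex_norm_square by (simp add: power2_eq_square)
    then show ?thesis unfolding two of_real_eq_iff .
  qed
  show ?thesis unfolding circular_block_def m
  proof (intro conjI allI impI ballI)
    show "(\<integral>z. (cmod (\<Sum>t\<in>{()}. \<Sum>t'\<in>{()}. c t t' * z * z))\<^sup>2 \<partial>complex_gaussian v)
      \<le> 1 * v\<^sup>2 / 2 * (\<Sum>t\<in>{()}. \<Sum>t'\<in>{()}. (cmod (c t t' + c t' t))\<^sup>2)" for c :: "unit \<Rightarrow> unit \<Rightarrow> complex"
    proof -
      have "(\<integral>z. (cmod (c () () * z * z))\<^sup>2 \<partial>complex_gaussian v) = (\<integral>z. (cmod (c () ()))\<^sup>2 * (cmod (z * z))\<^sup>2 \<partial>complex_gaussian v)"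
        by (simp add: norm_mult power_mult_distrib mult_ac)
      also have "\<dots> = (cmod (c () ()))\<^sup>2 * (2 * v\<^sup>2)" by (simp add: four)
      also have "\<dots> = 1 * v\<^sup>2 / 2 * (cmod (c () () + c () ()))\<^sup>2"
        by (simp add: mult_2[symmetric] norm_mult power_mult_distrib)
      finally show ?thesis by simp
    qed
  qed (use zero one prob_space_complex_gaussian[OF v] integrable_complex_gaussian_monomial[OF v] in auto)
qed

lemma borel_measurable_mat_entry:
  assumes "ab \<in> {..<d} \<times> {..<d}"
  shows "(\<lambda>M. M $$ ab) \<in> borel_measurable (mat_borel d)"
proof -
  have "(\<lambda>M. \<lambda>ab\<in>{..<d} \<times> {..<d}. M $$ ab) \<in> measurable (mat_borel d) (\<Pi>\<^sub>M ab\<in>{..<d} \<times> {..<d}. (borel :: complex measure))"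
    unfolding mat_borel_def by (intro measurable_vimage_algebra1) (auto simp: space_PiM)
  from measurable_compose[OF this measurable_component_singleton[OF assms]] show ?thesis
    using assms by simp
qed

lemma space_mat_borel [simp]: "space (mat_borel d) = carrier_mat d d"
  by (simp add: mat_borel_def)

lemma measurable_into_mat_borel:
  assumes "\<And>x. x \<in> space N \<Longrightarrow> f x \<in> carrier_mat d d"
    and "\<And>ab. ab \<in> {..<d} \<times> {..<d} \<Longrightarrow> (\<lambda>x. f x $$ ab) \<in> borel_measurable N"
  shows "f \<in> measurable N (mat_borel d)"
  unfolding mat_borel_def using assms
  by (intro measurable_vimage_algebra2 measurable_restrict) auto

text \<open>The matrix is an image of the product of \<open>d * d\<close> scalar blocks; the indices
  \<open>(ab, ())\<close> that the product creates are renamed to \<open>ab\<close>.\<close>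

lemma circular_block_gaussian_measure:
  assumes d: "d \<ge> 1"
  shows "circular_block (gaussian_measure d) ({..<d} \<times> {..<d}) (\<lambda>ab M. M $$ ab) (1 / real d) 1"
  unfolding gaussian_measure_def
proof (rule circular_block_distr)
  let ?J = "{..<d} \<times> {..<d}"
  have v: "1 / real d > 0" using d by simp
  show "circular_block (Pi\<^sub>M ?J (\<lambda>_. complex_gaussian (1 / real d))) (?J \<times> {()})
     (prod_coord (\<lambda>_ z. z)) (1 / real d) 1"
    by (intro circular_block_product circular_block_complex_gaussian v) auto
  have sb: "sets (complex_gaussian (1 / real d)) = sets borel"
    by (simp add: complex_gaussian_def Let_def)
  have comp: "(\<lambda>\<omega>. \<omega> ab) \<in> borel_measurable (Pi\<^sub>M ?J (\<lambda>_. complex_gaussian (1 / real d)))" if "ab \<in> ?J" for ab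
    using measurable_component_singleton[OF that, of "\<lambda>_. complex_gaussian (1 / real d)"]
    by (simp add: measurable_cong_sets[OF refl sb])
  show "mat d d \<in> measurable (Pi\<^sub>M ?J (\<lambda>_. complex_gaussian (1 / real d))) (mat_borel d)"
    by (rule measurable_into_mat_borel) (use comp in \<open>auto simp: case_prod_beta\<close>)
  show "bij_betw (\<lambda>ab. (ab, ())) ?J (?J \<times> {()})" by (auto simp: bij_betw_def inj_on_def)
  show "(\<lambda>M. M $$ t) \<in> borel_measurable (mat_borel d)" if "t \<in> ?J" for t
    by (rule borel_measurable_mat_entry[OF that])
  show "mat d d \<omega> $$ t = prod_coord (\<lambda>_ z. z) (t, ()) \<omega>" if "t \<in> ?J" for t \<omega>
    using that by (auto simp: prod_coord_def)
qed

section \<open>Haar-distributed matrices\<close>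

text \<open>Orthonormal rows make the adjoint a right inverse, and a one-sided inverse of a square
  matrix is two-sided.\<close>

lemma unitary_groupI:
  assumes U: "U \<in> carrier_mat d d"
    and "\<And>a c. a < d \<Longrightarrow> c < d \<Longrightarrow> (\<Sum>p<d. U $$ (a, p) * cnj (U $$ (c, p))) = (if a = c then 1 else 0)"
  shows "U \<in> unitary_group d"
proof -
  have adj: "mat_adjoint U \<in> carrier_mat d d" using U by (auto simp: mat_adjoint_def)
  have "U * mat_adjoint U = 1\<^sub>m d"
  proof (rule eq_matI)
    fix i j assume "i < dim_row (1\<^sub>m d :: complex mat)" "j < dim_col (1\<^sub>m d :: complex mat)"
    then have ij: "i < d" "j < d" by auto
    have "(U * mat_adjoint U) $$ (i, j) = (\<Sum>p<d. U $$ (i, p) * cnj (U $$ (j, p)))"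
      using U ij by (auto simp: mat_adjoint_def scalar_prod_def atLeast0LessThan mat_of_rows_def intro!: sum.cong)
    then show "(U * mat_adjoint U) $$ (i, j) = 1\<^sub>m d $$ (i, j)" using assms(2)[OF ij] ij by simp
  qed (use U adj in auto)
  moreover from this have "mat_adjoint U * U = 1\<^sub>m d" by (rule mat_mult_left_right_inverse[OF U adj])
  ultimately show ?thesis using U by (simp add: unitary_group_def)
qed

lemma unitary_group_columns:
  assumes U: "U \<in> unitary_group d" and b: "b < d" "e < d"
  shows "(\<Sum>a<d. U $$ (a, b) * cnj (U $$ (a, e))) = (if b = e then 1 else 0)"
proof -
  have C: "U \<in> carrier_mat d d" and eq: "mat_adjoint U * U = 1\<^sub>m d" using U by (auto simp: unitary_group_def)
  have "(mat_adjoint U * U) $$ (e, b) = (\<Sum>a<d. cnj (U $$ (a, e)) * U $$ (a, b))"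
    using C b by (auto simp: mat_adjoint_def scalar_prod_def atLeast0LessThan mat_of_rows_def intro!: sum.cong)
  then show ?thesis unfolding eq using b by (auto simp: mult.commute)
qed

text \<open>The columns are unit vectors. Monomials in the entries are thus bounded almost surely,
  which is the source of integrability under the Haar law.\<close>

lemma unitary_group_entry_le_1:
  assumes U: "U \<in> unitary_group d" and "a < d" "b < d"
  shows "cmod (U $$ (a, b)) \<le> 1"
proof -
  have "complex_of_real (\<Sum>p<d. (cmod (U $$ (p, b)))\<^sup>2) = 1"
    using unitary_group_columns[OF U \<open>b < d\<close> \<open>b < d\<close>]
    by (simp only: of_real_sum complex_norm_square if_True simp_thms)
  then have "(\<Sum>p<d. (cmod (U $$ (p, b)))\<^sup>2) = 1" by (metis of_real_eq_1_iff)
  moreover have "(cmod (U $$ (a, b)))\<^sup>2 \<le> (\<Sum>p<d. (cmod (U $$ (p, b)))\<^sup>2)"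
    using assms by (intro member_le_sum) auto
  ultimately show ?thesis by (simp add: abs_square_le_1)
qed

lemma prod_list_norm_le_1:
  fixes f :: "'a \<Rightarrow> complex"
  shows "(\<And>x. x \<in> set xs \<Longrightarrow> cmod (f x) \<le> 1) \<Longrightarrow> cmod (\<Prod>x\<leftarrow>xs. f x) \<le> 1"
proof (induction xs)
  case (Cons x xs)
  then show ?case by (simp add: norm_mult mult_le_one)
qed simp

context
  fixes d :: nat and \<mu> :: "complex mat measure"
  assumes haar: "haar_measure d \<mu>"
begin

interpretation prob_space \<mu> using haar by (simp add: haar_measure_def)

abbreviation "entry \<equiv> \<lambda>ab M. M $$ ab :: complex"

lemma haar_sets: "sets \<mu> = sets (mat_borel d)" using haar by (simp add: haar_measure_def)

lemma haar_space: "space \<mu> = carrier_mat d d"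
  using sets_eq_imp_space_eq[OF haar_sets] by simp

lemma haar_AE_unitary: "AE M in \<mu>. M \<in> unitary_group d"
proof -
  have "emeasure \<mu> (unitary_group d) = 1" using haar by (simp add: haar_measure_def)
  then have "prob (unitary_group d) = 1" by (simp add: measure_def)
  then show ?thesis by (rule AE_prob_1)
qed

lemma haar_entry_measurable:
  "a < d \<Longrightarrow> b < d \<Longrightarrow> (\<lambda>M. M $$ (a, b)) \<in> borel_measurable \<mu>"
  using borel_measurable_mat_entry[of "(a, b)" d] by (simp add: measurable_cong_sets[OF haar_sets refl])

lemma haar_monomial_measurable:
  assumes "set xs \<subseteq> {..<d} \<times> {..<d}" "set ys \<subseteq> {..<d} \<times> {..<d}"
  shows "circ_monomial entry xs ys \<in> borel_measurable (mat_borel d)"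
  using assms by (intro circ_monomial_measurable borel_measurable_mat_entry) auto

lemma haar_monomial_integrable:
  assumes "set xs \<subseteq> {..<d} \<times> {..<d}" "set ys \<subseteq> {..<d} \<times> {..<d}"
  shows "integrable \<mu> (circ_monomial entry xs ys)"
proof (rule integrable_const_bound[where B = 1])
  show "AE M in \<mu>. norm (circ_monomial entry xs ys M) \<le> 1"
    using haar_AE_unitary
  proof eventually_elim
    case (elim M)
    have "cmod (\<Prod>x\<leftarrow>zs. F (M $$ x)) \<le> 1" if "set zs \<subseteq> {..<d} \<times> {..<d}" "\<And>z. cmod (F z) = cmod z" for zs F
      using that unitary_group_entry_le_1[OF elim] by (intro prod_list_norm_le_1) auto
    from this[OF assms(1), of "\<lambda>x. x"] this[OF assms(2), of cnj] show ?case
      by (simp add: circ_monomial_def norm_mult mult_le_one)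
  qed
  show "circ_monomial entry xs ys \<in> borel_measurable \<mu>"
    using haar_monomial_measurable[OF assms] by (simp add: measurable_cong_sets[OF haar_sets refl])
qed

lemma haar_left_invariant:
  fixes f :: "complex mat \<Rightarrow> complex"
  assumes U: "U \<in> unitary_group d" and f: "f \<in> borel_measurable (mat_borel d)"
  shows "(\<integral>M. f (U * M) \<partial>\<mu>) = integral\<^sup>L \<mu> f"
proof -
  have C: "U \<in> carrier_mat d d" using U by (auto simp: unitary_group_def)
  have meas: "(\<lambda>M. U * M) \<in> measurable \<mu> (mat_borel d)"
  proof (rule measurable_into_mat_borel)
    fix ab assume ab: "ab \<in> {..<d} \<times> {..<d}"
    have "(\<lambda>M. \<Sum>p<d. U $$ (fst ab, p) * M $$ (p, snd ab)) \<in> borel_measurable \<mu>"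
      using ab by (intro borel_measurable_sum borel_measurable_times borel_measurable_const haar_entry_measurable) auto
    then show "(\<lambda>M. (U * M) $$ ab) \<in> borel_measurable \<mu>"
      by (rule measurable_cong[THEN iffD1, rotated])
         (use C ab in \<open>auto simp: haar_space scalar_prod_def atLeast0LessThan intro!: sum.cong\<close>)
  qed (use C in \<open>auto simp: haar_space\<close>)
  have inv: "distr \<mu> (mat_borel d) (\<lambda>M. U * M) = \<mu>" using haar U by (simp add: haar_measure_def)
  have "integral\<^sup>L \<mu> f = integral\<^sup>L (distr \<mu> (mat_borel d) (\<lambda>M. U * M)) f" by (simp add: inv)
  also have "\<dots> = (\<integral>M. f (U * M) \<partial>\<mu>)" by (rule integral_distr[OF meas f])
  finally show ?thesis by simp
qed

text \<open>Invariance is applied to a generalized permutation matrix with phases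
  \<open>\<theta>\<close>: after left multiplication, row \<open>a\<close> is
  \<open>\<theta> a\<close> times the old row \<open>\<pi> a\<close>.\<close>

lemma haar_monomial_transform:
  assumes \<pi>: "\<pi> permutes {..<d}" and \<theta>: "\<And>a. cmod (\<theta> a) = 1"
    and xs: "set xs \<subseteq> {..<d} \<times> {..<d}" and ys: "set ys \<subseteq> {..<d} \<times> {..<d}"
  shows "integral\<^sup>L \<mu> (circ_monomial entry xs ys) =
    (\<Prod>x\<leftarrow>xs. \<theta> (fst x)) * (\<Prod>y\<leftarrow>ys. cnj (\<theta> (fst y))) *
    integral\<^sup>L \<mu> (circ_monomial entry (map (apfst \<pi>) xs) (map (apfst \<pi>) ys))"
proof -
  define U where "U = mat d d (\<lambda>(a, p). if p = \<pi> a then \<theta> a else 0)"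
  have C: "U \<in> carrier_mat d d" by (simp add: U_def)
  have \<pi>d: "\<pi> a < d" if "a < d" for a using permutes_in_image[OF \<pi>, of a] that by simp
  have inj: "\<pi> a = \<pi> c \<longleftrightarrow> a = c" for a c using permutes_inj[OF \<pi>] by (auto simp: inj_def)
  have U: "U \<in> unitary_group d"
  proof (rule unitary_groupI[OF C])
    fix a c assume ac: "a < d" "c < d"
    have "(\<Sum>p<d. U $$ (a, p) * cnj (U $$ (c, p))) = (\<Sum>p<d. if p = \<pi> a then (if a = c then \<theta> a * cnj (\<theta> c) else 0) else 0)"
      using ac inj by (intro sum.cong) (auto simp: U_def)
    also have "\<dots> = (if a = c then 1 else 0)"
      using \<pi>d[OF ac(1)] \<theta>[of a] complex_norm_square[of "\<theta> a"] by (auto simp: sum.delta)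
    finally show "(\<Sum>p<d. U $$ (a, p) * cnj (U $$ (c, p))) = (if a = c then 1 else 0)" .
  qed
  have act: "(U * M) $$ x = \<theta> (fst x) * M $$ apfst \<pi> x" if M: "M \<in> carrier_mat d d" and xd: "x \<in> {..<d} \<times> {..<d}" for M x
  proof -
    obtain a b where x: "x = (a, b)" "a < d" "b < d" using xd by auto
    have "(U * M) $$ x = (\<Sum>p<d. U $$ (a, p) * M $$ (p, b))"
      using C M x by (auto simp: scalar_prod_def atLeast0LessThan intro!: sum.cong)
    also have "\<dots> = (\<Sum>p<d. if p = \<pi> a then \<theta> a * M $$ (p, b) else 0)"
      using x by (intro sum.cong) (auto simp: U_def)
    also have "\<dots> = \<theta> a * M $$ (\<pi> a, b)" using \<pi>d[OF x(2)] by (simp add: sum.delta)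
    finally show ?thesis using x by simp
  qed
  have "integral\<^sup>L \<mu> (circ_monomial entry xs ys) = (\<integral>M. circ_monomial entry xs ys (U * M) \<partial>\<mu>)"
    by (rule haar_left_invariant[OF U haar_monomial_measurable[OF xs ys], symmetric])
  also have "\<dots> = (\<integral>M. (\<Prod>x\<leftarrow>xs. \<theta> (fst x)) * (\<Prod>y\<leftarrow>ys. cnj (\<theta> (fst y))) *
      circ_monomial entry (map (apfst \<pi>) xs) (map (apfst \<pi>) ys) M \<partial>\<mu>)"
  proof (intro Bochner_Integration.integral_cong refl)
    fix M assume "M \<in> space \<mu>"
    then have M: "M \<in> carrier_mat d d" by (simp add: haar_space)
    have *: "(\<Prod>x\<leftarrow>zs. F ((U * M) $$ x)) = (\<Prod>x\<leftarrow>zs. F (\<theta> (fst x))) * (\<Prod>x\<leftarrow>map (apfst \<pi>) zs. F (M $$ x))"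
      if "set zs \<subseteq> {..<d} \<times> {..<d}" "\<And>x y. F (x * y) = F x * F y" for zs and F :: "complex \<Rightarrow> complex"
      using that(1)
    proof (induction zs)
      case (Cons z zs)
      have "F ((U * M) $$ z) = F (\<theta> (fst z)) * F (M $$ apfst \<pi> z)"
        using act[OF M, of z] Cons.prems that(2) by simp
      then show ?case using Cons by (simp add: mult_ac)
    qed simp
    show "circ_monomial entry xs ys (U * M) = (\<Prod>x\<leftarrow>xs. \<theta> (fst x)) * (\<Prod>y\<leftarrow>ys. cnj (\<theta> (fst y))) *
      circ_monomial entry (map (apfst \<pi>) xs) (map (apfst \<pi>) ys) M"
      unfolding circ_monomial_def using *[OF xs, of "\<lambda>x. x"] *[OF ys, of cnj] by (simp add: mult_ac)
  qed
  also have "\<dots> = (\<Prod>x\<leftarrow>xs. \<theta> (fst x)) * (\<Prod>y\<leftarrow>ys. cnj (\<theta> (fst y))) *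
    integral\<^sup>L \<mu> (circ_monomial entry (map (apfst \<pi>) xs) (map (apfst \<pi>) ys))" by simp
  finally show ?thesis .
qed

lemma haar_row_unbalanced:
  assumes xs: "set xs \<subseteq> {..<d} \<times> {..<d}" "length xs \<le> 2" and ys: "set ys \<subseteq> {..<d} \<times> {..<d}" "length ys \<le> 2"
    and k: "length (proj_list k xs) \<noteq> length (proj_list k ys)"
  shows "integral\<^sup>L \<mu> (circ_monomial entry xs ys) = 0"
proof -
  \<comment> \<open>Scaling row \<open>k\<close> by \<i> multiplies the moment by \<i> to the power
    of the difference of the two counts. This difference is nonzero and at most 2 in modulus, so the
    factor is not 1; the phase -1 would miss a difference of 2.\<close>
  let ?\<theta> = "\<lambda>a. if a = k then \<i> else 1"
  have p: "(\<Prod>x\<leftarrow>zs. F (?\<theta> (fst x))) = F \<i> ^ length (proj_list k zs)" if "F 1 = 1" for zs :: "(nat \<times> nat) list" and F :: "complex \<Rightarrow> complex"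
    using that by (induction zs) auto
  have "integral\<^sup>L \<mu> (circ_monomial entry xs ys) =
    (\<Prod>x\<leftarrow>xs. ?\<theta> (fst x)) * (\<Prod>y\<leftarrow>ys. cnj (?\<theta> (fst y))) *
    integral\<^sup>L \<mu> (circ_monomial entry (map (apfst id) xs) (map (apfst id) ys))"
    by (rule haar_monomial_transform[OF permutes_id _ xs(1) ys(1)]) simp
  also have "\<dots> = \<i> ^ length (proj_list k xs) * (- \<i>) ^ length (proj_list k ys) * integral\<^sup>L \<mu> (circ_monomial entry xs ys)"
    using p[of "\<lambda>x. x" xs] p[of cnj ys] by simp
  finally have eq: "integral\<^sup>L \<mu> (circ_monomial entry xs ys) = \<dots>" .
  have small: "n = 0 \<or> n = 1 \<or> n = 2" if "n \<le> 2" for n :: nat using that by auto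
  have "length (proj_list k xs) \<le> 2" "length (proj_list k ys) \<le> 2"
    using length_proj_list_le[of k xs] length_proj_list_le[of k ys] xs ys by auto
  from small[OF this(1)] small[OF this(2)] have "\<i> ^ length (proj_list k xs) * (- \<i>) ^ length (proj_list k ys) \<noteq> 1"
    using k by (auto simp: complex_eq_iff power2_eq_square)
  then show ?thesis using eq by (metis mult_cancel_right1)
qed

lemma haar_unbalanced:
  assumes xs: "set xs \<subseteq> {..<d} \<times> {..<d}" "length xs \<le> 2" and ys: "set ys \<subseteq> {..<d} \<times> {..<d}" "length ys \<le> 2"
    and "length xs \<noteq> length ys"
  shows "integral\<^sup>L \<mu> (circ_monomial entry xs ys) = 0"
proof -
  have "(\<Sum>j<d. length (proj_list j xs)) \<noteq> (\<Sum>j<d. length (proj_list j ys))"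
    using length_eq_sum_proj_list[OF _ xs(1)] length_eq_sum_proj_list[OF _ ys(1)] assms by simp
  then obtain j where "length (proj_list j xs) \<noteq> length (proj_list j ys)"
    by (meson sum.cong)
  then show ?thesis by (rule haar_row_unbalanced[OF xs ys])
qed

lemma haar_permute_rows:
  assumes \<pi>: "\<pi> permutes {..<d}"
    and xs: "set xs \<subseteq> {..<d} \<times> {..<d}" and ys: "set ys \<subseteq> {..<d} \<times> {..<d}"
  shows "integral\<^sup>L \<mu> (circ_monomial entry xs ys) =
    integral\<^sup>L \<mu> (circ_monomial entry (map (apfst \<pi>) xs) (map (apfst \<pi>) ys))"
  using haar_monomial_transform[OF \<pi> _ xs ys, of "\<lambda>_. 1"] by (simp add: map_replicate_const)

text \<open>Different rows are unbalanced. For equal rows the moment does not depend on the row, and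
  its sum over all rows is the inner product of two columns, which is constant on the unitary
  group.\<close>

lemma haar_second:
  assumes "x \<in> {..<d} \<times> {..<d}" "y \<in> {..<d} \<times> {..<d}"
  shows "integral\<^sup>L \<mu> (circ_monomial entry [x] [y]) = (if x = y then of_real (1 / real d) else 0)"
proof -
  obtain a b c e where x: "x = (a, b)" "y = (c, e)" and lt: "a < d" "b < d" "c < d" "e < d" using assms by auto
  show ?thesis
  proof (cases "a = c")
    case False
    then show ?thesis unfolding x using lt by (subst haar_row_unbalanced[of _ _ a]) auto
  next
    case True
    have const: "integral\<^sup>L \<mu> (circ_monomial entry [(p, b)] [(p, e)]) = integral\<^sup>L \<mu> (circ_monomial entry [(a, b)] [(a, e)])" if "p < d" for p
      using haar_permute_rows[of "Transposition.transpose p a" "[(p, b)]" "[(p, e)]"] that lt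
      by (simp add: permutes_swap_id)
    have "of_nat d * integral\<^sup>L \<mu> (circ_monomial entry [(a, b)] [(a, e)]) = (\<Sum>p<d. integral\<^sup>L \<mu> (circ_monomial entry [(p, b)] [(p, e)]))"
      by (simp add: const)
    also have "\<dots> = (\<integral>M. (\<Sum>p<d. circ_monomial entry [(p, b)] [(p, e)] M) \<partial>\<mu>)"
      using lt by (intro Bochner_Integration.integral_sum[symmetric] haar_monomial_integrable) auto
    also have "\<dots> = (\<integral>M. (if b = e then 1 else 0) \<partial>\<mu>)"
    proof (rule integral_cong_AE)
      show "(\<lambda>M. \<Sum>p<d. circ_monomial entry [(p, b)] [(p, e)] M) \<in> borel_measurable \<mu>"
        using lt by (intro borel_measurable_sum borel_measurable_integrable haar_monomial_integrable) auto
      show "AE M in \<mu>. (\<Sum>p<d. circ_monomial entry [(p, b)] [(p, e)] M) = (if b = e then 1 else 0)"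
        using haar_AE_unitary by eventually_elim (use unitary_group_columns lt in \<open>auto simp: circ_monomial_def\<close>)
    qed auto
    also have "\<dots> = (if b = e then 1 else 0)" by (simp add: prob_space)
    finally show ?thesis using lt True by (auto simp: x field_simps split: if_splits)
  qed
qed

end

text \<open>Two-transitivity of the row permutations, normalized to start from rows 0 and 1. The
  transposition \<open>?q\<close> fixes 0 because \<open>?p c\<close> differs from
  \<open>?p a = 0\<close>.\<close>

lemma permutes_pair_exists:
  assumes "a < d" "c < d" "a \<noteq> c"
  obtains \<pi> where "\<pi> permutes {..<d}" "\<pi> 0 = a" "\<pi> (Suc 0) = c"
proof -
  let ?p = "Transposition.transpose 0 a"
  let ?q = "Transposition.transpose (Suc 0) (?p c)"
  have d: "Suc 0 < d" using assms by auto
  have p: "?p permutes {..<d}" using assms d by (intro permutes_swap_id) auto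
  have "?p c < d" using permutes_in_image[OF p, of c] assms by simp
  then have q: "?q permutes {..<d}" using d by (intro permutes_swap_id) auto
  have "?p c \<noteq> ?p a" using assms(3) by (metis Transposition.transpose_involutory)
  then have "?q 0 = 0" by (intro Transposition.transpose_apply_other) auto
  then have "(?p \<circ> ?q) 0 = a" by simp
  moreover have "(?p \<circ> ?q) (Suc 0) = c" by simp
  ultimately show ?thesis by (rule that[OF permutes_compose[OF q p]])
qed

text \<open>The 2 x 2 Hadamard matrix on the indices 0 and 1, padded by the identity. Permutations
  and phases cannot relate a moment with two equal rows to moments with two distinct rows; this
  unitary matrix does.\<close>

definition hadamard_block :: "nat \<Rightarrow> complex mat" where
  "hadamard_block d = mat d d (\<lambda>(i, j).
     if i < 2 \<and> j < 2 then of_real (if i = 1 \<and> j = 1 then - (1 / sqrt 2) else 1 / sqrt 2)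
     else if i = j then 1 else 0)"

lemma hadamard_block_sum:
  assumes d: "d \<ge> 2" and i: "i < d"
  shows "(\<Sum>p<d. hadamard_block d $$ (i, p) * f p) =
    (if i = 0 then of_real (1 / sqrt 2) * (f 0 + f 1)
     else if i = 1 then of_real (1 / sqrt 2) * (f 0 - f 1) else f i)"
proof -
  have split: "{..<d} = {0, 1} \<union> {2..<d}" using d by auto
  have "(\<Sum>p<d. hadamard_block d $$ (i, p) * f p) =
     hadamard_block d $$ (i, 0) * f 0 + hadamard_block d $$ (i, 1) * f 1 + (\<Sum>p\<in>{2..<d}. hadamard_block d $$ (i, p) * f p)"
    unfolding split by (subst sum.union_disjoint) auto
  also have "(\<Sum>p\<in>{2..<d}. hadamard_block d $$ (i, p) * f p) = (\<Sum>p\<in>{2..<d}. if p = i then f p else 0)"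
    using i by (intro sum.cong) (auto simp: hadamard_block_def)
  also have "\<dots> = (if i \<ge> 2 then f i else 0)" using i by simp
  finally have eq: "(\<Sum>p<d. hadamard_block d $$ (i, p) * f p) = hadamard_block d $$ (i, 0) * f 0 +
    hadamard_block d $$ (i, 1) * f 1 + (if i \<ge> 2 then f i else 0)" .
  consider "i = 0" | "i = 1" | "i \<ge> 2" by linarith
  then show ?thesis
  proof cases
    case 1
    then show ?thesis unfolding eq using d by (simp add: hadamard_block_def distrib_left)
  next
    case 2
    then show ?thesis unfolding eq using d by (simp add: hadamard_block_def right_diff_distrib)
  next
    case 3
    then show ?thesis unfolding eq using d i by (simp add: hadamard_block_def)
  qed
qed

lemma hadamard_block_unitary:
  assumes d: "d \<ge> 2"
  shows "hadamard_block d \<in> unitary_group d"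
proof (rule unitary_groupI)
  have half: "complex_of_real (1 / sqrt 2) * complex_of_real (1 / sqrt 2) = 1 / 2"
    by (simp flip: of_real_mult)
  fix a c assume ac: "a < d" "c < d"
  have cnj: "cnj (hadamard_block d $$ (c, p)) = hadamard_block d $$ (c, p)" if "p < d" for p
    using that ac by (simp add: hadamard_block_def)
  have "(\<Sum>p<d. hadamard_block d $$ (a, p) * cnj (hadamard_block d $$ (c, p))) =
    (\<Sum>p<d. hadamard_block d $$ (a, p) * hadamard_block d $$ (c, p))"
    by (intro sum.cong refl) (simp add: cnj)
  also have "\<dots> = (if a = c then 1 else 0)"
    unfolding hadamard_block_sum[OF d ac(1)]
    using d ac half by (auto simp: hadamard_block_def)
  finally show "(\<Sum>p<d. hadamard_block d $$ (a, p) * cnj (hadamard_block d $$ (c, p))) = (if a = c then 1 else 0)" .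
qed (simp add: hadamard_block_def)

section \<open>Fourth moments of a Haar matrix\<close>

context
  fixes d :: nat and \<mu> :: "complex mat measure"
  assumes haar: "haar_measure d \<mu>" and d2: "d \<ge> 2"
begin

interpretation prob_space \<mu> using haar by (simp add: haar_measure_def)

text \<open>The columns come first: they stay fixed while the rows are permuted, mixed and summed
  over.\<close>

abbreviation "haar4 b e b' e' a c a' c' \<equiv>
  integral\<^sup>L \<mu> (circ_monomial (\<lambda>ab M. M $$ ab) [(a, b), (c, e)] [(a', b'), (c', e')])"

context
  fixes b e b' e' :: nat
  assumes lt: "b < d" "e < d" "b' < d" "e' < d"
begin

text \<open>The multisets {a, c} and {a', c'} differ, so some row is unbalanced.\<close>

lemma haar4_zero:
  assumes "a < d" "c < d" "a' < d" "c' < d" "\<not> (a = a' \<and> c = c')" "\<not> (a = c' \<and> c = a')"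
  shows "haar4 b e b' e' a c a' c' = 0"
proof -
  have cnt: "length (proj_list k [(x,u),(y,w)]) = (if x = k then 1 else 0) + (if y = k then 1 else 0)"
    for k x y and u w :: nat by simp
  have "length (proj_list a [(a,b),(c,e)]) \<noteq> length (proj_list a [(a',b'),(c',e')]) \<or>
     length (proj_list c [(a,b),(c,e)]) \<noteq> length (proj_list c [(a',b'),(c',e')])"
    unfolding cnt using assms(5,6) by presburger
  moreover have sub: "set [(a,b),(c,e)] \<subseteq> {..<d} \<times> {..<d}" "set [(a',b'),(c',e')] \<subseteq> {..<d} \<times> {..<d}"
    using assms(1-4) lt by auto
  note h = haar_row_unbalanced[OF haar sub(1) _ sub(2)]
  ultimately show ?thesis by (elim disjE) (erule h[rotated 2], simp, simp)+
qed

lemma haar4_permute: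
  assumes "\<pi> permutes {..<d}" "a < d" "c < d" "a' < d" "c' < d"
  shows "haar4 b e b' e' a c a' c' = haar4 b e b' e' (\<pi> a) (\<pi> c) (\<pi> a') (\<pi> c')"
  using haar_permute_rows[OF haar assms(1), of "[(a, b), (c, e)]" "[(a', b'), (c', e')]"] assms lt by simp

text \<open>Invariance under \<open>hadamard_block\<close> turns the moment z with all letters in
  row 0 into 1/4 of the sum over all choices of rows 0 and 1 in the four places. Ten of the sixteen
  terms are unbalanced. Up to exchanging the two rows the others are z, x, y, twice each, where x
  and y are the straight and the crossed moment; and z = (2 z + 2 x + 2 y) / 4 gives z = x +
  y.\<close>

lemma haar4_diagonal:
  "haar4 b e b' e' 0 0 0 0 = haar4 b e b' e' 0 1 0 1 + haar4 b e b' e' 0 1 1 0"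
proof -
  let ?e = "\<lambda>ab M. M $$ ab :: complex"
  let ?I = "{0, 1::nat}"
  have C: "hadamard_block d \<in> carrier_mat d d" by (simp add: hadamard_block_def)
  define s where "s = complex_of_real (1 / sqrt 2)"
  have row: "(hadamard_block d * M) $$ (0, q) = s * (\<Sum>p\<in>?I. M $$ (p, q))"
    if M: "M \<in> carrier_mat d d" and q: "q < d" for M q
  proof -
    have "(hadamard_block d * M) $$ (0, q) = (\<Sum>p<d. hadamard_block d $$ (0, p) * M $$ (p, q))"
      using C M q d2 by (auto simp: scalar_prod_def atLeast0LessThan intro!: sum.cong)
    also have "\<dots> = s * (M $$ (0, q) + M $$ (1, q))"
      using d2 by (subst hadamard_block_sum) (auto simp: s_def)
    finally show ?thesis by simp
  qed
  have quarter: "s * s * (s * s) = 1 / 4" and cnj_s: "cnj s = s"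
    unfolding s_def by (simp_all flip: of_real_mult)
  have int: "integrable \<mu> (circ_monomial ?e [(p, b), (q, e)] [(r, b'), (s, e')])"
    if "p \<in> ?I" "q \<in> ?I" "r \<in> ?I" "s \<in> ?I" for p q r s
    using that lt d2 by (intro haar_monomial_integrable[OF haar]) auto
  have "haar4 b e b' e' 0 0 0 0 = (\<integral>M. circ_monomial ?e [(0, b), (0, e)] [(0, b'), (0, e')] (hadamard_block d * M) \<partial>\<mu>)"
    using lt d2 by (intro haar_left_invariant[OF haar hadamard_block_unitary[OF d2], symmetric]
        haar_monomial_measurable[OF haar]) auto
  also have "\<dots> = (\<integral>M. 1 / 4 * (\<Sum>p\<in>?I. \<Sum>q\<in>?I. \<Sum>r\<in>?I. \<Sum>s\<in>?I. circ_monomial ?e [(p, b), (q, e)] [(r, b'), (s, e')] M) \<partial>\<mu>)"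
  proof (intro Bochner_Integration.integral_cong refl)
    fix M assume "M \<in> space \<mu>"
    then have M: "M \<in> carrier_mat d d" by (simp add: haar_space[OF haar])
    have "circ_monomial ?e [(0, b), (0, e)] [(0, b'), (0, e')] (hadamard_block d * M) =
       (s * s * (s * s)) *
       ((\<Sum>p\<in>?I. M $$ (p, b)) * (\<Sum>p\<in>?I. M $$ (p, e)) * (cnj (\<Sum>p\<in>?I. M $$ (p, b')) * cnj (\<Sum>p\<in>?I. M $$ (p, e'))))"
      by (simp only: circ_monomial_def list.map prod_list.Cons prod_list.Nil mult_1_right mult_1_left
          row[OF M lt(1)] row[OF M lt(2)] row[OF M lt(3)] row[OF M lt(4)] complex_cnj_mult cnj_s mult_ac)
    also have "(\<Sum>p\<in>?I. M $$ (p, b)) * (\<Sum>p\<in>?I. M $$ (p, e)) * (cnj (\<Sum>p\<in>?I. M $$ (p, b')) * cnj (\<Sum>p\<in>?I. M $$ (p, e')))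
       = (\<Sum>p\<in>?I. \<Sum>q\<in>?I. \<Sum>r\<in>?I. \<Sum>s\<in>?I. circ_monomial ?e [(p, b), (q, e)] [(r, b'), (s, e')] M)"
    proof -
      have "(\<Sum>p\<in>I. f p) * (\<Sum>p\<in>I. g p) * (cnj (\<Sum>p\<in>I. h p) * cnj (\<Sum>p\<in>I. k p)) =
        (\<Sum>p\<in>I. \<Sum>q\<in>I. \<Sum>r\<in>I. \<Sum>s\<in>I. f p * g q * (cnj (h r) * cnj (k s)))" for f g h k and I :: "nat set"
        by (simp only: cnj_sum sum_distrib_left[symmetric] sum_distrib_right[symmetric])
      then show ?thesis by (simp only: circ_monomial_def list.map prod_list.Cons prod_list.Nil mult_1_right)
    qed
    finally show "circ_monomial ?e [(0, b), (0, e)] [(0, b'), (0, e')] (hadamard_block d * M) =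
      1 / 4 * (\<Sum>p\<in>?I. \<Sum>q\<in>?I. \<Sum>r\<in>?I. \<Sum>s\<in>?I. circ_monomial ?e [(p, b), (q, e)] [(r, b'), (s, e')] M)"
      unfolding quarter .
  qed
  also have "\<dots> = 1 / 4 * (\<Sum>p\<in>?I. \<Sum>q\<in>?I. \<Sum>r\<in>?I. \<Sum>s\<in>?I. haar4 b e b' e' p q r s)"
  proof -
    let ?F = "\<lambda>p q r s M. circ_monomial ?e [(p, b), (q, e)] [(r, b'), (s, e')] M"
    have i3: "integrable \<mu> (\<lambda>M. \<Sum>s\<in>?I. ?F p q r s M)" if "p \<in> ?I" "q \<in> ?I" "r \<in> ?I" for p q r
      by (intro Bochner_Integration.integrable_sum int that)
    have i2: "integrable \<mu> (\<lambda>M. \<Sum>r\<in>?I. \<Sum>s\<in>?I. ?F p q r s M)" if "p \<in> ?I" "q \<in> ?I" for p q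
      by (intro Bochner_Integration.integrable_sum i3 that)
    have i1: "integrable \<mu> (\<lambda>M. \<Sum>q\<in>?I. \<Sum>r\<in>?I. \<Sum>s\<in>?I. ?F p q r s M)" if "p \<in> ?I" for p
      by (intro Bochner_Integration.integrable_sum i2 that)
    have "(\<integral>M. (\<Sum>p\<in>?I. \<Sum>q\<in>?I. \<Sum>r\<in>?I. \<Sum>s\<in>?I. ?F p q r s M) \<partial>\<mu>) =
       (\<Sum>p\<in>?I. \<integral>M. (\<Sum>q\<in>?I. \<Sum>r\<in>?I. \<Sum>s\<in>?I. ?F p q r s M) \<partial>\<mu>)"
      by (rule Bochner_Integration.integral_sum) (rule i1)
    also have "\<dots> = (\<Sum>p\<in>?I. \<Sum>q\<in>?I. \<integral>M. (\<Sum>r\<in>?I. \<Sum>s\<in>?I. ?F p q r s M) \<partial>\<mu>)"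
      by (intro sum.cong refl Bochner_Integration.integral_sum i2)
    also have "\<dots> = (\<Sum>p\<in>?I. \<Sum>q\<in>?I. \<Sum>r\<in>?I. \<integral>M. (\<Sum>s\<in>?I. ?F p q r s M) \<partial>\<mu>)"
      by (intro sum.cong refl Bochner_Integration.integral_sum i3)
    also have "\<dots> = (\<Sum>p\<in>?I. \<Sum>q\<in>?I. \<Sum>r\<in>?I. \<Sum>s\<in>?I. integral\<^sup>L \<mu> (?F p q r s))"
      by (intro sum.cong refl Bochner_Integration.integral_sum int)
    finally show ?thesis by (simp only: integral_mult_right_zero)
  qed
  also have "(\<Sum>p\<in>?I. \<Sum>q\<in>?I. \<Sum>r\<in>?I. \<Sum>s\<in>?I. haar4 b e b' e' p q r s) =
     haar4 b e b' e' 0 0 0 0 + haar4 b e b' e' 1 1 1 1 +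
     (haar4 b e b' e' 0 1 0 1 + haar4 b e b' e' 1 0 1 0) + (haar4 b e b' e' 0 1 1 0 + haar4 b e b' e' 1 0 0 1)"
  proof -
    have expand: "(\<Sum>p\<in>?I. \<Sum>q\<in>?I. \<Sum>r\<in>?I. \<Sum>s\<in>?I. H p q r s) =
        H 0 0 0 0 + H 1 1 1 1 + (H 0 1 0 1 + H 1 0 1 0) + (H 0 1 1 0 + H 1 0 0 1)"
      if "H 0 0 0 1 = 0" "H 0 0 1 0 = 0" "H 0 0 1 1 = 0" "H 0 1 0 0 = 0" "H 0 1 1 1 = 0"
        "H 1 0 0 0 = 0" "H 1 0 1 1 = 0" "H 1 1 0 0 = 0" "H 1 1 0 1 = 0" "H 1 1 1 0 = 0"
      for H :: "nat \<Rightarrow> nat \<Rightarrow> nat \<Rightarrow> nat \<Rightarrow> complex"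
      using that by simp
    have "0 < d" "1 < d" using d2 by auto
    show ?thesis
      by (rule expand; rule haar4_zero; (rule \<open>0 < d\<close> | rule \<open>1 < d\<close> | simp only: zero_neq_one one_neq_zero simp_thms))
  qed
  also have "haar4 b e b' e' 1 1 1 1 = haar4 b e b' e' 0 0 0 0"
    using haar4_permute[of "Transposition.transpose 0 1" 1 1 1 1] d2 by (simp add: permutes_swap_id)
  also have "haar4 b e b' e' 1 0 1 0 = haar4 b e b' e' 0 1 0 1"
    using haar4_permute[of "Transposition.transpose 0 1" 1 0 1 0] d2 by (simp add: permutes_swap_id)
  also have "haar4 b e b' e' 1 0 0 1 = haar4 b e b' e' 0 1 1 0"
    using haar4_permute[of "Transposition.transpose 0 1" 1 0 0 1] d2 by (simp add: permutes_swap_id)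
  finally have eq: "haar4 b e b' e' 0 0 0 0 = 1 / 4 * (haar4 b e b' e' 0 0 0 0 + haar4 b e b' e' 0 0 0 0 +
     (haar4 b e b' e' 0 1 0 1 + haar4 b e b' e' 0 1 0 1) + (haar4 b e b' e' 0 1 1 0 + haar4 b e b' e' 0 1 1 0))" .
  have solve: "z = x + y" if "z = 1 / 4 * (z + z + (x + x) + (y + y))" for x y z :: complex
  proof -
    have "2 * z = 2 * (x + y)" using that by (simp add: field_simps)
    then show ?thesis unfolding mult_cancel_left by simp
  qed
  show ?thesis by (rule solve[OF eq])
qed

text \<open>Two-transitivity carries distinct rows to 0 and 1. For equal rows both indicators hold,
  and \<open>haar4_diagonal\<close> says that the two contributions add up to the right
  value.\<close>

lemma haar4_form:
  assumes "a < d" "c < d" "a' < d" "c' < d"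
  shows "haar4 b e b' e' a c a' c' =
    (if a = a' \<and> c = c' then haar4 b e b' e' 0 1 0 1 else 0) +
    (if a = c' \<and> c = a' then haar4 b e b' e' 0 1 1 0 else 0)"
proof (cases "a = c")
  case True
  show ?thesis
  proof (cases "a' = a \<and> c' = a")
    case eq: True
    have "haar4 b e b' e' 0 0 0 0 = haar4 b e b' e' a a a a"
      using haar4_permute[of "Transposition.transpose 0 a" 0 0 0 0] assms d2 by (simp add: permutes_swap_id)
    then show ?thesis using haar4_diagonal True eq by simp
  next
    case False
    then show ?thesis using assms True haar4_zero[of a c a' c'] by auto
  qed
next
  case False
  obtain \<pi> where \<pi>: "\<pi> permutes {..<d}" "\<pi> 0 = a" "\<pi> (Suc 0) = c"
    using permutes_pair_exists[OF assms(1,2) False] .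
  have "haar4 b e b' e' 0 1 0 1 = haar4 b e b' e' a c a c" "haar4 b e b' e' 0 1 1 0 = haar4 b e b' e' a c c a"
    using haar4_permute[OF \<pi>(1), of 0 1 0 1] haar4_permute[OF \<pi>(1), of 0 1 1 0] \<pi>(2,3) d2 by auto
  then show ?thesis using assms False haar4_zero[of a c a' c'] by auto
qed

text \<open>Summing over the rows turns the integrand into a product of two inner products of
  columns, constant on the unitary group.\<close>

lemma haar4_contractions:
  "(\<Sum>a<d. \<Sum>c<d. haar4 b e b' e' a c a c) = (if b = b' \<and> e = e' then 1 else 0)"
  "(\<Sum>a<d. \<Sum>c<d. haar4 b e b' e' a c c a) = (if b = e' \<and> e = b' then 1 else 0)"
proof -
  let ?e = "\<lambda>ab M. M $$ ab :: complex"
  have *: "(\<Sum>a<d. \<Sum>c<d. integral\<^sup>L \<mu> (circ_monomial ?e [(a, b), (c, e)] (ys a c))) = R"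
    if ys: "\<And>a c. a < d \<Longrightarrow> c < d \<Longrightarrow> set (ys a c) \<subseteq> {..<d} \<times> {..<d}"
      and ae: "\<And>M. M \<in> unitary_group d \<Longrightarrow> (\<Sum>a<d. \<Sum>c<d. circ_monomial ?e [(a, b), (c, e)] (ys a c) M) = R" for ys R
  proof -
    have int: "integrable \<mu> (circ_monomial ?e [(a, b), (c, e)] (ys a c))" if "a < d" "c < d" for a c
      using that lt ys[OF that] by (intro haar_monomial_integrable[OF haar]) auto
    have "(\<Sum>a<d. \<Sum>c<d. integral\<^sup>L \<mu> (circ_monomial ?e [(a, b), (c, e)] (ys a c))) =
      (\<Sum>a<d. \<integral>M. (\<Sum>c<d. circ_monomial ?e [(a, b), (c, e)] (ys a c) M) \<partial>\<mu>)"
      by (intro sum.cong refl Bochner_Integration.integral_sum[symmetric] int) auto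
    also have "\<dots> = (\<integral>M. (\<Sum>a<d. \<Sum>c<d. circ_monomial ?e [(a, b), (c, e)] (ys a c) M) \<partial>\<mu>)"
      by (intro Bochner_Integration.integral_sum[symmetric] Bochner_Integration.integrable_sum int) auto
    also have "\<dots> = (\<integral>M. R \<partial>\<mu>)"
    proof (rule integral_cong_AE)
      show "(\<lambda>M. \<Sum>a<d. \<Sum>c<d. circ_monomial ?e [(a, b), (c, e)] (ys a c) M) \<in> borel_measurable \<mu>"
        by (intro borel_measurable_sum borel_measurable_integrable int) auto
      show "AE M in \<mu>. (\<Sum>a<d. \<Sum>c<d. circ_monomial ?e [(a, b), (c, e)] (ys a c) M) = R"
        using haar_AE_unitary[OF haar] by eventually_elim (rule ae)
    qed auto
    also have "\<dots> = R" by (simp add: prob_space)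
    finally show ?thesis .
  qed
  show "(\<Sum>a<d. \<Sum>c<d. haar4 b e b' e' a c a c) = (if b = b' \<and> e = e' then 1 else 0)"
  proof (rule *[of "\<lambda>a c. [(a, b'), (c, e')]"])
    fix M assume M: "M \<in> unitary_group d"
    have "(\<Sum>a<d. \<Sum>c<d. circ_monomial ?e [(a, b), (c, e)] [(a, b'), (c, e')] M) =
      (\<Sum>a<d. M $$ (a, b) * cnj (M $$ (a, b'))) * (\<Sum>c<d. M $$ (c, e) * cnj (M $$ (c, e')))"
      unfolding sum_product by (intro sum.cong refl) (simp add: circ_monomial_def)
    also have "\<dots> = (if b = b' \<and> e = e' then 1 else 0)"
      unfolding unitary_group_columns[OF M lt(1,3)] unitary_group_columns[OF M lt(2,4)] by simp
    finally show "(\<Sum>a<d. \<Sum>c<d. circ_monomial ?e [(a, b), (c, e)] [(a, b'), (c, e')] M) = \<dots>" .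
  qed (use lt in auto)
  show "(\<Sum>a<d. \<Sum>c<d. haar4 b e b' e' a c c a) = (if b = e' \<and> e = b' then 1 else 0)"
  proof (rule *[of "\<lambda>a c. [(c, b'), (a, e')]"])
    fix M assume M: "M \<in> unitary_group d"
    have "(\<Sum>a<d. \<Sum>c<d. circ_monomial ?e [(a, b), (c, e)] [(c, b'), (a, e')] M) =
      (\<Sum>a<d. M $$ (a, b) * cnj (M $$ (a, e'))) * (\<Sum>c<d. M $$ (c, e) * cnj (M $$ (c, b')))"
      unfolding sum_product by (intro sum.cong refl) (simp add: circ_monomial_def)
    also have "\<dots> = (if b = e' \<and> e = b' then 1 else 0)"
      unfolding unitary_group_columns[OF M lt(1,4)] unitary_group_columns[OF M lt(2,3)] by simp
    finally show "(\<Sum>a<d. \<Sum>c<d. circ_monomial ?e [(a, b), (c, e)] [(c, b'), (a, e')] M) = \<dots>" .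
  qed (use lt in auto)
qed

text \<open>These are the Weingarten weights of degree two. Inserting \<open>haar4_form\<close> into
  the contractions gives d^2 x + d y = P and d x + d^2 y = Q, and eliminating y leaves d (d^2 - 1) x
  = d P - Q.\<close>

lemma haar4_coefficients:
  "haar4 b e b' e' 0 1 0 1 = of_real (1 / ((real d)\<^sup>2 - 1)) * (if b = b' \<and> e = e' then 1 else 0)
     - of_real (1 / (real d * ((real d)\<^sup>2 - 1))) * (if b = e' \<and> e = b' then 1 else 0)" (is "?x = of_real ?\<alpha> * ?P - of_real ?\<beta> * ?Q")
  "haar4 b e b' e' 0 1 1 0 = of_real (1 / ((real d)\<^sup>2 - 1)) * (if b = e' \<and> e = b' then 1 else 0)
     - of_real (1 / (real d * ((real d)\<^sup>2 - 1))) * (if b = b' \<and> e = e' then 1 else 0)" (is "?y = _")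
proof -
  have s: "(\<Sum>a<d. \<Sum>c<d. x + (if a = c then y else 0)) = of_nat d * of_nat d * x + of_nat d * y"
    "(\<Sum>a<d. \<Sum>c<d. (if a = c then x else 0) + y) = of_nat d * x + of_nat d * of_nat d * y" for x y :: complex
    by (simp_all add: sum.distrib distrib_left)
  have g: "(if a = a \<and> c = c then x else 0) + (if a = c \<and> c = a then y else 0) = x + (if a = c then y else 0)"
    "(if a = c \<and> c = a then x else 0) + (if a = a \<and> c = c then y else 0) = (if a = c then x else 0) + y"
    for a c :: nat and x y :: complex by auto
  have "?P = (\<Sum>a<d. \<Sum>c<d. haar4 b e b' e' a c a c)" by (rule haar4_contractions[symmetric])
  also have "\<dots> = (\<Sum>a<d. \<Sum>c<d. ?x + (if a = c then ?y else 0))"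
    by (intro sum.cong refl trans[OF haar4_form g(1)]) (simp_all only: lessThan_iff)
  finally have 1: "of_nat d * of_nat d * ?x + of_nat d * ?y = ?P" unfolding s by (rule sym)
  have "?Q = (\<Sum>a<d. \<Sum>c<d. haar4 b e b' e' a c c a)" by (rule haar4_contractions[symmetric])
  also have "\<dots> = (\<Sum>a<d. \<Sum>c<d. (if a = c then ?x else 0) + ?y)"
    by (intro sum.cong refl trans[OF haar4_form g(2)]) (simp_all only: lessThan_iff)
  finally have 2: "of_nat d * ?x + of_nat d * of_nat d * ?y = ?Q" unfolding s by (rule sym)
  have solve: "x = of_real ?\<alpha> * P - of_real ?\<beta> * Q"
    if 1: "of_nat d * of_nat d * x + of_nat d * y = P" and 2: "of_nat d * x + of_nat d * of_nat d * y = Q" for x y P Q :: complex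
  proof -
    have "(2::real)\<^sup>2 \<le> (real d)\<^sup>2" using d2 by (intro power_mono) auto
    then have r: "(real d)\<^sup>2 - 1 \<noteq> 0" "real d \<noteq> 0" using d2 by auto
    have c: "complex_of_real ((real d)\<^sup>2 - 1) \<noteq> 0" "complex_of_real (real d) \<noteq> 0"
      using r by (simp_all only: of_real_eq_0_iff not_False_eq_True)
    have n: "of_nat d = complex_of_real (real d)" by simp
    have "complex_of_real (real d) * P - Q = complex_of_real (real d) * complex_of_real ((real d)\<^sup>2 - 1) * x"
      unfolding 1[symmetric] 2[symmetric] n by (simp add: algebra_simps power2_eq_square)
    then have "x = (complex_of_real (real d) * P - Q) / (complex_of_real (real d) * complex_of_real ((real d)\<^sup>2 - 1))"
      using c by (simp only: nonzero_eq_divide_eq mult_eq_0_iff simp_thms mult_ac)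
    also have "\<dots> = P / complex_of_real ((real d)\<^sup>2 - 1) - Q / (complex_of_real (real d) * complex_of_real ((real d)\<^sup>2 - 1))"
      unfolding diff_divide_distrib nonzero_mult_divide_mult_cancel_left[OF c(2)] ..
    finally show ?thesis by (simp add: of_real_divide)
  qed
  show "?x = of_real ?\<alpha> * ?P - of_real ?\<beta> * ?Q" by (rule solve[OF 1 2])
  \<comment> \<open>The system is symmetric under exchanging the unknowns together with the
    right-hand sides.\<close>
  show "?y = of_real ?\<alpha> * ?Q - of_real ?\<beta> * ?P"
    by (rule solve[OF trans[OF add.commute 2] trans[OF add.commute 1]])
qed

end

end

text \<open>The absolute Weingarten weights 1/(d^2 - 1) and 1/(d (d^2 - 1)) sum to 1/(d (d - 1)),
  which is this multiple of the Gaussian 1/d^2. At \<open>d = 1\<close>, where the quotient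
  degenerates, the only entry has modulus one and the Gaussian bound itself holds.\<close>

definition haar_factor :: "nat \<Rightarrow> real" where
  "haar_factor d = (if d = 1 then 1 else real d / (real d - 1))"

text \<open>The conjugated pair \<open>Y\<close> has four relevant values: the given pair and its
  swap, with the positive weight, and the two pairs obtained from these by crossing the columns,
  with the negative weight.\<close>

lemma haar4_expansion:
  assumes haar: "haar_measure d \<mu>" and d2: "d \<ge> 2"
    and lt: "a < d" "b < d" "c < d" "e < d" and Y: "Y \<in> ({..<d} \<times> {..<d}) \<times> ({..<d} \<times> {..<d})"
  shows "integral\<^sup>L \<mu> (circ_monomial (\<lambda>ab M. M $$ ab) [(a, b), (c, e)] [fst Y, snd Y]) =
    of_real (1 / ((real d)\<^sup>2 - 1)) *
      ((if Y = ((a, b), (c, e)) then 1 else 0) + (if Y = ((c, e), (a, b)) then 1 else 0)) -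
    of_real (1 / (real d * ((real d)\<^sup>2 - 1))) *
      ((if Y = ((a, e), (c, b)) then 1 else 0) + (if Y = ((c, b), (a, e)) then 1 else 0))"
proof -
  obtain a' b' c' e' where Y': "Y = ((a', b'), (c', e'))" by (metis prod.exhaust)
  have lt': "a' < d" "b' < d" "c' < d" "e' < d" using Y by (auto simp: Y')
  define \<alpha> \<beta> where ab: "\<alpha> = complex_of_real (1 / ((real d)\<^sup>2 - 1))" "\<beta> = complex_of_real (1 / (real d * ((real d)\<^sup>2 - 1)))"
  have "integral\<^sup>L \<mu> (circ_monomial (\<lambda>ab M. M $$ ab) [(a, b), (c, e)] [fst Y, snd Y]) =
    (if a = a' \<and> c = c' then \<alpha> * (if b = b' \<and> e = e' then 1 else 0) - \<beta> * (if b = e' \<and> e = b' then 1 else 0) else 0) +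
    (if a = c' \<and> c = a' then \<alpha> * (if b = e' \<and> e = b' then 1 else 0) - \<beta> * (if b = b' \<and> e = e' then 1 else 0) else 0)"
    unfolding Y' fst_conv snd_conv ab haar4_form[OF haar d2 lt(2,4) lt'(2,4) lt(1,3) lt'(1,3)]
      haar4_coefficients[OF haar d2 lt(2,4) lt'(2,4)] ..
  also have "\<dots> = \<alpha> * ((if Y = ((a, b), (c, e)) then 1 else 0) + (if Y = ((c, e), (a, b)) then 1 else 0)) -
      \<beta> * ((if Y = ((a, e), (c, b)) then 1 else 0) + (if Y = ((c, b), (a, e)) then 1 else 0))"
  proof -
    have bool: "(if p then \<alpha> * (if q then 1 else 0) - \<beta> * (if q' then 1 else 0) else 0) +
      (if p' then \<alpha> * (if q' then 1 else 0) - \<beta> * (if q then 1 else 0) else 0) =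
      \<alpha> * ((if p \<and> q then 1 else 0) + (if p' \<and> q' then 1 else 0)) -
      \<beta> * ((if p \<and> q' then 1 else 0) + (if p' \<and> q then 1 else 0))" for p q p' q' :: bool
      by simp
    have eqs: "Y = ((a, b), (c, e)) \<longleftrightarrow> (a = a' \<and> c = c') \<and> (b = b' \<and> e = e')"
      "Y = ((c, e), (a, b)) \<longleftrightarrow> (a = c' \<and> c = a') \<and> (b = e' \<and> e = b')"
      "Y = ((a, e), (c, b)) \<longleftrightarrow> (a = a' \<and> c = c') \<and> (b = e' \<and> e = b')"
      "Y = ((c, b), (a, e)) \<longleftrightarrow> (a = c' \<and> c = a') \<and> (b = b' \<and> e = e')"
      unfolding Y' by auto
    show ?thesis unfolding eqs by (rule bool)
  qed
  finally show ?thesis unfolding ab .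
qed

text \<open>The cross term from the crossed columns has no definite sign and is estimated by the
  arithmetic-geometric mean inequality.\<close>

lemma cmod_square_minus_cross:
  "Re (z * cnj (of_real \<alpha> * z - of_real \<beta> * w)) \<le> \<alpha> * (cmod z)\<^sup>2 + \<beta> * ((cmod z)\<^sup>2 + (cmod w)\<^sup>2) / 2" if "\<beta> \<ge> 0"
proof -
  have "Re (z * cnj (of_real \<alpha> * z - of_real \<beta> * w)) = \<alpha> * (cmod z)\<^sup>2 + \<beta> * (- Re (z * cnj w))"
    unfolding cmod_power2 by (simp add: algebra_simps power2_eq_square)
  also have "- Re (z * cnj w) \<le> ((cmod z)\<^sup>2 + (cmod w)\<^sup>2) / 2"
    using zero_le_power2[of "Re z + Re w"] zero_le_power2[of "Im z + Im w"]
    unfolding cmod_power2 by (simp add: power2_eq_square algebra_simps)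
  finally show ?thesis using that by (simp add: mult_left_mono)
qed

lemma haar_quartic_bound:
  fixes c :: "nat \<times> nat \<Rightarrow> nat \<times> nat \<Rightarrow> complex"
  assumes haar: "haar_measure d \<mu>" and d2: "d \<ge> 2"
  defines "T \<equiv> {..<d} \<times> {..<d}"
  shows "(\<integral>M. (cmod (\<Sum>t\<in>T. \<Sum>t'\<in>T. c t t' * M $$ t * M $$ t'))\<^sup>2 \<partial>\<mu>)
    \<le> haar_factor d * (1 / real d)\<^sup>2 / 2 * (\<Sum>t\<in>T. \<Sum>t'\<in>T. (cmod (c t t' + c t' t))\<^sup>2)" (is "?E \<le> _")
proof -
  let ?\<alpha> = "1 / ((real d)\<^sup>2 - 1)" and ?\<beta> = "1 / (real d * ((real d)\<^sup>2 - 1))"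
  define f where "f X = c (fst X) (snd X)" for X
  define s where "s X = f X + f (prod.swap X)" for X
  \<comment> \<open>\<open>\<sigma>\<close> crosses the columns of the two letters, whereas
    \<open>prod.swap\<close> exchanges whole letters.\<close>
  define \<sigma> where "\<sigma> X = ((fst (fst X), snd (snd X)), (fst (snd X), snd (fst X)))" for X :: "(nat \<times> nat) \<times> (nat \<times> nat)"
  have T: "finite T" by (simp add: T_def)
  have d0: "real d \<ge> 2" using d2 by simp
  have "(2::real)\<^sup>2 \<le> (real d)\<^sup>2" using d0 by (intro power_mono) auto
  then have dd: "(real d)\<^sup>2 - 1 > 0" by simp
  have bij_swap: "bij_betw prod.swap (T \<times> T) (T \<times> T)"
    by (rule bij_betw_byWitness[of _ prod.swap]) auto
  have bij_\<sigma>: "bij_betw \<sigma> (T \<times> T) (T \<times> T)"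
    by (rule bij_betw_byWitness[of _ \<sigma>]) (auto simp: \<sigma>_def T_def)
  have s_swap: "s (prod.swap X) = s X" for X by (simp add: s_def add.commute)
  have s_\<sigma>_swap: "s (\<sigma> (prod.swap X)) = s (\<sigma> X)" for X
  proof -
    have "\<sigma> (prod.swap X) = prod.swap (\<sigma> X)" by (simp add: \<sigma>_def prod.swap_def)
    then show ?thesis using s_swap by simp
  qed
  have row: "(\<Sum>Y\<in>T\<times>T. f X * cnj (f Y) * integral\<^sup>L \<mu> (circ_monomial (\<lambda>ab M. M $$ ab) [fst X, snd X] [fst Y, snd Y])) =
     f X * cnj (of_real ?\<alpha> * s X - of_real ?\<beta> * s (\<sigma> X))" (is "?L = _") if X: "X \<in> T \<times> T" for X
  proof -
    obtain a b p e where X': "X = ((a, b), (p, e))" by (metis prod.exhaust)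
    have lt: "a < d" "b < d" "p < d" "e < d" using X by (auto simp: X' T_def)
    have mem: "((a, b), (p, e)) \<in> T \<times> T" "((p, e), (a, b)) \<in> T \<times> T" "((a, e), (p, b)) \<in> T \<times> T" "((p, b), (a, e)) \<in> T \<times> T"
      using lt by (auto simp: T_def)
    let ?g = "\<lambda>Y. f X * cnj (f Y)"
    have ind: "u * (A * ((if P then 1 else 0) + (if Q then 1 else 0)) - B * ((if P' then 1 else 0) + (if Q' then 1 else 0))) =
        A * ((if P then u else 0) + (if Q then u else 0)) - B * ((if P' then u else 0) + (if Q' then u else 0))"
      for u A B :: complex and P Q P' Q' by (simp add: algebra_simps)
    have "?L = (\<Sum>Y\<in>T\<times>T. of_real ?\<alpha> * ((if Y = ((a, b), (p, e)) then ?g Y else 0) + (if Y = ((p, e), (a, b)) then ?g Y else 0)) -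
        of_real ?\<beta> * ((if Y = ((a, e), (p, b)) then ?g Y else 0) + (if Y = ((p, b), (a, e)) then ?g Y else 0)))"
    proof (intro sum.cong refl)
      fix Y assume "Y \<in> T \<times> T"
      then have Y: "Y \<in> ({..<d} \<times> {..<d}) \<times> ({..<d} \<times> {..<d})" by (simp add: T_def)
      have XX: "fst X = (a, b)" "snd X = (p, e)" by (simp_all add: X')
      show "f X * cnj (f Y) * integral\<^sup>L \<mu> (circ_monomial (\<lambda>ab M. M $$ ab) [fst X, snd X] [fst Y, snd Y]) =
        of_real ?\<alpha> * ((if Y = ((a, b), (p, e)) then ?g Y else 0) + (if Y = ((p, e), (a, b)) then ?g Y else 0)) -
        of_real ?\<beta> * ((if Y = ((a, e), (p, b)) then ?g Y else 0) + (if Y = ((p, b), (a, e)) then ?g Y else 0))"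
        unfolding XX haar4_expansion[OF haar d2 lt Y] by (rule ind)
    qed
    also have "\<dots> = of_real ?\<alpha> * (?g ((a, b), (p, e)) + ?g ((p, e), (a, b))) - of_real ?\<beta> * (?g ((a, e), (p, b)) + ?g ((p, b), (a, e)))"
      using T by (simp only: sum_subtractf sum_distrib_left[symmetric] sum.distrib sum.delta mem if_True finite_cartesian_product)
    also have "\<dots> = f X * cnj (of_real ?\<alpha> * s X - of_real ?\<beta> * s (\<sigma> X))"
      unfolding s_def \<sigma>_def X' by (simp add: algebra_simps)
    finally show ?thesis .
  qed
  have "complex_of_real ?E = (\<Sum>X\<in>T\<times>T. \<Sum>Y\<in>T\<times>T. c (fst X) (snd X) * cnj (c (fst Y) (snd Y)) *
      integral\<^sup>L \<mu> (circ_monomial (\<lambda>ab M. M $$ ab) [fst X, snd X] [fst Y, snd Y]))"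
    by (rule quartic_form_eq) (intro haar_monomial_integrable[OF haar], auto simp: T_def)
  also have "\<dots> = (\<Sum>X\<in>T\<times>T. f X * cnj (of_real ?\<alpha> * s X - of_real ?\<beta> * s (\<sigma> X)))"
    unfolding f_def[symmetric] by (intro sum.cong refl row)
  finally have E1: "complex_of_real ?E = \<dots>" .
  \<comment> \<open>Reindexing by the swap gives a second expression for the same moment; adding
    both replaces \<open>f\<close> by its symmetrization \<open>s\<close>.\<close>
  also have "(\<Sum>X\<in>T\<times>T. f X * cnj (of_real ?\<alpha> * s X - of_real ?\<beta> * s (\<sigma> X))) =
     (\<Sum>X\<in>T\<times>T. f (prod.swap X) * cnj (of_real ?\<alpha> * s X - of_real ?\<beta> * s (\<sigma> X)))"
    by (subst sum.reindex_bij_betw[OF bij_swap, symmetric]) (simp only: s_swap s_\<sigma>_swap)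
  finally have E2: "complex_of_real ?E = \<dots>" .
  have "2 * ?E = Re (complex_of_real ?E + complex_of_real ?E)" by simp
  also have "complex_of_real ?E + complex_of_real ?E =
      (\<Sum>X\<in>T\<times>T. f X * cnj (of_real ?\<alpha> * s X - of_real ?\<beta> * s (\<sigma> X))) +
      (\<Sum>X\<in>T\<times>T. f (prod.swap X) * cnj (of_real ?\<alpha> * s X - of_real ?\<beta> * s (\<sigma> X)))"
    by (rule arg_cong2[OF E1 E2])
  also have "\<dots> = (\<Sum>X\<in>T\<times>T. s X * cnj (of_real ?\<alpha> * s X - of_real ?\<beta> * s (\<sigma> X)))"
    unfolding sum.distrib[symmetric] distrib_right[symmetric] s_def[symmetric] ..
  finally have "2 * ?E = (\<Sum>X\<in>T\<times>T. Re (s X * cnj (of_real ?\<alpha> * s X - of_real ?\<beta> * s (\<sigma> X))))"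
    unfolding Re_sum .
  also have "\<dots> \<le> (\<Sum>X\<in>T\<times>T. ?\<alpha> * (cmod (s X))\<^sup>2 + ?\<beta> * ((cmod (s X))\<^sup>2 + (cmod (s (\<sigma> X)))\<^sup>2) / 2)"
    using dd by (intro sum_mono cmod_square_minus_cross) auto
  also have "\<dots> = ?\<alpha> * (\<Sum>X\<in>T\<times>T. (cmod (s X))\<^sup>2) + ?\<beta> * ((\<Sum>X\<in>T\<times>T. (cmod (s X))\<^sup>2) + (\<Sum>X\<in>T\<times>T. (cmod (s (\<sigma> X)))\<^sup>2)) / 2"
    by (simp only: sum.distrib sum_distrib_left[symmetric] sum_divide_distrib[symmetric])
  \<comment> \<open>\<open>\<sigma>\<close> permutes the pairs of letters, so both halves of the
    mean give the same sum and the weights simply add.\<close>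
  also have "(\<Sum>X\<in>T\<times>T. (cmod (s (\<sigma> X)))\<^sup>2) = (\<Sum>X\<in>T\<times>T. (cmod (s X))\<^sup>2)"
    by (rule sum.reindex_bij_betw[OF bij_\<sigma>])
  also have "?\<alpha> * (\<Sum>X\<in>T\<times>T. (cmod (s X))\<^sup>2) + ?\<beta> * ((\<Sum>X\<in>T\<times>T. (cmod (s X))\<^sup>2) + (\<Sum>X\<in>T\<times>T. (cmod (s X))\<^sup>2)) / 2
     = (?\<alpha> + ?\<beta>) * (\<Sum>X\<in>T\<times>T. (cmod (s X))\<^sup>2)"
  proof -
    have "u * S + w * (S + S) / 2 = (u + w) * S" for u w S :: real by (simp add: field_simps)
    then show ?thesis .
  qed
  also have "?\<alpha> + ?\<beta> = haar_factor d * (1 / real d)\<^sup>2"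
  proof -
    have "(real d)\<^sup>2 - 1 = (real d - 1) * (real d + 1)" by (simp add: power2_eq_square algebra_simps)
    moreover have "real d - 1 \<noteq> 0" "real d + 1 \<noteq> 0" "real d \<noteq> 0" "d \<noteq> 1" using d0 by auto
    ultimately show ?thesis
      by (simp add: haar_factor_def power2_eq_square divide_simps)
  qed
  also have "(\<Sum>X\<in>T\<times>T. (cmod (s X))\<^sup>2) = (\<Sum>t\<in>T. \<Sum>t'\<in>T. (cmod (c t t' + c t' t))\<^sup>2)"
    unfolding sum.cartesian_product' by (simp add: s_def f_def)
  finally show ?thesis by simp
qed

lemma circular_block_haar:
  assumes haar: "haar_measure d \<mu>" and d: "d \<ge> 1"
  shows "circular_block \<mu> ({..<d} \<times> {..<d}) (\<lambda>ab M. M $$ ab) (1 / real d) (haar_factor d)"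
proof -
  interpret prob_space \<mu> using haar by (simp add: haar_measure_def)
  have fourth: "(\<integral>M. (cmod (\<Sum>t\<in>{..<d} \<times> {..<d}. \<Sum>t'\<in>{..<d} \<times> {..<d}. c t t' * M $$ t * M $$ t'))\<^sup>2 \<partial>\<mu>)
    \<le> haar_factor d * (1 / real d)\<^sup>2 / 2 * (\<Sum>t\<in>{..<d} \<times> {..<d}. \<Sum>t'\<in>{..<d} \<times> {..<d}. (cmod (c t t' + c t' t))\<^sup>2)" for c :: "nat \<times> nat \<Rightarrow> nat \<times> nat \<Rightarrow> complex"
  proof (cases "d = 1")
    case False
    then show ?thesis using d by (intro haar_quartic_bound haar) auto
  next
    \<comment> \<open>At \<open>d = 1\<close> the weights with denominator d^2 - 1 do not exist. The
      single entry has modulus at most 1, and the right-hand side is twice the squared modulus of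
      the coefficient.\<close>
    case True
    then have T: "{..<d} \<times> {..<d} = {(0::nat, 0::nat)}" by auto
    let ?C = "c (0, 0) (0, 0)"
    have "(\<integral>M. (cmod (?C * M $$ (0, 0) * M $$ (0, 0)))\<^sup>2 \<partial>\<mu>) \<le> (\<integral>M. (cmod ?C)\<^sup>2 \<partial>\<mu>)"
    proof (rule integral_mono_AE')
      show "AE M in \<mu>. (cmod (?C * M $$ (0, 0) * M $$ (0, 0)))\<^sup>2 \<le> (cmod ?C)\<^sup>2"
        using haar_AE_unitary[OF haar]
      proof eventually_elim
        case (elim M)
        have "cmod (M $$ (0, 0)) \<le> 1" using unitary_group_entry_le_1[OF elim] True by simp
        then have "cmod ?C * (cmod (M $$ (0, 0)) * cmod (M $$ (0, 0))) \<le> cmod ?C * 1"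
          by (intro mult_left_mono mult_le_one) auto
        then show ?case by (intro power_mono) (simp_all add: norm_mult mult.assoc)
      qed
    qed auto
    also have "\<dots> = (cmod ?C)\<^sup>2" by (simp add: prob_space)
    also have "\<dots> \<le> 2 * (cmod ?C)\<^sup>2" by simp
    also have "\<dots> = 1 / 2 * (cmod (?C + ?C))\<^sup>2" by (simp add: mult_2[symmetric] norm_mult power_mult_distrib)
    finally show ?thesis unfolding T by (simp add: True haar_factor_def)
  qed
  show ?thesis unfolding circular_block_def
    using fourth haar_monomial_integrable[OF haar] haar_unbalanced[OF haar] haar_second[OF haar] prob_space_axioms
    by (intro conjI allI impI ballI) auto
qed

lemma circular_block_mono:
  assumes blk: "circular_block M T e v K" and K: "K \<le> K'"
  shows "circular_block M T e v K'"
proof -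
  have "K * v\<^sup>2 / 2 * (\<Sum>t\<in>T. \<Sum>t'\<in>T. (cmod (c t t' + c t' t))\<^sup>2) \<le>
      K' * v\<^sup>2 / 2 * (\<Sum>t\<in>T. \<Sum>t'\<in>T. (cmod (c t t' + c t' t))\<^sup>2)" for c :: "_ \<Rightarrow> _ \<Rightarrow> complex"
    using K by (intro mult_right_mono divide_right_mono sum_nonneg) auto
  then show ?thesis
    using blk unfolding circular_block_def by (meson order_trans)
qed

lemma haar_factor_ge_1: "d \<ge> 1 \<Longrightarrow> haar_factor d \<ge> 1"
  by (auto simp: haar_factor_def field_simps)

text \<open>Both laws receive the same constant, so that the moment bounds below treat them
  together.\<close>

lemma circular_block_haar_or_gaussian:
  assumes "haar_or_gaussian d \<mu>" and d: "d \<ge> 1"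
  shows "circular_block \<mu> ({..<d} \<times> {..<d}) (\<lambda>ab M. M $$ ab) (1 / real d) (haar_factor d)"
  using assms circular_block_haar circular_block_mono[OF circular_block_gaussian_measure[OF d] haar_factor_ge_1[OF d]]
  unfolding haar_or_gaussian_def by auto

section \<open>Fourth moments of row-multilinear forms\<close>

text \<open>Only the real part of the form is constrained, which keeps Hermitian symmetry of the
  kernel out of the inductions.\<close>

definition psd_kernel :: "'x set \<Rightarrow> ('x \<Rightarrow> 'x \<Rightarrow> complex) \<Rightarrow> bool" where
  "psd_kernel S D \<longleftrightarrow> (\<forall>c. 0 \<le> Re (\<Sum>x\<in>S. \<Sum>y\<in>S. c x * cnj (c y) * D x y))"

lemma sum_times_cnj_sum:
  "(\<Sum>x\<in>S. f x) * cnj (\<Sum>y\<in>S. g y) * w = (\<Sum>x\<in>S. \<Sum>y\<in>S. f x * cnj (g y) * w)"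
  unfolding cnj_sum unfolding sum_product unfolding sum_distrib_right ..

text \<open>For a Gram kernel \<open>A\<close>, the form of the tensor product is a sum over
  \<open>z\<close> of forms of \<open>D\<close>, evaluated at the coefficients contracted with
  \<open>\<beta> z\<close>.\<close>

lemma psd_kernel_tensor_gram_sum:
  assumes D: "psd_kernel Y D"
    and A: "\<And>x y. x \<in> S \<Longrightarrow> y \<in> S \<Longrightarrow> A x y = (\<Sum>z\<in>Z. \<beta> z x * cnj (\<beta> z y))"
  shows "0 \<le> Re (\<Sum>x\<in>S. \<Sum>p\<in>Y. \<Sum>y\<in>S. \<Sum>q\<in>Y. c x p * cnj (c y q) * (A x y * D p q))"
proof -
  have "(\<Sum>x\<in>S. \<Sum>p\<in>Y. \<Sum>y\<in>S. \<Sum>q\<in>Y. c x p * cnj (c y q) * (A x y * D p q)) =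
    (\<Sum>x\<in>S. \<Sum>p\<in>Y. \<Sum>y\<in>S. \<Sum>q\<in>Y. \<Sum>z\<in>Z. c x p * \<beta> z x * cnj (c y q * \<beta> z y) * D p q)"
    by (intro sum.cong refl) (simp add: A sum_distrib_left sum_distrib_right mult_ac)
  also have "\<dots> = (\<Sum>z\<in>Z. \<Sum>p\<in>Y. \<Sum>q\<in>Y. \<Sum>x\<in>S. \<Sum>y\<in>S. c x p * \<beta> z x * cnj (c y q * \<beta> z y) * D p q)"
    by (simp only: sum.swap[of _ Z] sum.swap[of _ S Y])
  also have "\<dots> = (\<Sum>z\<in>Z. \<Sum>p\<in>Y. \<Sum>q\<in>Y. (\<Sum>x\<in>S. c x p * \<beta> z x) * cnj (\<Sum>y\<in>S. c y q * \<beta> z y) * D p q)"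
    by (simp only: sum_times_cnj_sum)
  finally show ?thesis
    using D[unfolded psd_kernel_def, rule_format] by (simp only: Re_sum[of _ Z]) (intro sum_nonneg)
qed

text \<open>A kernel of moments is a Gram kernel with an integral in place of the sum: positivity
  holds for each \<omega> and survives integration. The nested integrability facts serve to pull the
  finite sums out of the integral.\<close>

lemma psd_kernel_tensor_gram_integral:
  assumes D: "psd_kernel Y D"
    and int: "\<And>x y. x \<in> S \<Longrightarrow> y \<in> S \<Longrightarrow> integrable \<nu> (\<lambda>\<omega>. \<phi> x \<omega> * cnj (\<phi> y \<omega>))"
    and A: "\<And>x y. x \<in> S \<Longrightarrow> y \<in> S \<Longrightarrow> A x y = (\<integral>\<omega>. \<phi> x \<omega> * cnj (\<phi> y \<omega>) \<partial>\<nu>)"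
  shows "0 \<le> Re (\<Sum>x\<in>S. \<Sum>p\<in>Y. \<Sum>y\<in>S. \<Sum>q\<in>Y. c x p * cnj (c y q) * (A x y * D p q))"
proof -
  define G where "G x p y q \<omega> = c x p * cnj (c y q) * (\<phi> x \<omega> * cnj (\<phi> y \<omega>) * D p q)" for x p y q \<omega>
  have i4: "integrable \<nu> (G x p y q)" if "x \<in> S" "y \<in> S" for x p y q
    unfolding G_def[abs_def] using int[OF that] by (intro integrable_mult_right integrable_mult_left)
  have i3: "integrable \<nu> (\<lambda>\<omega>. \<Sum>q\<in>Y. G x p y q \<omega>)" if "x \<in> S" "y \<in> S" for x p y
    using that by (intro Bochner_Integration.integrable_sum i4)
  have i2: "integrable \<nu> (\<lambda>\<omega>. \<Sum>y\<in>S. \<Sum>q\<in>Y. G x p y q \<omega>)" if "x \<in> S" for x p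
    using that by (intro Bochner_Integration.integrable_sum i3)
  have i1: "integrable \<nu> (\<lambda>\<omega>. \<Sum>p\<in>Y. \<Sum>y\<in>S. \<Sum>q\<in>Y. G x p y q \<omega>)" if "x \<in> S" for x
    using that by (intro Bochner_Integration.integrable_sum i2)
  have i0: "integrable \<nu> (\<lambda>\<omega>. \<Sum>x\<in>S. \<Sum>p\<in>Y. \<Sum>y\<in>S. \<Sum>q\<in>Y. G x p y q \<omega>)"
    by (intro Bochner_Integration.integrable_sum i1)
  have "(\<Sum>x\<in>S. \<Sum>p\<in>Y. \<Sum>y\<in>S. \<Sum>q\<in>Y. c x p * cnj (c y q) * (A x y * D p q)) =
    (\<Sum>x\<in>S. \<Sum>p\<in>Y. \<Sum>y\<in>S. \<Sum>q\<in>Y. integral\<^sup>L \<nu> (G x p y q))"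
  proof (intro sum.cong refl)
    fix x p y q assume "x \<in> S" "y \<in> S"
    show "c x p * cnj (c y q) * (A x y * D p q) = integral\<^sup>L \<nu> (G x p y q)"
      unfolding G_def[abs_def] A[OF \<open>x \<in> S\<close> \<open>y \<in> S\<close>] by (simp only: integral_mult_right_zero integral_mult_left_zero)
  qed
  also have "\<dots> = (\<Sum>x\<in>S. \<Sum>p\<in>Y. \<Sum>y\<in>S. \<integral>\<omega>. (\<Sum>q\<in>Y. G x p y q \<omega>) \<partial>\<nu>)"
    by (intro sum.cong refl Bochner_Integration.integral_sum[symmetric] i4)
  also have "\<dots> = (\<Sum>x\<in>S. \<Sum>p\<in>Y. \<integral>\<omega>. (\<Sum>y\<in>S. \<Sum>q\<in>Y. G x p y q \<omega>) \<partial>\<nu>)"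
    by (intro sum.cong refl Bochner_Integration.integral_sum[symmetric] i3)
  also have "\<dots> = (\<Sum>x\<in>S. \<integral>\<omega>. (\<Sum>p\<in>Y. \<Sum>y\<in>S. \<Sum>q\<in>Y. G x p y q \<omega>) \<partial>\<nu>)"
    by (intro sum.cong refl Bochner_Integration.integral_sum[symmetric] i2)
  also have "\<dots> = (\<integral>\<omega>. (\<Sum>x\<in>S. \<Sum>p\<in>Y. \<Sum>y\<in>S. \<Sum>q\<in>Y. G x p y q \<omega>) \<partial>\<nu>)"
    by (intro Bochner_Integration.integral_sum[symmetric] i1)
  finally have eq: "(\<Sum>x\<in>S. \<Sum>p\<in>Y. \<Sum>y\<in>S. \<Sum>q\<in>Y. c x p * cnj (c y q) * (A x y * D p q)) =
    (\<integral>\<omega>. (\<Sum>x\<in>S. \<Sum>p\<in>Y. \<Sum>y\<in>S. \<Sum>q\<in>Y. G x p y q \<omega>) \<partial>\<nu>)" .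
  \<comment> \<open>At a fixed \<omega> the kernel has rank one, the case of a single Gram
    vector.\<close>
  have "0 \<le> Re (\<Sum>x\<in>S. \<Sum>p\<in>Y. \<Sum>y\<in>S. \<Sum>q\<in>Y. G x p y q \<omega>)" for \<omega>
    unfolding G_def
    by (rule psd_kernel_tensor_gram_sum[OF D, where Z = "{()}" and \<beta> = "\<lambda>_ x. \<phi> x \<omega>"]) simp
  then have "0 \<le> (\<integral>\<omega>. Re (\<Sum>x\<in>S. \<Sum>p\<in>Y. \<Sum>y\<in>S. \<Sum>q\<in>Y. G x p y q \<omega>) \<partial>\<nu>)"
    by (intro integral_nonneg_AE always_eventually) blast
  also have "\<dots> = Re (\<integral>\<omega>. (\<Sum>x\<in>S. \<Sum>p\<in>Y. \<Sum>y\<in>S. \<Sum>q\<in>Y. G x p y q \<omega>) \<partial>\<nu>)"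
    by (rule integral_Re[OF i0])
  finally show ?thesis unfolding eq .
qed

section \<open>Tensor powers of kernels\<close>

lemma sum_PiE_Suc:
  fixes F :: "(nat \<Rightarrow> 'x) \<Rightarrow> 'b :: comm_monoid_add"
  shows "(\<Sum>x\<in>PiE {..<Suc m} (\<lambda>_. S). F x) = (\<Sum>s\<in>S. \<Sum>g\<in>PiE {..<m} (\<lambda>_. S). F (g(m := s)))"
proof -
  have "(\<Sum>x\<in>PiE {..<Suc m} (\<lambda>_. S). F x) = (\<Sum>x\<in>(\<lambda>(s, g). g(m := s)) ` (S \<times> PiE {..<m} (\<lambda>_. S)). F x)"
    unfolding lessThan_Suc PiE_insert_eq ..
  also have "\<dots> = (\<Sum>x\<in>S \<times> PiE {..<m} (\<lambda>_. S). F (case x of (s, g) \<Rightarrow> g(m := s)))"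
    by (subst sum.reindex) (auto intro!: inj_combinator)
  also have "\<dots> = (\<Sum>s\<in>S. \<Sum>g\<in>PiE {..<m} (\<lambda>_. S). F (g(m := s)))"
    unfolding sum.cartesian_product by (intro sum.cong) auto
  finally show ?thesis .
qed

lemma prod_lessThan_Suc_upd: "(\<Prod>i<Suc m. A ((g(m := s)) i) ((h(m := t)) i)) = A s t * (\<Prod>i<m. A (g i) (h i))"
  by (simp add: mult.commute)

text \<open>The Schur product theorem for tensor powers: replacing one factor at a time keeps the difference
  of the two kernels positive semidefinite, because Gram kernels preserve positive semidefiniteness
  under tensoring.\<close>

lemma psd_kernel_tensor_power:
  fixes S :: "'x set" and A B :: "'x \<Rightarrow> 'x \<Rightarrow> complex" and m :: nat
  assumes int: "\<And>x y. x \<in> S \<Longrightarrow> y \<in> S \<Longrightarrow> integrable \<nu> (\<lambda>\<omega>. \<phi> x \<omega> * cnj (\<phi> y \<omega>))"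
    and A: "\<And>x y. x \<in> S \<Longrightarrow> y \<in> S \<Longrightarrow> A x y = (\<integral>\<omega>. \<phi> x \<omega> * cnj (\<phi> y \<omega>) \<partial>\<nu>)"
    and B: "\<And>x y. x \<in> S \<Longrightarrow> y \<in> S \<Longrightarrow> B x y = (\<Sum>z\<in>Z. \<beta> z x * cnj (\<beta> z y))"
    and AB: "psd_kernel S (\<lambda>x y. B x y - A x y)"
  shows "psd_kernel (PiE {..<m} (\<lambda>_. S)) (\<lambda>x y. (\<Prod>i<m. B (x i) (y i)) - (\<Prod>i<m. A (x i) (y i)))"
proof -
  \<comment> \<open>The power of \<open>A\<close> tensored with \<open>B - A\<close> is positive: it
    starts from \<open>AB\<close>, and each further factor \<open>A\<close> is a Gram kernel in L^2
    of \<open>\<nu>\<close>.\<close>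
  have tensor_A: "0 \<le> Re (\<Sum>x\<in>PiE {..<m} (\<lambda>_. S). \<Sum>p\<in>S. \<Sum>y\<in>PiE {..<m} (\<lambda>_. S). \<Sum>q\<in>S.
      c x p * cnj (c y q) * ((\<Prod>i<m. A (x i) (y i)) * (B p q - A p q)))" for c and m :: nat
  proof (induction m arbitrary: c)
    case 0
    show ?case using AB[unfolded psd_kernel_def, rule_format, of "c (\<lambda>_. undefined)"]
      by (simp only: lessThan_0 PiE_empty_domain prod.empty mult_1_left sum.insert sum.empty finite.emptyI
          empty_iff add_0_right not_False_eq_True)
  next
    case (Suc m)
    let ?P = "PiE {..<m} (\<lambda>_. S)"
    define Y where "Y = ?P \<times> S"
    define D where "D u w = (\<Prod>i<m. A (fst u i) (fst w i)) * (B (snd u) (snd w) - A (snd u) (snd w))" for u w :: "(nat \<Rightarrow> 'x) \<times> 'x"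
    have "psd_kernel Y D"
      unfolding psd_kernel_def
    proof
      fix c :: "(nat \<Rightarrow> 'x) \<times> 'x \<Rightarrow> complex"
      show "0 \<le> Re (\<Sum>x\<in>Y. \<Sum>y\<in>Y. c x * cnj (c y) * D x y)"
        using Suc.IH[of "\<lambda>x p. c (x, p)"] unfolding Y_def D_def sum.cartesian_product' fst_conv snd_conv .
    qed
    from psd_kernel_tensor_gram_integral[OF this int A, where c = "\<lambda>s u. c ((fst u)(m := s)) (snd u)"]
    show ?case
      unfolding sum_PiE_Suc prod_lessThan_Suc_upd Y_def D_def sum.cartesian_product' fst_conv snd_conv
      by (simp only: mult.assoc)
  qed
  show ?thesis
  proof (induction m)
    case 0
    then show ?case by (simp add: psd_kernel_def)
  next
    case (Suc m)
    let ?P = "PiE {..<m} (\<lambda>_. S)"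
    show ?case unfolding psd_kernel_def
    proof
      fix c :: "(nat \<Rightarrow> 'x) \<Rightarrow> complex"
      define k where "k s g = c (g(m := s))" for s g
      let ?\<Pi> = "\<lambda>A x y. \<Prod>i<m. A (x i) (y i)"
      have "(\<Sum>x\<in>PiE {..<Suc m} (\<lambda>_. S). \<Sum>y\<in>PiE {..<Suc m} (\<lambda>_. S). c x * cnj (c y) *
          ((\<Prod>i<Suc m. B (x i) (y i)) - (\<Prod>i<Suc m. A (x i) (y i)))) =
        (\<Sum>s\<in>S. \<Sum>x\<in>?P. \<Sum>t\<in>S. \<Sum>y\<in>?P. k s x * cnj (k t y) * (B s t * ?\<Pi> B x y - A s t * ?\<Pi> A x y))"
        unfolding sum_PiE_Suc prod_lessThan_Suc_upd k_def ..
      \<comment> \<open>Telescoping: B B^m - A A^m = B (B^m - A^m) + A^m (B - A). The Gram form of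
        \<open>B\<close> and the induction hypothesis handle the first summand,
        \<open>tensor_A\<close> the second.\<close>
      also have "\<dots> = (\<Sum>s\<in>S. \<Sum>x\<in>?P. \<Sum>t\<in>S. \<Sum>y\<in>?P.
          k s x * cnj (k t y) * (B s t * (?\<Pi> B x y - ?\<Pi> A x y)) + k s x * cnj (k t y) * (?\<Pi> A x y * (B s t - A s t)))"
        by (intro sum.cong refl) (simp add: algebra_simps)
      also have "\<dots> = (\<Sum>s\<in>S. \<Sum>x\<in>?P. \<Sum>t\<in>S. \<Sum>y\<in>?P. k s x * cnj (k t y) * (B s t * (?\<Pi> B x y - ?\<Pi> A x y))) +
          (\<Sum>s\<in>S. \<Sum>x\<in>?P. \<Sum>t\<in>S. \<Sum>y\<in>?P. k s x * cnj (k t y) * (?\<Pi> A x y * (B s t - A s t)))"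
        by (simp only: sum.distrib)
      also have "(\<Sum>s\<in>S. \<Sum>x\<in>?P. \<Sum>t\<in>S. \<Sum>y\<in>?P. k s x * cnj (k t y) * (?\<Pi> A x y * (B s t - A s t))) =
          (\<Sum>x\<in>?P. \<Sum>s\<in>S. \<Sum>y\<in>?P. \<Sum>t\<in>S. k s x * cnj (k t y) * (?\<Pi> A x y * (B s t - A s t)))"
        by (simp only: sum.swap[of _ S ?P])
      finally show "0 \<le> Re (\<Sum>x\<in>PiE {..<Suc m} (\<lambda>_. S). \<Sum>y\<in>PiE {..<Suc m} (\<lambda>_. S). c x * cnj (c y) *
          ((\<Prod>i<Suc m. B (x i) (y i)) - (\<Prod>i<Suc m. A (x i) (y i))))"
        by (simp only: plus_complex.sel)
          (intro add_nonneg_nonneg psd_kernel_tensor_gram_sum[OF Suc.IH B] tensor_A)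
    qed
  qed
qed

definition swap_on :: "nat set \<Rightarrow> nat \<Rightarrow> (nat \<Rightarrow> 'x \<times> 'x) \<Rightarrow> nat \<Rightarrow> 'x \<times> 'x" where
  "swap_on S n z = (\<lambda>i\<in>{..<n}. if i \<in> S then prod.swap (z i) else z i)"

lemma sum_PiE_Times:
  fixes F :: "(nat \<Rightarrow> 'x \<times> 'y) \<Rightarrow> 'b :: comm_monoid_add"
  shows "(\<Sum>z\<in>PiE I (\<lambda>_. X \<times> Y). F z) =
    (\<Sum>t\<in>PiE I (\<lambda>_. X). \<Sum>u\<in>PiE I (\<lambda>_. Y). F (\<lambda>i\<in>I. (t i, u i)))"
proof -
  have "(\<Sum>z\<in>PiE I (\<lambda>_. X \<times> Y). F z) =
    (\<Sum>p\<in>PiE I (\<lambda>_. X) \<times> PiE I (\<lambda>_. Y). F (\<lambda>i\<in>I. (fst p i, snd p i)))"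
    by (rule sum.reindex_bij_witness[where
          i = "\<lambda>p. \<lambda>i\<in>I. (fst p i, snd p i)" and j = "\<lambda>z. (\<lambda>i\<in>I. fst (z i), \<lambda>i\<in>I. snd (z i))"])
       (auto simp: fun_eq_iff PiE_iff extensional_def restrict_def mem_Times_iff intro!: arg_cong[of _ _ F])
  then show ?thesis by (simp add: sum.cartesian_product')
qed

lemma prod_if_eq_PiE:
  assumes "finite I" "t \<in> PiE I (\<lambda>_. X)" "u \<in> PiE I (\<lambda>_. X)"
  shows "(\<Prod>i\<in>I. if t i = u i then a else 0 :: complex) = (if t = u then a ^ card I else 0)"
proof (cases "t = u")
  case False
  then obtain i where "i \<in> I" "t i \<noteq> u i" using PiE_ext[OF assms(2,3)] by blast
  then show ?thesis using assms False by auto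
qed simp

text \<open>Expanding a product of two-term factors means deciding in each row whether the pair is
  exchanged; \<open>S\<close> is the set of rows where it is, and each choice determines
  \<open>w\<close>.\<close>

lemma prod_swap_kernel:
  fixes z w :: "nat \<Rightarrow> 'x \<times> 'x"
  assumes z: "z \<in> PiE {..<n} (\<lambda>_. X \<times> X)" and w: "w \<in> PiE {..<n} (\<lambda>_. X \<times> X)"
  shows "(\<Prod>i<n. a * ((if w i = prod.swap (z i) then 1 else 0) + (if w i = z i then 1 else 0 :: complex))) =
    a ^ n * (\<Sum>S\<in>Pow {..<n}. if w = swap_on S n z then 1 else 0)"
proof -
  have "(\<Prod>i<n. a * ((if w i = prod.swap (z i) then 1 else 0) + (if w i = z i then 1 else 0 :: complex))) =
    a ^ n * (\<Sum>S\<in>Pow {..<n}. (\<Prod>i\<in>S. if w i = prod.swap (z i) then 1 else 0) * (\<Prod>i\<in>{..<n} - S. if w i = z i then 1 else 0))"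
    unfolding prod.distrib prod_constant card_lessThan prod_add[OF finite_lessThan] ..
  also have "(\<Sum>S\<in>Pow {..<n}. (\<Prod>i\<in>S. if w i = prod.swap (z i) then 1 else 0) * (\<Prod>i\<in>{..<n} - S. if w i = z i then 1 else 0)) =
    (\<Sum>S\<in>Pow {..<n}. if w = swap_on S n z then 1 else 0 :: complex)"
  proof (intro sum.cong refl)
    fix S assume "S \<in> Pow {..<n}"
    then have S: "S \<subseteq> {..<n}" by simp
    have "(\<Prod>i\<in>S. if w i = prod.swap (z i) then 1 else 0) * (\<Prod>i\<in>{..<n} - S. if w i = z i then 1 else 0 :: complex) =
      (\<Prod>i\<in>{..<n} - S. if w i = swap_on S n z i then 1 else 0) * (\<Prod>i\<in>S. if w i = swap_on S n z i then 1 else 0)"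
      using S by (subst mult.commute, intro arg_cong2[where f = "(*)"] prod.cong refl) (auto simp: swap_on_def)
    also have "\<dots> = (\<Prod>i<n. if w i = swap_on S n z i then 1 else 0)"
      using S by (intro prod.subset_diff[symmetric]) auto
    also have "\<dots> = (if w = swap_on S n z then 1 else 0)"
    proof -
      have "z i \<in> X \<times> X" if "i < n" for i using z that by (auto simp: PiE_iff)
      then have "swap_on S n z \<in> PiE {..<n} (\<lambda>_. X \<times> X)" by (auto simp: swap_on_def PiE_iff mem_Times_iff)
      from prod_if_eq_PiE[OF _ w this, of 1] show ?thesis by simp
    qed
    finally show "(\<Prod>i\<in>S. if w i = prod.swap (z i) then 1 else 0) * (\<Prod>i\<in>{..<n} - S. if w i = z i then 1 else 0 :: complex) =
      (if w = swap_on S n z then 1 else 0)" .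
  qed
  finally show ?thesis .
qed

lemma integral_double_sum:
  fixes F :: "'s \<Rightarrow> 's \<Rightarrow> 'a \<Rightarrow> complex"
  assumes "\<And>x y. x \<in> S \<Longrightarrow> y \<in> S \<Longrightarrow> integrable M (F x y)"
  shows "(\<integral>\<omega>. (\<Sum>x\<in>S. \<Sum>y\<in>S. k x y * F x y \<omega>) \<partial>M) = (\<Sum>x\<in>S. \<Sum>y\<in>S. k x y * integral\<^sup>L M (F x y))"
proof -
  have i: "integrable M (\<lambda>\<omega>. k x y * F x y \<omega>)" if "x \<in> S" "y \<in> S" for x y
    using assms[OF that] by (rule integrable_mult_right)
  have "(\<integral>\<omega>. (\<Sum>x\<in>S. \<Sum>y\<in>S. k x y * F x y \<omega>) \<partial>M) = (\<Sum>x\<in>S. \<integral>\<omega>. (\<Sum>y\<in>S. k x y * F x y \<omega>) \<partial>M)"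
    by (intro Bochner_Integration.integral_sum Bochner_Integration.integrable_sum i)
  also have "\<dots> = (\<Sum>x\<in>S. \<Sum>y\<in>S. \<integral>\<omega>. k x y * F x y \<omega> \<partial>M)"
    by (intro sum.cong refl Bochner_Integration.integral_sum i)
  finally show ?thesis by simp
qed

text \<open>\<open>t i\<close> names the column and the coordinate taken from row \<open>i\<close>.
  Every row enters with degree one, so the square has degree two per row and the fourth moment stays
  within the range of \<open>circular_block\<close>.\<close>

definition multilinear ::
  "'t set \<Rightarrow> ('t \<Rightarrow> 'a \<Rightarrow> complex) \<Rightarrow> nat set \<Rightarrow> nat \<Rightarrow>
    ((nat \<Rightarrow> nat \<times> 't) \<Rightarrow> complex) \<Rightarrow> (nat \<times> nat \<Rightarrow> 'a) \<Rightarrow> complex" where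
  "multilinear T e J n c \<rho> =
    (\<Sum>t\<in>PiE {..<n} (\<lambda>_. J \<times> T). c t * (\<Prod>i<n. e (snd (t i)) (\<rho> (i, fst (t i)))))"

context
  fixes \<mu> :: "'a measure" and T :: "'t set" and e v K and J :: "nat set" and n :: nat
  assumes blk: "circular_block \<mu> T e v K" and J: "finite J" and K: "K \<ge> 1"
begin

abbreviation "row_law \<equiv> Pi\<^sub>M J (\<lambda>_. \<mu>)"
abbreviation "joint_law \<equiv> Pi\<^sub>M ({..<n} \<times> J) (\<lambda>_. \<mu>)"

text \<open>The joint law is a product over single matrices, not over rows: each monomial is split
  down to the single matrices and reassembled by rows.\<close>

lemma joint_moments:
  assumes xs: "\<And>i. i < n \<Longrightarrow> set (xs i) \<subseteq> J \<times> T" "\<And>i. i < n \<Longrightarrow> length (xs i) \<le> 2"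
    and ys: "\<And>i. i < n \<Longrightarrow> set (ys i) \<subseteq> J \<times> T" "\<And>i. i < n \<Longrightarrow> length (ys i) \<le> 2"
  shows "integrable joint_law (\<lambda>\<rho>. \<Prod>i<n. circ_monomial (prod_coord e) (xs i) (ys i) (\<lambda>j. \<rho> (i, j)))"
    "(\<integral>\<rho>. (\<Prod>i<n. circ_monomial (prod_coord e) (xs i) (ys i) (\<lambda>j. \<rho> (i, j))) \<partial>joint_law) =
      (\<Prod>i<n. integral\<^sup>L row_law (circ_monomial (prod_coord e) (xs i) (ys i)))"
proof -
  interpret M: prob_space \<mu> by (rule circular_blockD(1)[OF blk])
  interpret product_prob_space "\<lambda>_::nat \<times> nat. \<mu>" by standard
  define f where "f ij = circ_monomial e (proj_list (snd ij) (xs (fst ij))) (proj_list (snd ij) (ys (fst ij)))" for ij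
  have fin: "finite ({..<n} \<times> J)" using J by simp
  have int: "integrable \<mu> (f ij)" if "ij \<in> {..<n} \<times> J" for ij
  proof -
    have i: "fst ij < n" using that by auto
    show ?thesis
      using set_proj_list[OF xs(1)[OF i], of "snd ij"] set_proj_list[OF ys(1)[OF i], of "snd ij"]
        order_trans[OF length_proj_list_le xs(2)[OF i]] order_trans[OF length_proj_list_le ys(2)[OF i]]
      unfolding f_def by (intro circular_blockD(3)[OF blk])
  qed
  have eq: "(\<Prod>i<n. circ_monomial (prod_coord e) (xs i) (ys i) (\<lambda>j. \<rho> (i, j))) = (\<Prod>ij\<in>{..<n} \<times> J. f ij (\<rho> ij))" for \<rho>
  proof -
    have "(\<Prod>i<n. circ_monomial (prod_coord e) (xs i) (ys i) (\<lambda>j. \<rho> (i, j))) = (\<Prod>i<n. \<Prod>j\<in>J. f (i, j) (\<rho> (i, j)))"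
      by (intro prod.cong refl) (simp add: f_def circ_monomial_prod_coord[OF J xs(1) ys(1)])
    then show ?thesis by (simp add: prod.cartesian_product case_prod_beta)
  qed
  show "integrable joint_law (\<lambda>\<rho>. \<Prod>i<n. circ_monomial (prod_coord e) (xs i) (ys i) (\<lambda>j. \<rho> (i, j)))"
    unfolding eq by (rule product_integrable_prod[OF fin int])
  have "(\<integral>\<rho>. (\<Prod>i<n. circ_monomial (prod_coord e) (xs i) (ys i) (\<lambda>j. \<rho> (i, j))) \<partial>joint_law) =
      (\<Prod>ij\<in>{..<n} \<times> J. integral\<^sup>L \<mu> (f ij))"
    unfolding eq by (rule product_integral_prod[OF fin int])
  also have "\<dots> = (\<Prod>i<n. \<Prod>j\<in>J. integral\<^sup>L \<mu> (f (i, j)))"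
    by (simp add: prod.cartesian_product case_prod_beta)
  also have "\<dots> = (\<Prod>i<n. integral\<^sup>L row_law (circ_monomial (prod_coord e) (xs i) (ys i)))"
    using xs ys by (intro prod.cong refl) (simp add: f_def product_monomial_moments(2)[OF blk J])
  finally show "(\<integral>\<rho>. (\<Prod>i<n. circ_monomial (prod_coord e) (xs i) (ys i) (\<lambda>j. \<rho> (i, j))) \<partial>joint_law) = \<dots>" .
qed

text \<open>Distinct index tuples differ in some row, where the second moment vanishes; the
  monomials are orthogonal with common squared norm \<open>v ^ n\<close>.\<close>

lemma second_moment_multilinear:
  "(\<integral>\<rho>. (cmod (multilinear T e J n c \<rho>))\<^sup>2 \<partial>joint_law) = v ^ n * (\<Sum>t\<in>PiE {..<n} (\<lambda>_. J \<times> T). (cmod (c t))\<^sup>2)"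
proof -
  let ?X = "PiE {..<n} (\<lambda>_. J \<times> T)"
  let ?m = "\<lambda>t u \<rho>. \<Prod>i<n. circ_monomial (prod_coord e) [t i] [u i] (\<lambda>j. \<rho> (i, j))"
  have fin: "finite ?X" using J circular_blockD(2)[OF blk] by (intro finite_PiE) auto
  have mem: "t i \<in> J \<times> T" if "t \<in> ?X" "i < n" for t i using that by (auto simp: PiE_iff)
  have "complex_of_real (\<integral>\<rho>. (cmod (multilinear T e J n c \<rho>))\<^sup>2 \<partial>joint_law) =
     (\<integral>\<rho>. (\<Sum>t\<in>?X. \<Sum>u\<in>?X. c t * cnj (c u) * ?m t u \<rho>) \<partial>joint_law)"
    unfolding integral_complex_of_real[symmetric] complex_norm_square multilinear_def cnj_sum sum_product
    by (simp add: circ_monomial_def prod_coord_def prod.distrib mult_ac)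
  also have "\<dots> = (\<Sum>t\<in>?X. \<Sum>u\<in>?X. c t * cnj (c u) * integral\<^sup>L joint_law (?m t u))"
    using mem by (intro integral_double_sum joint_moments(1)) auto
  also have "\<dots> = (\<Sum>t\<in>?X. \<Sum>u\<in>?X. if t = u then c t * cnj (c u) * of_real v ^ n else 0)"
  proof (intro sum.cong refl)
    fix t u assume t: "t \<in> ?X" and u: "u \<in> ?X"
    have "integral\<^sup>L joint_law (?m t u) = (\<Prod>i<n. integral\<^sup>L row_law (circ_monomial (prod_coord e) [t i] [u i]))"
      using mem t u by (intro joint_moments(2)) auto
    also have "\<dots> = (\<Prod>i<n. if t i = u i then of_real v else 0)"
      using mem t u by (intro prod.cong refl product_monomial_second[OF blk J]) auto
    also have "\<dots> = (if t = u then of_real v ^ n else 0)"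
      using prod_if_eq_PiE[OF _ t u] by simp
    finally show "c t * cnj (c u) * integral\<^sup>L joint_law (?m t u) = (if t = u then c t * cnj (c u) * of_real v ^ n else 0)"
      by simp
  qed
  also have "\<dots> = (\<Sum>t\<in>?X. c t * cnj (c t) * of_real v ^ n)" using fin by simp
  also have "\<dots> = complex_of_real (v ^ n * (\<Sum>t\<in>?X. (cmod (c t))\<^sup>2))"
    by (simp add: sum_distrib_left complex_norm_square[symmetric] mult.commute)
  finally show ?thesis unfolding of_real_eq_iff .
qed

text \<open>With two entries per row, the row kernel is dominated by \<open>K v\<^sup>2\<close> times the Gaussian (Wick) kernel
  \<open>[w = z] + [w = swap z]\<close>; the tensor power then turns into a sum over the sets of swapped rows.\<close>

lemma fourth_moment_multilinear:
  "integrable joint_law (\<lambda>\<rho>. (cmod (multilinear T e J n c \<rho>)) ^ 4)"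
  "(\<integral>\<rho>. (cmod (multilinear T e J n c \<rho>)) ^ 4 \<partial>joint_law) \<le> (K * v\<^sup>2) ^ n *
    (\<Sum>S\<in>Pow {..<n}. \<Sum>z\<in>PiE {..<n} (\<lambda>_. (J \<times> T) \<times> (J \<times> T)).
       cmod (c (\<lambda>i\<in>{..<n}. fst (z i)) * c (\<lambda>i\<in>{..<n}. snd (z i))) *
       cmod (c (\<lambda>i\<in>{..<n}. fst (swap_on S n z i)) * c (\<lambda>i\<in>{..<n}. snd (swap_on S n z i))))"
proof -
  let ?X = "J \<times> T"
  let ?Z = "PiE {..<n} (\<lambda>_. ?X \<times> ?X)"
  let ?e = "prod_coord e"
  have T: "finite T" by (rule circular_blockD(2)[OF blk])
  have finX: "finite (?X \<times> ?X)" using J T by auto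
  have finZ: "finite ?Z" using finX by (intro finite_PiE) auto
  note rowblk = circular_block_product[OF blk J K]
  define C where "C z = c (\<lambda>i\<in>{..<n}. fst (z i)) * c (\<lambda>i\<in>{..<n}. snd (z i))" for z :: "nat \<Rightarrow> (nat \<times> 't) \<times> (nat \<times> 't)"
  define A where "A x y = integral\<^sup>L row_law (circ_monomial ?e [fst x, snd x] [fst y, snd y])" for x y
  define B where "B x y = complex_of_real (K * v\<^sup>2) * ((if y = prod.swap x then 1 else 0) + (if y = x then 1 else 0))"
    for x y :: "(nat \<times> 't) \<times> (nat \<times> 't)"
  let ?m = "\<lambda>z w \<rho>. \<Prod>i<n. circ_monomial ?e [fst (z i), snd (z i)] [fst (w i), snd (w i)] (\<lambda>j. \<rho> (i, j))"
  have mem: "fst (z i) \<in> ?X" "snd (z i) \<in> ?X" if "z \<in> ?Z" "i < n" for z i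
    using that by (auto simp: PiE_iff mem_Times_iff)
  \<comment> \<open>From here on \<open>z i\<close> is the pair of letters that the two factors of
    the square take from row \<open>i\<close>.\<close>
  have sq: "(multilinear T e J n c \<rho>)\<^sup>2 = (\<Sum>z\<in>?Z. C z * (\<Prod>i<n. ?e (fst (z i)) (\<lambda>j. \<rho> (i, j)) * ?e (snd (z i)) (\<lambda>j. \<rho> (i, j))))" for \<rho>
  proof -
    have "(multilinear T e J n c \<rho>)\<^sup>2 = (\<Sum>t\<in>PiE {..<n} (\<lambda>_. ?X). \<Sum>u\<in>PiE {..<n} (\<lambda>_. ?X).
        c t * c u * (\<Prod>i<n. ?e (t i) (\<lambda>j. \<rho> (i, j)) * ?e (u i) (\<lambda>j. \<rho> (i, j))))"
      unfolding power2_eq_square multilinear_def sum_product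
      by (intro sum.cong refl) (simp add: prod_coord_def prod.distrib mult_ac)
    also have "\<dots> = (\<Sum>z\<in>?Z. C z * (\<Prod>i<n. ?e (fst (z i)) (\<lambda>j. \<rho> (i, j)) * ?e (snd (z i)) (\<lambda>j. \<rho> (i, j))))"
    proof -
      have r: "(\<lambda>i\<in>{..<n}. t i) = t" if "t \<in> PiE {..<n} (\<lambda>_. ?X)" for t
        using that by (intro extensional_restrict) (auto simp: PiE_iff)
      have "(\<lambda>i\<in>{..<n}. fst ((\<lambda>i\<in>{..<n}. (t i, u i)) i)) = (\<lambda>i\<in>{..<n}. t i)"
        "(\<lambda>i\<in>{..<n}. snd ((\<lambda>i\<in>{..<n}. (t i, u i)) i)) = (\<lambda>i\<in>{..<n}. u i)" for t u :: "nat \<Rightarrow> nat \<times> 't"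
        by (auto simp: restrict_def)
      then have Ctu: "C (\<lambda>i\<in>{..<n}. (t i, u i)) = c t * c u"
        if "t \<in> PiE {..<n} (\<lambda>_. ?X)" "u \<in> PiE {..<n} (\<lambda>_. ?X)" for t u
        unfolding C_def using r[OF that(1)] r[OF that(2)] by simp
      show ?thesis
        unfolding sum_PiE_Times[where X = "?X" and Y = "?X"]
      proof (intro sum.cong refl arg_cong2[where f = "(*)"])
        show "c t * c u = C (\<lambda>i\<in>{..<n}. (t i, u i))"
          if "t \<in> PiE {..<n} (\<lambda>_. ?X)" "u \<in> PiE {..<n} (\<lambda>_. ?X)" for t u
          by (rule Ctu[OF that, symmetric])
      qed (intro prod.cong refl, simp)
    qed
    finally show ?thesis .
  qed
  have expand: "complex_of_real ((cmod (multilinear T e J n c \<rho>)) ^ 4) = (\<Sum>z\<in>?Z. \<Sum>w\<in>?Z. C z * cnj (C w) * ?m z w \<rho>)" for \<rho>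
  proof -
    have "(cmod (multilinear T e J n c \<rho>)) ^ 4 = (cmod ((multilinear T e J n c \<rho>)\<^sup>2))\<^sup>2"
      unfolding norm_power power_mult[symmetric] by simp
    then have "complex_of_real ((cmod (multilinear T e J n c \<rho>)) ^ 4) = (multilinear T e J n c \<rho>)\<^sup>2 * cnj ((multilinear T e J n c \<rho>)\<^sup>2)"
      by (simp only: complex_norm_square)
    also have "\<dots> = (\<Sum>z\<in>?Z. \<Sum>w\<in>?Z. C z * cnj (C w) * ?m z w \<rho>)"
      unfolding sq cnj_sum sum_product
      by (intro sum.cong refl) (simp add: circ_monomial_def prod.distrib mult_ac)
    finally show ?thesis .
  qed
  have int: "integrable joint_law (?m z w)" if "z \<in> ?Z" "w \<in> ?Z" for z w
    using mem that by (intro joint_moments(1)) auto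
  have "integrable joint_law (\<lambda>\<rho>. complex_of_real ((cmod (multilinear T e J n c \<rho>)) ^ 4))"
    unfolding expand by (intro Bochner_Integration.integrable_sum integrable_mult_right int)
  from integrable_Re[OF this] show "integrable joint_law (\<lambda>\<rho>. (cmod (multilinear T e J n c \<rho>)) ^ 4)" by simp
  have "complex_of_real (\<integral>\<rho>. (cmod (multilinear T e J n c \<rho>)) ^ 4 \<partial>joint_law) = (\<Sum>z\<in>?Z. \<Sum>w\<in>?Z. C z * cnj (C w) * integral\<^sup>L joint_law (?m z w))"
    unfolding integral_complex_of_real[symmetric] expand by (rule integral_double_sum[OF int])
  also have "\<dots> = (\<Sum>z\<in>?Z. \<Sum>w\<in>?Z. C z * cnj (C w) * (\<Prod>i<n. A (z i) (w i)))"
    unfolding A_def using mem by (intro sum.cong refl arg_cong2[where f = "(*)"] joint_moments(2)) auto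
  finally have "(\<integral>\<rho>. (cmod (multilinear T e J n c \<rho>)) ^ 4 \<partial>joint_law) = Re (\<Sum>z\<in>?Z. \<Sum>w\<in>?Z. C z * cnj (C w) * (\<Prod>i<n. A (z i) (w i)))"
    by (metis Re_complex_of_real)
  also have "\<dots> \<le> Re (\<Sum>z\<in>?Z. \<Sum>w\<in>?Z. C z * cnj (C w) * (\<Prod>i<n. B (z i) (w i)))"
  proof -
    have mono2: "circ_monomial ?e [p, q] [r, s] = (\<lambda>\<omega>. (?e p \<omega> * ?e q \<omega>) * cnj (?e r \<omega> * ?e s \<omega>))" for p q r s
      by (auto simp: circ_monomial_def fun_eq_iff)
    have "psd_kernel ?Z (\<lambda>x y. (\<Prod>i<n. B (x i) (y i)) - (\<Prod>i<n. A (x i) (y i)))"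
    \<comment> \<open>\<open>B\<close> is a Gram kernel: the vectors e_x + e_(swap x) have twice the
      Wick kernel as inner products, hence the scaling by the square root of K v^2 / 2.\<close>
    proof (rule psd_kernel_tensor_power[where \<nu> = row_law and \<phi> = "\<lambda>x \<omega>. ?e (fst x) \<omega> * ?e (snd x) \<omega>"
          and Z = "?X \<times> ?X" and \<beta> = "\<lambda>z x. of_real (sqrt (K * v\<^sup>2 / 2)) * ((if z = x then 1 else 0) + (if z = prod.swap x then 1 else 0))"])
      fix x y assume xy: "x \<in> ?X \<times> ?X" "y \<in> ?X \<times> ?X"
      show "integrable row_law (\<lambda>\<omega>. ?e (fst x) \<omega> * ?e (snd x) \<omega> * cnj (?e (fst y) \<omega> * ?e (snd y) \<omega>))"
        using circular_blockD(3)[OF rowblk, of "[fst x, snd x]" "[fst y, snd y]"] xy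
        unfolding mono2 by (auto simp: mem_Times_iff)
      show "A x y = (\<integral>\<omega>. ?e (fst x) \<omega> * ?e (snd x) \<omega> * cnj (?e (fst y) \<omega> * ?e (snd y) \<omega>) \<partial>row_law)"
        unfolding A_def mono2 ..
      have sx: "prod.swap x \<in> ?X \<times> ?X" using xy by auto
      have root: "complex_of_real (sqrt (K * v\<^sup>2 / 2)) * cnj (complex_of_real (sqrt (K * v\<^sup>2 / 2))) = of_real (K * v\<^sup>2 / 2)"
        using K by (simp flip: of_real_mult)
      have "(\<Sum>z\<in>?X \<times> ?X. of_real (sqrt (K * v\<^sup>2 / 2)) * ((if z = x then 1 else 0) + (if z = prod.swap x then 1 else 0)) *
            cnj (of_real (sqrt (K * v\<^sup>2 / 2)) * ((if z = y then 1 else 0) + (if z = prod.swap y then 1 else 0)))) =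
         (\<Sum>z\<in>?X \<times> ?X. (if z = x then of_real (K * v\<^sup>2 / 2) * ((if z = y then 1 else 0) + (if z = prod.swap y then 1 else 0)) else 0) +
            (if z = prod.swap x then of_real (K * v\<^sup>2 / 2) * ((if z = y then 1 else 0) + (if z = prod.swap y then 1 else 0)) else 0))"
        unfolding root[symmetric] by (intro sum.cong refl) (simp add: algebra_simps)
      also have "\<dots> = of_real (K * v\<^sup>2 / 2) * ((if x = y then 1 else 0) + (if x = prod.swap y then 1 else 0)) +
         of_real (K * v\<^sup>2 / 2) * ((if prod.swap x = y then 1 else 0) + (if prod.swap x = prod.swap y then 1 else 0))"
        using finX xy(1) sx by (simp only: sum.distrib sum.delta if_True)
      also have "\<dots> = B x y"
      proof -
        have eqs: "x = prod.swap y \<longleftrightarrow> y = prod.swap x" "prod.swap x = y \<longleftrightarrow> y = prod.swap x"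
          "prod.swap x = prod.swap y \<longleftrightarrow> y = x" "x = y \<longleftrightarrow> y = x"
          by (metis swap_swap)+
        show ?thesis unfolding B_def eqs by (simp add: algebra_simps)
      qed
      finally show "B x y = (\<Sum>z\<in>?X \<times> ?X. of_real (sqrt (K * v\<^sup>2 / 2)) * ((if z = x then 1 else 0) + (if z = prod.swap x then 1 else 0)) *
            cnj (of_real (sqrt (K * v\<^sup>2 / 2)) * ((if z = y then 1 else 0) + (if z = prod.swap y then 1 else 0))))" ..
    next
      \<comment> \<open>The form of \<open>A\<close> is a fourth moment and the form of
        \<open>B\<close> is its bound in \<open>circular_block\<close>, so that clause is the
        required positivity.\<close>
      show "psd_kernel (?X \<times> ?X) (\<lambda>x y. B x y - A x y)"
        unfolding psd_kernel_def
      proof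
        fix k :: "(nat \<times> 't) \<times> (nat \<times> 't) \<Rightarrow> complex"
        let ?k = "\<lambda>t t'. k (t, t')"
        let ?Q = "\<integral>\<omega>. (cmod (\<Sum>t\<in>?X. \<Sum>t'\<in>?X. ?k t t' * ?e t \<omega> * ?e t' \<omega>))\<^sup>2 \<partial>row_law"
        let ?R = "\<Sum>t\<in>?X. \<Sum>t'\<in>?X. (cmod (?k t t' + ?k t' t))\<^sup>2"
        have QA: "complex_of_real ?Q = (\<Sum>x\<in>?X\<times>?X. \<Sum>y\<in>?X\<times>?X. k x * cnj (k y) * A x y)"
          unfolding A_def
          by (subst quartic_form_eq) (auto intro: circular_blockD(3)[OF rowblk])
        have "(\<Sum>x\<in>?X\<times>?X. \<Sum>y\<in>?X\<times>?X. k x * cnj (k y) * B x y) =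
          (\<Sum>x\<in>?X\<times>?X. \<Sum>y\<in>?X\<times>?X. (if y = prod.swap x then of_real (K * v\<^sup>2) * (k x * cnj (k y)) else 0)
             + (if y = x then of_real (K * v\<^sup>2) * (k x * cnj (k y)) else 0))"
          unfolding B_def by (intro sum.cong refl) (simp add: algebra_simps)
        also have "\<dots> = (\<Sum>x\<in>?X\<times>?X. of_real (K * v\<^sup>2) * (k x * cnj (k (prod.swap x))) + of_real (K * v\<^sup>2) * (k x * cnj (k x)))"
        proof (intro sum.cong refl)
          fix x assume x: "x \<in> ?X \<times> ?X"
          then have "prod.swap x \<in> ?X \<times> ?X" by auto
          then show "(\<Sum>y\<in>?X\<times>?X. (if y = prod.swap x then of_real (K * v\<^sup>2) * (k x * cnj (k y)) else 0)
             + (if y = x then of_real (K * v\<^sup>2) * (k x * cnj (k y)) else 0)) =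
            of_real (K * v\<^sup>2) * (k x * cnj (k (prod.swap x))) + of_real (K * v\<^sup>2) * (k x * cnj (k x))"
            using finX x by (simp only: sum.distrib sum.delta if_True)
        qed
        also have "\<dots> = of_real (K * v\<^sup>2) * (\<Sum>t\<in>?X. \<Sum>t'\<in>?X. if True then ?k t t' * cnj (?k t t' + ?k t' t) else 0)"
          unfolding sum.cartesian_product' sum_distrib_left
          by (intro sum.cong refl) (simp add: algebra_simps)
        also have "\<dots> = of_real (K * v\<^sup>2) * of_real (?R / 2)"
          by (subst symmetrized_square_sum) auto
        finally have QB: "(\<Sum>x\<in>?X\<times>?X. \<Sum>y\<in>?X\<times>?X. k x * cnj (k y) * B x y) = of_real (K * v\<^sup>2 / 2 * ?R)"
          by (simp add: mult.assoc)
        have "(\<Sum>x\<in>?X\<times>?X. \<Sum>y\<in>?X\<times>?X. k x * cnj (k y) * (B x y - A x y)) = of_real (K * v\<^sup>2 / 2 * ?R) - of_real ?Q"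
          unfolding QA QB[symmetric] by (simp only: right_diff_distrib sum_subtractf)
        then have "Re (\<Sum>x\<in>?X\<times>?X. \<Sum>y\<in>?X\<times>?X. k x * cnj (k y) * (B x y - A x y)) = K * v\<^sup>2 / 2 * ?R - ?Q"
          by (simp only: minus_complex.sel Re_complex_of_real)
        then show "0 \<le> Re (\<Sum>x\<in>?X\<times>?X. \<Sum>y\<in>?X\<times>?X. k x * cnj (k y) * (B x y - A x y))"
          using circular_blockD(6)[OF rowblk, of ?k] by linarith
      qed
    qed
    then have "0 \<le> Re (\<Sum>z\<in>?Z. \<Sum>w\<in>?Z. C z * cnj (C w) * ((\<Prod>i<n. B (z i) (w i)) - (\<Prod>i<n. A (z i) (w i))))"
      unfolding psd_kernel_def by blast
    then show ?thesis by (simp only: right_diff_distrib sum_subtractf minus_complex.sel diff_ge_0_iff_ge)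
  qed
  also have "(\<Sum>z\<in>?Z. \<Sum>w\<in>?Z. C z * cnj (C w) * (\<Prod>i<n. B (z i) (w i))) =
     (\<Sum>z\<in>?Z. \<Sum>w\<in>?Z. \<Sum>S\<in>Pow {..<n}. if w = swap_on S n z then of_real (K * v\<^sup>2) ^ n * (C z * cnj (C w)) else 0)"
  proof (intro sum.cong refl)
    fix z w assume zw: "z \<in> ?Z" "w \<in> ?Z"
    show "C z * cnj (C w) * (\<Prod>i<n. B (z i) (w i)) =
      (\<Sum>S\<in>Pow {..<n}. if w = swap_on S n z then of_real (K * v\<^sup>2) ^ n * (C z * cnj (C w)) else 0)"
      unfolding B_def prod_swap_kernel[OF zw] sum_distrib_left by (intro sum.cong refl) simp
  qed
  also have "\<dots> = (\<Sum>S\<in>Pow {..<n}. \<Sum>z\<in>?Z. \<Sum>w\<in>?Z. if w = swap_on S n z then of_real (K * v\<^sup>2) ^ n * (C z * cnj (C w)) else 0)"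
    by (simp only: sum.swap[of _ _ "Pow {..<n}"])
  also have "\<dots> = (\<Sum>S\<in>Pow {..<n}. \<Sum>z\<in>?Z. of_real (K * v\<^sup>2) ^ n * (C z * cnj (C (swap_on S n z))))"
  proof (intro sum.cong refl)
    fix S z assume z: "z \<in> ?Z"
    have "swap_on S n z \<in> ?Z"
      using mem[OF z] by (auto simp: swap_on_def PiE_iff mem_Times_iff)
    then show "(\<Sum>w\<in>?Z. if w = swap_on S n z then of_real (K * v\<^sup>2) ^ n * (C z * cnj (C w)) else 0) =
      of_real (K * v\<^sup>2) ^ n * (C z * cnj (C (swap_on S n z)))"
      using finZ by (simp only: sum.delta if_True)
  qed
  \<comment> \<open>The signs of the coefficients are given up here; only moduli enter the
    count.\<close>
  also have "Re \<dots> \<le> cmod \<dots>" by (rule complex_Re_le_cmod)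
  also have "\<dots> \<le> (\<Sum>S\<in>Pow {..<n}. \<Sum>z\<in>?Z. cmod (of_real (K * v\<^sup>2) ^ n * (C z * cnj (C (swap_on S n z)))))"
    by (intro order_trans[OF norm_sum] sum_mono norm_sum)
  also have "\<dots> = (K * v\<^sup>2) ^ n * (\<Sum>S\<in>Pow {..<n}. \<Sum>z\<in>?Z. cmod (C z) * cmod (C (swap_on S n z)))"
    using K by (simp add: norm_mult norm_power sum_distrib_left power_mult_distrib abs_mult)
  finally show "(\<integral>\<rho>. (cmod (multilinear T e J n c \<rho>)) ^ 4 \<partial>joint_law) \<le> (K * v\<^sup>2) ^ n *
    (\<Sum>S\<in>Pow {..<n}. \<Sum>z\<in>?Z.
       cmod (c (\<lambda>i\<in>{..<n}. fst (z i)) * c (\<lambda>i\<in>{..<n}. snd (z i))) *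
       cmod (c (\<lambda>i\<in>{..<n}. fst (swap_on S n z i)) * c (\<lambda>i\<in>{..<n}. snd (swap_on S n z i))))"
    unfolding C_def .
qed

end

section \<open>Determinants as multilinear forms\<close>

text \<open>A word takes one pair of matrix indices from each row. When the rows are multiplied in
  the order \<open>\<pi>\<close>, it contributes to the trace iff consecutive indices agree;
  \<open>mod n\<close> closes the path.\<close>

definition chained :: "nat \<Rightarrow> (nat \<Rightarrow> nat) \<Rightarrow> (nat \<Rightarrow> nat \<times> nat) \<Rightarrow> bool" where
  "chained n \<pi> w \<longleftrightarrow> (\<forall>i<n. snd (w (\<pi> i)) = fst (w (\<pi> (Suc i mod n))))"

abbreviation words :: "nat \<Rightarrow> nat \<Rightarrow> (nat \<Rightarrow> nat \<times> nat) set" where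
  "words n d \<equiv> PiE {..<n} (\<lambda>_. {..<d} \<times> {..<d})"

lemma finite_words [simp]: "finite (words n d)"
  by (intro finite_PiE) auto

section \<open>Ordered matrix products as sums over index paths\<close>

lemma mat_prod_carrier:
  assumes "\<And>i. i < n \<Longrightarrow> F i \<in> carrier_mat d d"
  shows "mat_prod d n F \<in> carrier_mat d d"
proof -
  have "foldr (*) (map F xs) (1\<^sub>m d) \<in> carrier_mat d d" if "set xs \<subseteq> {..<n}" for xs
    using that assms by (induction xs) (auto intro!: mult_carrier_mat[of _ d d])
  from this[of "[0..<n]"] show ?thesis by (simp add: mat_prod_def lessThan_atLeast0)
qed

lemma mat_prod_Suc:
  assumes "\<And>i. i < Suc n \<Longrightarrow> F i \<in> carrier_mat d d"
  shows "mat_prod d (Suc n) F = mat_prod d n F * F n"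
proof -
  have *: "foldr (*) (map F xs) B = foldr (*) (map F xs) (1\<^sub>m d) * B \<and> foldr (*) (map F xs) (1\<^sub>m d) \<in> carrier_mat d d"
    if "set xs \<subseteq> {..<Suc n}" "B \<in> carrier_mat d d" for xs B
    using that(1)
  proof (induction xs)
    case Nil
    then show ?case using that(2) by simp
  next
    case (Cons x xs)
    then have x: "F x \<in> carrier_mat d d" using assms by auto
    from Cons have IH: "foldr (*) (map F xs) B = foldr (*) (map F xs) (1\<^sub>m d) * B"
      "foldr (*) (map F xs) (1\<^sub>m d) \<in> carrier_mat d d" by auto
    show ?case using assoc_mult_mat[OF x IH(2) that(2)] x IH by simp
  qed
  have Fn: "F n \<in> carrier_mat d d" using assms by simp
  have "mat_prod d (Suc n) F = foldr (*) (map F [0..<n]) (F n * 1\<^sub>m d)" by (simp add: mat_prod_def)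
  also have "F n * 1\<^sub>m d = F n" using Fn by simp
  also have "foldr (*) (map F [0..<n]) (F n) = mat_prod d n F * F n"
    unfolding mat_prod_def using *[of "[0..<n]" "F n"] Fn by (simp add: lessThan_Suc_atMost atLeast0LessThan lessThan_subset_iff subset_iff)
  finally show ?thesis .
qed

text \<open>The path consists of the left indices \<open>a i\<close> of the factors; the right end
  \<open>y\<close> is kept apart because it is not summed over.\<close>

lemma mat_prod_entry:
  assumes "\<And>i. i < Suc n \<Longrightarrow> F i \<in> carrier_mat d d" "x < d" "y < d"
  shows "mat_prod d (Suc n) F $$ (x, y) =
    (\<Sum>a\<in>PiE {..<Suc n} (\<lambda>_. {..<d}). if a 0 = x then \<Prod>i<Suc n. F i $$ (a i, if i = n then y else a (Suc i)) else 0)"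
  using assms
proof (induction n arbitrary: y)
  case 0
  have "mat_prod d (Suc 0) F = F 0" using 0 by (simp add: mat_prod_def)
  moreover have "(\<Sum>a\<in>PiE {..<Suc 0} (\<lambda>_. {..<d}). if a 0 = x then \<Prod>i<Suc 0. F i $$ (a i, if i = 0 then y else a (Suc i)) else 0) =
    (\<Sum>s<d. if s = x then F 0 $$ (s, y) else 0)"
    unfolding sum_PiE_Suc by (intro sum.cong) auto
  ultimately show ?case using 0 by simp
next
  case (Suc n)
  have C: "F i \<in> carrier_mat d d" if "i < Suc (Suc n)" for i using Suc.prems that by simp
  have Meq: "mat_prod d (Suc (Suc n)) F = mat_prod d (Suc n) F * F (Suc n)"
    by (rule mat_prod_Suc) (rule C)
  have M: "mat_prod d (Suc n) F \<in> carrier_mat d d" using C by (intro mat_prod_carrier) auto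
  have "mat_prod d (Suc (Suc n)) F $$ (x, y) = (\<Sum>z<d. mat_prod d (Suc n) F $$ (x, z) * F (Suc n) $$ (z, y))"
    unfolding Meq using M C[OF lessI] Suc.prems(2,3)
    by (auto simp: scalar_prod_def atLeast0LessThan intro!: sum.cong)
  also have "\<dots> = (\<Sum>z<d. \<Sum>a\<in>PiE {..<Suc n} (\<lambda>_. {..<d}).
      (if a 0 = x then \<Prod>i<Suc n. F i $$ (a i, if i = n then z else a (Suc i)) else 0) * F (Suc n) $$ (z, y))"
    using Suc by (intro sum.cong refl) (simp add: sum_distrib_right)
  also have "\<dots> = (\<Sum>z<d. \<Sum>a\<in>PiE {..<Suc n} (\<lambda>_. {..<d}).
      (if (a(Suc n := z)) 0 = x then \<Prod>i<Suc (Suc n). F i $$ ((a(Suc n := z)) i, if i = Suc n then y else (a(Suc n := z)) (Suc i)) else 0))"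
  proof (intro sum.cong refl)
    fix z a
    have "(\<Prod>i<Suc n. F i $$ ((a(Suc n := z)) i, if i = Suc n then y else (a(Suc n := z)) (Suc i))) =
      (\<Prod>i<Suc n. F i $$ (a i, if i = n then z else a (Suc i)))"
      by (intro prod.cong refl) auto
    then show "(if a 0 = x then \<Prod>i<Suc n. F i $$ (a i, if i = n then z else a (Suc i)) else 0) * F (Suc n) $$ (z, y) =
      (if (a(Suc n := z)) 0 = x then \<Prod>i<Suc (Suc n). F i $$ ((a(Suc n := z)) i, if i = Suc n then y else (a(Suc n := z)) (Suc i)) else 0)"
      unfolding prod.lessThan_Suc[of _ "Suc n"] by simp
  qed
  also have "\<dots> = (\<Sum>a\<in>PiE {..<Suc (Suc n)} (\<lambda>_. {..<d}).
      if a 0 = x then \<Prod>i<Suc (Suc n). F i $$ (a i, if i = Suc n then y else a (Suc i)) else 0)"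
    by (subst sum_PiE_Suc[of _ "Suc n"]) simp
  finally show ?case .
qed

text \<open>Identifying the right end with \<open>a 0\<close> amounts to reading the successor of an
  index modulo \<open>n\<close>.\<close>

lemma trace_mat_prod:
  assumes F: "\<And>i. i < n \<Longrightarrow> F i \<in> carrier_mat d d" and n: "n \<ge> 1"
  shows "trace (mat_prod d n F) = (\<Sum>a\<in>PiE {..<n} (\<lambda>_. {..<d}). \<Prod>i<n. F i $$ (a i, a (Suc i mod n)))"
proof -
  obtain m where m: "n = Suc m" using n by (cases n) auto
  have "trace (mat_prod d n F) = (\<Sum>x<d. mat_prod d n F $$ (x, x))"
    using mat_prod_carrier[of n F d] F by (simp add: trace_def)
  also have "\<dots> = (\<Sum>x<d. \<Sum>a\<in>PiE {..<n} (\<lambda>_. {..<d}). if a 0 = x then \<Prod>i<n. F i $$ (a i, if i = m then x else a (Suc i)) else 0)"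
    unfolding m using F by (intro sum.cong refl mat_prod_entry) (auto simp: m)
  also have "\<dots> = (\<Sum>a\<in>PiE {..<n} (\<lambda>_. {..<d}). \<Sum>x<d. if x = a 0 then \<Prod>i<n. F i $$ (a i, if i = m then x else a (Suc i)) else 0)"
    by (subst sum.swap, intro sum.cong refl if_cong eq_commute)
  also have "\<dots> = (\<Sum>a\<in>PiE {..<n} (\<lambda>_. {..<d}). \<Prod>i<n. F i $$ (a i, a (Suc i mod n)))"
  proof (intro sum.cong refl)
    fix a assume "a \<in> PiE {..<n} (\<lambda>_. {..<d})"
    then have "a 0 < d" using m by (auto simp: PiE_iff)
    then have "(\<Sum>x<d. if x = a 0 then \<Prod>i<n. F i $$ (a i, if i = m then x else a (Suc i)) else 0) =
      (\<Prod>i<n. F i $$ (a i, if i = m then a 0 else a (Suc i)))" by simp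
    also have "\<dots> = (\<Prod>i<n. F i $$ (a i, a (Suc i mod n)))"
      using m by (intro prod.cong refl) (auto simp: mod_Suc)
    finally show "(\<Sum>x<d. if x = a 0 then \<Prod>i<n. F i $$ (a i, if i = m then x else a (Suc i)) else 0) = \<dots>" .
  qed
  finally show ?thesis .
qed

text \<open>A closed path of matrix indices is encoded by the word of index pairs that it reads off in the
  rows \<open>\<pi> 0, \<pi> 1, \<dots>\<close>.\<close>

lemma bij_betw_chained:
  assumes \<pi>: "\<pi> permutes {..<n}"
  shows "bij_betw (\<lambda>a. \<lambda>k\<in>{..<n}. (a (inv_into UNIV \<pi> k), a (Suc (inv_into UNIV \<pi> k) mod n)))
    (PiE {..<n} (\<lambda>_. {..<d})) {w \<in> words n d. chained n \<pi> w}"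
proof (rule bij_betw_byWitness[where f' = "\<lambda>w. \<lambda>i\<in>{..<n}. fst (w (\<pi> i))"])
  have \<pi>n: "\<pi> i < n \<longleftrightarrow> i < n" "inv_into UNIV \<pi> i < n \<longleftrightarrow> i < n" for i
    using permutes_in_image[OF \<pi>] permutes_in_image[OF permutes_inv[OF \<pi>]] by auto
  note inv = permutes_inverses[OF \<pi>]
  show "\<forall>a\<in>PiE {..<n} (\<lambda>_. {..<d}). (\<lambda>i\<in>{..<n}. fst ((\<lambda>k\<in>{..<n}. (a (inv_into UNIV \<pi> k), a (Suc (inv_into UNIV \<pi> k) mod n))) (\<pi> i))) = a"
    by (auto simp: fun_eq_iff \<pi>n inv restrict_def PiE_iff extensional_def)
  show "\<forall>w\<in>{w \<in> words n d. chained n \<pi> w}.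
      (\<lambda>k\<in>{..<n}. ((\<lambda>i\<in>{..<n}. fst (w (\<pi> i))) (inv_into UNIV \<pi> k), (\<lambda>i\<in>{..<n}. fst (w (\<pi> i))) (Suc (inv_into UNIV \<pi> k) mod n))) = w"
  proof
    fix w assume "w \<in> {w \<in> words n d. chained n \<pi> w}"
    then have w: "w \<in> words n d" and c: "chained n \<pi> w" by auto
    show "(\<lambda>k\<in>{..<n}. ((\<lambda>i\<in>{..<n}. fst (w (\<pi> i))) (inv_into UNIV \<pi> k), (\<lambda>i\<in>{..<n}. fst (w (\<pi> i))) (Suc (inv_into UNIV \<pi> k) mod n))) = w"
    proof
      fix k
      show "(\<lambda>k\<in>{..<n}. ((\<lambda>i\<in>{..<n}. fst (w (\<pi> i))) (inv_into UNIV \<pi> k), (\<lambda>i\<in>{..<n}. fst (w (\<pi> i))) (Suc (inv_into UNIV \<pi> k) mod n))) k = w k"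
      proof (cases "k < n")
        case True
        then have "Suc (inv_into UNIV \<pi> k) mod n < n" by simp
        moreover have "snd (w k) = fst (w (\<pi> (Suc (inv_into UNIV \<pi> k) mod n)))"
          using c[unfolded chained_def, rule_format, of "inv_into UNIV \<pi> k"] True \<pi>n inv by simp
        ultimately show ?thesis using True \<pi>n inv by (simp add: prod_eq_iff)
      next
        case False
        then show ?thesis using w by (auto simp: PiE_iff extensional_def)
      qed
    qed
  qed
  show "(\<lambda>a. \<lambda>k\<in>{..<n}. (a (inv_into UNIV \<pi> k), a (Suc (inv_into UNIV \<pi> k) mod n))) ` PiE {..<n} (\<lambda>_. {..<d}) \<subseteq> {w \<in> words n d. chained n \<pi> w}"
  proof (intro subsetI, elim imageE)
    fix w a assume w: "w = (\<lambda>k\<in>{..<n}. (a (inv_into UNIV \<pi> k), a (Suc (inv_into UNIV \<pi> k) mod n)))" and a: "a \<in> PiE {..<n} (\<lambda>_. {..<d})"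
    have ad: "a i < d" if "i < n" for i using a that by (auto simp: PiE_iff)
    have mod: "Suc i mod n < n" if "i < n" for i using that by simp
    have "w \<in> words n d" unfolding w using ad mod \<pi>n by (intro restrict_PiE_iff[THEN iffD2]) auto
    moreover have "chained n \<pi> w" unfolding chained_def w using \<pi>n inv mod by simp
    ultimately show "w \<in> {w \<in> words n d. chained n \<pi> w}" by simp
  qed
  show "(\<lambda>w. \<lambda>i\<in>{..<n}. fst (w (\<pi> i))) ` {w \<in> words n d. chained n \<pi> w} \<subseteq> PiE {..<n} (\<lambda>_. {..<d})"
  proof (intro subsetI, elim imageE)
    fix a w assume a: "a = (\<lambda>i\<in>{..<n}. fst (w (\<pi> i)))" and "w \<in> {w \<in> words n d. chained n \<pi> w}"
    then have "w i \<in> {..<d} \<times> {..<d}" if "i < n" for i using that by (auto simp: PiE_iff)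
    then show "a \<in> PiE {..<n} (\<lambda>_. {..<d})" unfolding a using \<pi>n
      by (intro restrict_PiE_iff[THEN iffD2]) (auto simp: mem_Times_iff)
  qed
qed

lemma card_chained:
  assumes "\<pi> permutes {..<n}"
  shows "card {w \<in> words n d. chained n \<pi> w} = d ^ n"
  using bij_betw_same_card[OF bij_betw_chained[OF assms, of d]] by (simp add: card_PiE)

text \<open>Words are indexed by rows instead of positions, so that products in all orders are sums
  over the same monomials and differ only in the condition \<open>chained\<close>.\<close>

lemma trace_mat_prod_chained:
  assumes \<pi>: "\<pi> permutes {..<n}" and n: "n \<ge> 1" and G: "\<And>i. i < n \<Longrightarrow> G i \<in> carrier_mat d d"
  shows "trace (mat_prod d n (\<lambda>i. G (\<pi> i))) = (\<Sum>w\<in>words n d. if chained n \<pi> w then \<Prod>k<n. G k $$ w k else 0)"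
proof -
  have \<pi>n: "\<pi> i < n \<longleftrightarrow> i < n" for i using permutes_in_image[OF \<pi>] by auto
  let ?b = "\<lambda>a. \<lambda>k\<in>{..<n}. (a (inv_into UNIV \<pi> k), a (Suc (inv_into UNIV \<pi> k) mod n)) :: nat \<times> nat"
  have "(\<Sum>w\<in>words n d. if chained n \<pi> w then \<Prod>k<n. G k $$ w k else 0) = (\<Sum>w\<in>{w \<in> words n d. chained n \<pi> w}. \<Prod>k<n. G k $$ w k)"
    by (rule sum.inter_filter[symmetric]) simp
  also have "\<dots> = (\<Sum>a\<in>PiE {..<n} (\<lambda>_. {..<d}). \<Prod>k<n. G k $$ ?b a k)"
    by (rule sum.reindex_bij_betw[OF bij_betw_chained[OF \<pi>], symmetric])
  also have "\<dots> = (\<Sum>a\<in>PiE {..<n} (\<lambda>_. {..<d}). \<Prod>i<n. G (\<pi> i) $$ (a i, a (Suc i mod n)))"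
  proof (intro sum.cong refl)
    fix a :: "nat \<Rightarrow> nat"
    have "(\<Prod>k<n. G k $$ ?b a k) = (\<Prod>i<n. G (\<pi> i) $$ ?b a (\<pi> i))"
      by (rule prod.reindex_bij_betw[OF permutes_imp_bij[OF \<pi>], symmetric])
    also have "\<dots> = (\<Prod>i<n. G (\<pi> i) $$ (a i, a (Suc i mod n)))"
      using \<pi>n by (intro prod.cong refl) (simp add: permutes_inverses[OF \<pi>])
    finally show "(\<Prod>k<n. G k $$ ?b a k) = \<dots>" .
  qed
  also have "\<dots> = trace (mat_prod d n (\<lambda>i. G (\<pi> i)))"
    using G \<pi>n by (intro trace_mat_prod[symmetric] n) auto
  finally show ?thesis by (rule sym)
qed

text \<open>The proportion of orders in \<open>R\<close> in which the word contributes.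
  \<open>R\<close> will be \<open>{id}\<close> for the Cayley determinant and the set of all
  permutations for the symmetrized one.\<close>

definition order_weight :: "(nat \<Rightarrow> nat) set \<Rightarrow> nat \<Rightarrow> (nat \<Rightarrow> nat \<times> nat) \<Rightarrow> real" where
  "order_weight R n w = (\<Sum>\<pi>\<in>R. if chained n \<pi> w then 1 else 0) / card R"

text \<open>The part of a coefficient that depends on the columns. At most one
  \<open>\<sigma>\<close> agrees with \<open>f\<close> on all rows, so the sum selects it, or is 0
  if there is none.\<close>

definition signed_diagonal :: "complex mat \<Rightarrow> nat \<Rightarrow> (nat \<Rightarrow> nat) \<Rightarrow> complex" where
  "signed_diagonal A n f = (\<Sum>\<sigma> | \<sigma> permutes {..<n}.
     if \<forall>i<n. f i = \<sigma> i then of_int (sign \<sigma>) * (\<Prod>i<n. A $$ (i, \<sigma> i)) else 0)"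

definition det_coeff :: "complex mat \<Rightarrow> (nat \<Rightarrow> nat) set \<Rightarrow> nat \<Rightarrow> (nat \<Rightarrow> nat \<times> (nat \<times> nat)) \<Rightarrow> complex" where
  "det_coeff A R n t = signed_diagonal A n (\<lambda>i\<in>{..<n}. fst (t i)) * of_real (order_weight R n (\<lambda>i\<in>{..<n}. snd (t i)))"

definition ordered_det_trace :: "complex mat \<Rightarrow> (nat \<Rightarrow> nat) set \<Rightarrow> nat \<Rightarrow> nat \<Rightarrow> (nat \<times> nat \<Rightarrow> complex mat) \<Rightarrow> complex" where
  "ordered_det_trace A R d n \<rho> = (\<Sum>\<pi>\<in>R. \<Sum>\<sigma> | \<sigma> permutes {..<n}.
     of_int (sign \<sigma>) * trace (mat_prod d n (\<lambda>i. A $$ (\<pi> i, \<sigma> (\<pi> i)) \<cdot>\<^sub>m \<rho> (\<pi> i, \<sigma> (\<pi> i))))) / card R"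

lemma signed_diagonal_sum:
  "(\<Sum>f\<in>PiE {..<n} (\<lambda>_. {..<n}). signed_diagonal A n f * F f) =
   (\<Sum>\<sigma> | \<sigma> permutes {..<n}. of_int (sign \<sigma>) * (\<Prod>i<n. A $$ (i, \<sigma> i)) * F (restrict \<sigma> {..<n}))"
proof -
  have "(\<Sum>f\<in>PiE {..<n} (\<lambda>_. {..<n}). signed_diagonal A n f * F f) =
    (\<Sum>f\<in>PiE {..<n} (\<lambda>_. {..<n}). \<Sum>\<sigma> | \<sigma> permutes {..<n}. if f = restrict \<sigma> {..<n} then of_int (sign \<sigma>) * (\<Prod>i<n. A $$ (i, \<sigma> i)) * F f else 0)"
  proof (intro sum.cong refl)
    fix f assume f: "f \<in> PiE {..<n} (\<lambda>_. {..<n})"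
    have "(\<forall>i<n. f i = \<sigma> i) \<longleftrightarrow> f = restrict \<sigma> {..<n}" for \<sigma>
      using f by (auto simp: fun_eq_iff restrict_def PiE_iff extensional_def)
    then show "signed_diagonal A n f * F f =
      (\<Sum>\<sigma> | \<sigma> permutes {..<n}. if f = restrict \<sigma> {..<n} then of_int (sign \<sigma>) * (\<Prod>i<n. A $$ (i, \<sigma> i)) * F f else 0)"
      unfolding signed_diagonal_def sum_distrib_right by (intro sum.cong refl) simp
  qed
  also have "\<dots> = (\<Sum>\<sigma> | \<sigma> permutes {..<n}. \<Sum>f\<in>PiE {..<n} (\<lambda>_. {..<n}). if f = restrict \<sigma> {..<n} then of_int (sign \<sigma>) * (\<Prod>i<n. A $$ (i, \<sigma> i)) * F f else 0)"
    by (rule sum.swap)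
  also have "\<dots> = (\<Sum>\<sigma> | \<sigma> permutes {..<n}. of_int (sign \<sigma>) * (\<Prod>i<n. A $$ (i, \<sigma> i)) * F (restrict \<sigma> {..<n}))"
  proof (intro sum.cong refl)
    fix \<sigma> assume "\<sigma> \<in> {\<sigma>. \<sigma> permutes {..<n}}"
    then have "restrict \<sigma> {..<n} \<in> PiE {..<n} (\<lambda>_. {..<n})"
      using permutes_in_image[of \<sigma> "{..<n}"] by (intro restrict_PiE_iff[THEN iffD2]) auto
    then show "(\<Sum>f\<in>PiE {..<n} (\<lambda>_. {..<n}). if f = restrict \<sigma> {..<n} then of_int (sign \<sigma>) * (\<Prod>i<n. A $$ (i, \<sigma> i)) * F f else 0) =
      of_int (sign \<sigma>) * (\<Prod>i<n. A $$ (i, \<sigma> i)) * F (restrict \<sigma> {..<n})"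
      by (simp add: finite_PiE)
  qed
  finally show ?thesis .
qed

text \<open>Reordering the factors of a diagonal affects neither its sign nor its entries of
  \<open>A\<close>, only the words that contribute. The coefficients therefore factor into a column
  part and a word part, which is what separates \<open>A\<close> from \<open>d\<close>.\<close>

lemma ordered_det_trace_eq_multilinear:
  assumes n: "n \<ge> 1" and R: "\<And>\<pi>. \<pi> \<in> R \<Longrightarrow> \<pi> permutes {..<n}"
    and \<rho>: "\<And>ij. ij \<in> {..<n} \<times> {..<n} \<Longrightarrow> \<rho> ij \<in> carrier_mat d d"
  shows "ordered_det_trace A R d n \<rho> =
    multilinear ({..<d} \<times> {..<d}) (\<lambda>ab M. M $$ ab) {..<n} n (det_coeff A R n) \<rho>"
proof -
  let ?F = "PiE {..<n} (\<lambda>_. {..<n})"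
  let ?D = "\<lambda>\<sigma>. of_int (sign \<sigma>) * (\<Prod>i<n. A $$ (i, \<sigma> i)) :: complex"
  have tr: "trace (mat_prod d n (\<lambda>i. A $$ (\<pi> i, \<sigma> (\<pi> i)) \<cdot>\<^sub>m \<rho> (\<pi> i, \<sigma> (\<pi> i)))) =
     (\<Prod>i<n. A $$ (i, \<sigma> i)) * (\<Sum>w\<in>words n d. if chained n \<pi> w then \<Prod>k<n. \<rho> (k, \<sigma> k) $$ w k else 0)"
    if "\<pi> \<in> R" "\<sigma> permutes {..<n}" for \<pi> \<sigma>
  proof -
    have \<sigma>n: "\<sigma> i < n" if "i < n" for i using permutes_in_image[OF \<open>\<sigma> permutes {..<n}\<close>, of i] that by simp
    have C: "\<rho> (i, \<sigma> i) \<in> carrier_mat d d" if "i < n" for i using \<rho>[of "(i, \<sigma> i)"] \<sigma>n that by auto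
    have "trace (mat_prod d n (\<lambda>i. A $$ (\<pi> i, \<sigma> (\<pi> i)) \<cdot>\<^sub>m \<rho> (\<pi> i, \<sigma> (\<pi> i)))) =
      (\<Sum>w\<in>words n d. if chained n \<pi> w then \<Prod>k<n. (A $$ (k, \<sigma> k) \<cdot>\<^sub>m \<rho> (k, \<sigma> k)) $$ w k else 0)"
      using C by (intro trace_mat_prod_chained[of \<pi> n "\<lambda>i. A $$ (i, \<sigma> i) \<cdot>\<^sub>m \<rho> (i, \<sigma> i)"] R that n) auto
    also have "\<dots> = (\<Sum>w\<in>words n d. (\<Prod>i<n. A $$ (i, \<sigma> i)) * (if chained n \<pi> w then \<Prod>k<n. \<rho> (k, \<sigma> k) $$ w k else 0))"
    proof (intro sum.cong refl)
      fix w assume w: "w \<in> words n d"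
      have "(A $$ (k, \<sigma> k) \<cdot>\<^sub>m \<rho> (k, \<sigma> k)) $$ w k = A $$ (k, \<sigma> k) * \<rho> (k, \<sigma> k) $$ w k" if "k < n" for k
      proof -
        have "w k \<in> {..<d} \<times> {..<d}" using w that by (auto simp: PiE_iff)
        then show ?thesis using C[OF that] by (cases "w k") auto
      qed
      then show "(if chained n \<pi> w then \<Prod>k<n. (A $$ (k, \<sigma> k) \<cdot>\<^sub>m \<rho> (k, \<sigma> k)) $$ w k else 0) =
        (\<Prod>i<n. A $$ (i, \<sigma> i)) * (if chained n \<pi> w then \<Prod>k<n. \<rho> (k, \<sigma> k) $$ w k else 0)"
        by (simp add: prod.distrib)
    qed
    finally show ?thesis by (simp only: sum_distrib_left)
  qed
  have ow: "complex_of_real (order_weight R n w) * x = (\<Sum>\<pi>\<in>R. if chained n \<pi> w then x else 0) / of_nat (card R)" for w x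
  proof -
    have "complex_of_real (\<Sum>\<pi>\<in>R. if chained n \<pi> w then 1 else 0) * x = (\<Sum>\<pi>\<in>R. if chained n \<pi> w then x else 0)"
      unfolding of_real_sum sum_distrib_right by (intro sum.cong refl) simp
    then show ?thesis by (simp add: order_weight_def)
  qed
  have "multilinear ({..<d} \<times> {..<d}) (\<lambda>ab M. M $$ ab) {..<n} n (det_coeff A R n) \<rho> =
    (\<Sum>f\<in>?F. \<Sum>w\<in>words n d. signed_diagonal A n f * (order_weight R n w * (\<Prod>i<n. \<rho> (i, f i) $$ w i)))"
    unfolding multilinear_def sum_PiE_Times[where X = "{..<n}"]
  proof (intro sum.cong refl)
    fix f w assume f: "f \<in> ?F" and w: "w \<in> words n d"
    have "(\<lambda>i\<in>{..<n}. fst ((\<lambda>i\<in>{..<n}. (f i, w i)) i)) = f" "(\<lambda>i\<in>{..<n}. snd ((\<lambda>i\<in>{..<n}. (f i, w i)) i)) = w"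
      using f w by (auto simp: fun_eq_iff restrict_def PiE_iff extensional_def)
    then show "det_coeff A R n (\<lambda>i\<in>{..<n}. (f i, w i)) *
        (\<Prod>i<n. \<rho> (i, fst ((\<lambda>i\<in>{..<n}. (f i, w i)) i)) $$ snd ((\<lambda>i\<in>{..<n}. (f i, w i)) i)) =
      signed_diagonal A n f * (order_weight R n w * (\<Prod>i<n. \<rho> (i, f i) $$ w i))"
      unfolding det_coeff_def by simp
  qed
  also have "\<dots> = (\<Sum>f\<in>?F. signed_diagonal A n f * (\<Sum>w\<in>words n d. order_weight R n w * (\<Prod>i<n. \<rho> (i, f i) $$ w i)))"
    by (simp only: sum_distrib_left)
  also have "\<dots> = (\<Sum>\<sigma> | \<sigma> permutes {..<n}. ?D \<sigma> * (\<Sum>w\<in>words n d. order_weight R n w * (\<Prod>i<n. \<rho> (i, \<sigma> i) $$ w i)))"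
    unfolding signed_diagonal_sum by (intro sum.cong refl arg_cong2[where f = "(*)"] prod.cong) auto
  also have "\<dots> = (\<Sum>\<sigma> | \<sigma> permutes {..<n}. ?D \<sigma> * (\<Sum>w\<in>words n d. \<Sum>\<pi>\<in>R. if chained n \<pi> w then \<Prod>k<n. \<rho> (k, \<sigma> k) $$ w k else 0) / card R)"
    by (simp only: ow sum_divide_distrib[symmetric] times_divide_eq_right)
  also have "\<dots> = (\<Sum>\<sigma> | \<sigma> permutes {..<n}. \<Sum>\<pi>\<in>R. of_int (sign \<sigma>) * trace (mat_prod d n (\<lambda>i. A $$ (\<pi> i, \<sigma> (\<pi> i)) \<cdot>\<^sub>m \<rho> (\<pi> i, \<sigma> (\<pi> i)))) / card R)"
    by (subst sum.swap[of _ R "words n d"], intro sum.cong refl)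
      (simp add: tr sum_distrib_left sum_divide_distrib mult.assoc)
  also have "\<dots> = ordered_det_trace A R d n \<rho>"
    unfolding ordered_det_trace_def sum_divide_distrib by (rule sum.swap)
  finally show ?thesis by (rule sym)
qed

section \<open>The Cayley and the symmetrized determinant\<close>

lemma trace_mat_sum: "trace (mat_sum d I F) = (\<Sum>i\<in>I. \<Sum>a<d. F i $$ (a, a))"
  unfolding trace_def mat_sum_def by (simp add: sum.swap[of _ I])

lemma mat_prod_cong: "(\<And>i. i < n \<Longrightarrow> F i = G i) \<Longrightarrow> mat_prod d n F = mat_prod d n G"
  unfolding mat_prod_def by (intro arg_cong[where f = "\<lambda>xs. foldr (*) xs (1\<^sub>m d)"] map_cong) auto

lemma trace_smult_carrier:
  assumes "M \<in> carrier_mat d d"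
  shows "(\<Sum>a<d. (c \<cdot>\<^sub>m M) $$ (a, a)) = c * trace M"
  using assms by (simp add: trace_def sum_distrib_left)

context
  fixes A :: "complex mat" and \<rho> :: "nat \<times> nat \<Rightarrow> complex mat" and n d :: nat
  assumes A: "A \<in> carrier_mat n n"
    and \<rho>: "\<And>ij. ij \<in> {..<n} \<times> {..<n} \<Longrightarrow> \<rho> ij \<in> carrier_mat d d"
begin

lemma trace_cayley_det_random_mat:
  "trace (cayley_det d (random_mat A \<rho>)) = ordered_det_trace A {id} d n \<rho>"
proof -
  have "trace (cayley_det d (random_mat A \<rho>)) = (\<Sum>\<sigma> | \<sigma> permutes {..<n}. \<Sum>a<d.
     (of_int (sign \<sigma>) \<cdot>\<^sub>m mat_prod d n (\<lambda>i. random_mat A \<rho> $$ (i, \<sigma> i))) $$ (a, a))"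
    using A by (simp add: cayley_det_def trace_mat_sum random_mat_def)
  also have "\<dots> = (\<Sum>\<sigma> | \<sigma> permutes {..<n}. of_int (sign \<sigma>) *
     trace (mat_prod d n (\<lambda>i. A $$ (i, \<sigma> i) \<cdot>\<^sub>m \<rho> (i, \<sigma> i))))"
  proof (intro sum.cong refl)
    fix \<sigma> assume "\<sigma> \<in> {\<sigma>. \<sigma> permutes {..<n}}"
    then have \<sigma>: "\<sigma> i < n" if "i < n" for i using permutes_in_image[of \<sigma> "{..<n}" i] that by simp
    have "mat_prod d n (\<lambda>i. random_mat A \<rho> $$ (i, \<sigma> i)) = mat_prod d n (\<lambda>i. A $$ (i, \<sigma> i) \<cdot>\<^sub>m \<rho> (i, \<sigma> i))"
      using A \<sigma> by (intro mat_prod_cong) (simp add: random_mat_def)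
    moreover have "mat_prod d n (\<lambda>i. A $$ (i, \<sigma> i) \<cdot>\<^sub>m \<rho> (i, \<sigma> i)) \<in> carrier_mat d d"
      using \<rho> \<sigma> by (intro mat_prod_carrier) auto
    ultimately show "(\<Sum>a<d. (of_int (sign \<sigma>) \<cdot>\<^sub>m mat_prod d n (\<lambda>i. random_mat A \<rho> $$ (i, \<sigma> i))) $$ (a, a)) =
      of_int (sign \<sigma>) * trace (mat_prod d n (\<lambda>i. A $$ (i, \<sigma> i) \<cdot>\<^sub>m \<rho> (i, \<sigma> i)))"
      by (simp only: trace_smult_carrier)
  qed
  finally show ?thesis by (simp add: ordered_det_trace_def)
qed

text \<open>Setting \<sigma> = \<alpha>' \<alpha>^(-1) turns a pair (\<alpha>, \<alpha>') into a
  diagonal \<sigma> and an order \<alpha> of its factors; \<open>1 / fact n\<close> becomes the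
  average over the orders.\<close>

lemma trace_sdet_random_mat:
  "trace (sdet d (random_mat A \<rho>)) = ordered_det_trace A {\<pi>. \<pi> permutes {..<n}} d n \<rho>"
proof -
  let ?P = "{\<pi>. \<pi> permutes {..<n}}"
  let ?S = "mat_sum d (?P \<times> ?P) (\<lambda>(\<alpha>, \<alpha>'). of_int (sign (\<alpha>' \<circ> inv_into UNIV \<alpha>)) \<cdot>\<^sub>m
            mat_prod d n (\<lambda>i. random_mat A \<rho> $$ (\<alpha> i, \<alpha>' i)))"
  have "trace (sdet d (random_mat A \<rho>)) = trace ((1 / fact n) \<cdot>\<^sub>m ?S)"
    using A by (simp add: sdet_def random_mat_def)
  also have "\<dots> = 1 / fact n * trace ?S"
    using trace_smult_carrier[of ?S d "1 / fact n"] by (simp add: trace_def mat_sum_def)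
  also have "trace ?S = (\<Sum>\<alpha>\<in>?P. \<Sum>\<alpha>'\<in>?P. \<Sum>a<d. (of_int (sign (\<alpha>' \<circ> inv_into UNIV \<alpha>)) \<cdot>\<^sub>m
            mat_prod d n (\<lambda>i. random_mat A \<rho> $$ (\<alpha> i, \<alpha>' i))) $$ (a, a))"
    unfolding trace_mat_sum sum.cartesian_product' by simp
  also have "\<dots> = (\<Sum>\<pi>\<in>?P. \<Sum>\<sigma>\<in>?P. of_int (sign \<sigma>) *
      trace (mat_prod d n (\<lambda>i. A $$ (\<pi> i, \<sigma> (\<pi> i)) \<cdot>\<^sub>m \<rho> (\<pi> i, \<sigma> (\<pi> i)))))"
  proof (rule sum.cong[OF refl])
    fix \<pi> assume "\<pi> \<in> ?P"
    then have \<pi>: "\<pi> permutes {..<n}" by simp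
    then have \<pi>n: "\<pi> i < n" if "i < n" for i using permutes_in_image[of \<pi> "{..<n}" i] that by simp
    have "(\<Sum>\<alpha>'\<in>?P. \<Sum>a<d. (of_int (sign (\<alpha>' \<circ> inv_into UNIV \<pi>)) \<cdot>\<^sub>m
            mat_prod d n (\<lambda>i. random_mat A \<rho> $$ (\<pi> i, \<alpha>' i))) $$ (a, a)) =
      (\<Sum>\<sigma>\<in>?P. \<Sum>a<d. (of_int (sign ((\<sigma> \<circ> \<pi>) \<circ> inv_into UNIV \<pi>)) \<cdot>\<^sub>m
            mat_prod d n (\<lambda>i. random_mat A \<rho> $$ (\<pi> i, (\<sigma> \<circ> \<pi>) i))) $$ (a, a))"
      by (rule sum_permutations_compose_right[OF \<pi>])
    also have "\<dots> = (\<Sum>\<sigma>\<in>?P. of_int (sign \<sigma>) *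
      trace (mat_prod d n (\<lambda>i. A $$ (\<pi> i, \<sigma> (\<pi> i)) \<cdot>\<^sub>m \<rho> (\<pi> i, \<sigma> (\<pi> i)))))"
    proof (intro sum.cong refl)
      fix \<sigma> assume "\<sigma> \<in> ?P"
      then have \<sigma>: "\<sigma> i < n" if "i < n" for i using permutes_in_image[of \<sigma> "{..<n}" i] that by simp
      have "(\<sigma> \<circ> \<pi>) \<circ> inv_into UNIV \<pi> = \<sigma>"
        using permutes_inv_o(1)[OF \<pi>] by (simp add: comp_assoc)
      moreover have "mat_prod d n (\<lambda>i. random_mat A \<rho> $$ (\<pi> i, (\<sigma> \<circ> \<pi>) i)) =
         mat_prod d n (\<lambda>i. A $$ (\<pi> i, \<sigma> (\<pi> i)) \<cdot>\<^sub>m \<rho> (\<pi> i, \<sigma> (\<pi> i)))"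
        using A \<sigma> \<pi>n by (intro mat_prod_cong) (simp add: random_mat_def)
      moreover have "mat_prod d n (\<lambda>i. A $$ (\<pi> i, \<sigma> (\<pi> i)) \<cdot>\<^sub>m \<rho> (\<pi> i, \<sigma> (\<pi> i))) \<in> carrier_mat d d"
        using \<rho> \<sigma> \<pi>n by (intro mat_prod_carrier) auto
      ultimately show "(\<Sum>a<d. (of_int (sign ((\<sigma> \<circ> \<pi>) \<circ> inv_into UNIV \<pi>)) \<cdot>\<^sub>m
            mat_prod d n (\<lambda>i. random_mat A \<rho> $$ (\<pi> i, (\<sigma> \<circ> \<pi>) i))) $$ (a, a)) =
        of_int (sign \<sigma>) * trace (mat_prod d n (\<lambda>i. A $$ (\<pi> i, \<sigma> (\<pi> i)) \<cdot>\<^sub>m \<rho> (\<pi> i, \<sigma> (\<pi> i))))"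
        by (simp only: trace_smult_carrier)
    qed
    finally show "(\<Sum>\<alpha>'\<in>?P. \<Sum>a<d. (of_int (sign (\<alpha>' \<circ> inv_into UNIV \<pi>)) \<cdot>\<^sub>m
            mat_prod d n (\<lambda>i. random_mat A \<rho> $$ (\<pi> i, \<alpha>' i))) $$ (a, a)) = \<dots>" .
  qed
  finally show ?thesis by (simp add: ordered_det_trace_def card_permutations)
qed

end

text \<open>There is at most one permutation behind \<open>f\<close>, and its entries are 0 or 1.
  Consequently the moduli and their squares have the same sum, the permanent of
  \<open>A\<close>.\<close>

lemma signed_diagonal_norm:
  assumes A: "zero_one_mat n A"
  shows "cmod (signed_diagonal A n f) \<in> {0, 1}"
proof (cases "\<exists>\<sigma>. \<sigma> permutes {..<n} \<and> (\<forall>i<n. f i = \<sigma> i)")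
  case True
  then obtain \<sigma> where \<sigma>: "\<sigma> permutes {..<n}" "\<forall>i<n. f i = \<sigma> i" by blast
  have uniq: "\<tau> = \<sigma>" if "\<tau> permutes {..<n}" "\<forall>i<n. f i = \<tau> i" for \<tau>
  proof
    fix i show "\<tau> i = \<sigma> i"
    proof (cases "i < n")
      case False
      then show ?thesis using permutes_not_in[OF that(1), of i] permutes_not_in[OF \<sigma>(1), of i] by simp
    qed (use that(2) \<sigma>(2) in metis)
  qed
  have "signed_diagonal A n f = (\<Sum>\<tau> | \<tau> permutes {..<n}. if \<tau> = \<sigma> then of_int (sign \<sigma>) * (\<Prod>i<n. A $$ (i, \<sigma> i)) else 0)"
    unfolding signed_diagonal_def
  proof (intro sum.cong refl)
    fix \<tau> assume "\<tau> \<in> {\<tau>. \<tau> permutes {..<n}}"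
    then have "(\<forall>i<n. f i = \<tau> i) \<longleftrightarrow> \<tau> = \<sigma>" using uniq \<sigma> by blast
    then show "(if \<forall>i<n. f i = \<tau> i then of_int (sign \<tau>) * (\<Prod>i<n. A $$ (i, \<tau> i)) else 0) =
      (if \<tau> = \<sigma> then of_int (sign \<sigma>) * (\<Prod>i<n. A $$ (i, \<sigma> i)) else 0)" by simp
  qed
  also have "\<dots> = of_int (sign \<sigma>) * (\<Prod>i<n. A $$ (i, \<sigma> i))"
    using \<sigma>(1) by (simp add: finite_permutations)
  finally have eq: "signed_diagonal A n f = \<dots>" .
  have entry01: "A $$ (i, \<sigma> i) \<in> {0, 1}" if "i < n" for i
    using A that permutes_in_image[OF \<sigma>(1), of i] unfolding zero_one_mat_def by simp
  have "(\<Prod>i<m. A $$ (i, \<sigma> i)) \<in> {0, 1}" if "m \<le> n" for m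
    using that
  proof (induction m)
    case (Suc m)
    then show ?case using entry01[of m] by auto
  qed simp
  then have "(\<Prod>i<n. A $$ (i, \<sigma> i)) \<in> {0, 1}" by blast
  moreover have "cmod (of_int (sign \<sigma>)) = 1" by (simp add: sign_def)
  ultimately show ?thesis unfolding eq by (auto simp: norm_mult)
next
  case False
  then have "signed_diagonal A n f = 0"
    unfolding signed_diagonal_def by (intro sum.neutral) auto
  then show ?thesis by simp
qed

section \<open>Energies of words\<close>

definition merge_on :: "nat set \<Rightarrow> nat \<Rightarrow> (nat \<Rightarrow> 'x) \<Rightarrow> (nat \<Rightarrow> 'x) \<Rightarrow> nat \<Rightarrow> 'x" where
  "merge_on S n w w' = (\<lambda>i\<in>{..<n}. if i \<in> S then w' i else w i)"

definition word_energy :: "(nat \<Rightarrow> nat) set \<Rightarrow> nat \<Rightarrow> nat \<Rightarrow> real" where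
  "word_energy R n d = (\<Sum>w\<in>words n d. (order_weight R n w)\<^sup>2)"

text \<open>The word part of the Wick sum: two words, and the two words that arise by exchanging
  their rows in \<open>S\<close>.\<close>

definition switched_energy :: "(nat \<Rightarrow> nat) set \<Rightarrow> nat \<Rightarrow> nat \<Rightarrow> real" where
  "switched_energy R n d = (\<Sum>S\<in>Pow {..<n}. \<Sum>w\<in>words n d. \<Sum>w'\<in>words n d.
     order_weight R n w * order_weight R n w' *
     (order_weight R n (merge_on S n w w') * order_weight R n (merge_on S n w' w)))"

lemma order_weight_nonneg: "order_weight R n w \<ge> 0"
  unfolding order_weight_def by (intro divide_nonneg_nonneg sum_nonneg) auto

lemma sum_det_coeff_square:
  "(\<Sum>t\<in>PiE {..<n} (\<lambda>_. {..<n} \<times> ({..<d} \<times> {..<d})). (cmod (det_coeff A R n t))\<^sup>2) =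
   (\<Sum>f\<in>PiE {..<n} (\<lambda>_. {..<n}). (cmod (signed_diagonal A n f))\<^sup>2) * word_energy R n d"
proof -
  have "(\<Sum>t\<in>PiE {..<n} (\<lambda>_. {..<n} \<times> ({..<d} \<times> {..<d})). (cmod (det_coeff A R n t))\<^sup>2) =
    (\<Sum>f\<in>PiE {..<n} (\<lambda>_. {..<n}). \<Sum>w\<in>words n d. (cmod (signed_diagonal A n f))\<^sup>2 * (order_weight R n w)\<^sup>2)"
    unfolding sum_PiE_Times[where X = "{..<n}"]
  proof (intro sum.cong refl)
    fix f w assume f: "f \<in> PiE {..<n} (\<lambda>_. {..<n})" and w: "w \<in> words n d"
    have "(\<lambda>i\<in>{..<n}. fst ((\<lambda>i\<in>{..<n}. (f i, w i)) i)) = f" "(\<lambda>i\<in>{..<n}. snd ((\<lambda>i\<in>{..<n}. (f i, w i)) i)) = w"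
      using f w by (auto simp: fun_eq_iff restrict_def PiE_iff extensional_def)
    then show "(cmod (det_coeff A R n (\<lambda>i\<in>{..<n}. (f i, w i))))\<^sup>2 = (cmod (signed_diagonal A n f))\<^sup>2 * (order_weight R n w)\<^sup>2"
      unfolding det_coeff_def by (simp add: norm_mult power_mult_distrib)
  qed
  then show ?thesis unfolding word_energy_def sum_product .
qed

text \<open>The column factors of the exchanged pair are at most 1 and are dropped. For each
  \<open>S\<close> the rest is a product of a sum over columns and a sum over words.\<close>

lemma sum_det_coeff_switched:
  assumes A: "zero_one_mat n A"
  shows "(\<Sum>S\<in>Pow {..<n}. \<Sum>z\<in>PiE {..<n} (\<lambda>_. ({..<n} \<times> ({..<d} \<times> {..<d})) \<times> ({..<n} \<times> ({..<d} \<times> {..<d}))).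
       cmod (det_coeff A R n (\<lambda>i\<in>{..<n}. fst (z i)) * det_coeff A R n (\<lambda>i\<in>{..<n}. snd (z i))) *
       cmod (det_coeff A R n (\<lambda>i\<in>{..<n}. fst (swap_on S n z i)) * det_coeff A R n (\<lambda>i\<in>{..<n}. snd (swap_on S n z i))))
    \<le> (\<Sum>f\<in>PiE {..<n} (\<lambda>_. {..<n}). cmod (signed_diagonal A n f))\<^sup>2 * switched_energy R n d"
proof -
  let ?X = "{..<n} \<times> ({..<d} \<times> {..<d})"
  let ?F = "PiE {..<n} (\<lambda>_. {..<n})"
  let ?g = "\<lambda>f. cmod (signed_diagonal A n f)"
  let ?h = "order_weight R n"
  have g1: "?g f \<le> 1" for f using signed_diagonal_norm[OF A, of f] by auto
  have det: "cmod (det_coeff A R n t) = ?g (\<lambda>i\<in>{..<n}. fst (t i)) * ?h (\<lambda>i\<in>{..<n}. snd (t i))" for t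
    by (simp add: det_coeff_def norm_mult order_weight_nonneg)
  have row: "(\<Sum>z\<in>PiE {..<n} (\<lambda>_. ?X \<times> ?X).
       cmod (det_coeff A R n (\<lambda>i\<in>{..<n}. fst (z i)) * det_coeff A R n (\<lambda>i\<in>{..<n}. snd (z i))) *
       cmod (det_coeff A R n (\<lambda>i\<in>{..<n}. fst (swap_on S n z i)) * det_coeff A R n (\<lambda>i\<in>{..<n}. snd (swap_on S n z i))))
    \<le> (\<Sum>f\<in>?F. ?g f)\<^sup>2 * (\<Sum>w\<in>words n d. \<Sum>w'\<in>words n d. ?h w * ?h w' * (?h (merge_on S n w w') * ?h (merge_on S n w' w)))" for S
  proof -
    have "(\<Sum>z\<in>PiE {..<n} (\<lambda>_. ?X \<times> ?X).
       cmod (det_coeff A R n (\<lambda>i\<in>{..<n}. fst (z i)) * det_coeff A R n (\<lambda>i\<in>{..<n}. snd (z i))) *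
       cmod (det_coeff A R n (\<lambda>i\<in>{..<n}. fst (swap_on S n z i)) * det_coeff A R n (\<lambda>i\<in>{..<n}. snd (swap_on S n z i))))
      = (\<Sum>f\<in>?F. \<Sum>w\<in>words n d. \<Sum>f'\<in>?F. \<Sum>w'\<in>words n d.
         (?g f * ?h w) * (?g f' * ?h w') *
         ((?g (merge_on S n f f') * ?h (merge_on S n w w')) * (?g (merge_on S n f' f) * ?h (merge_on S n w' w))))"
      unfolding sum_PiE_Times[where X = ?X] sum_PiE_Times[where X = "{..<n}"]
    proof (intro sum.cong refl)
      fix f w f' w' assume m: "f \<in> ?F" "w \<in> words n d" "f' \<in> ?F" "w' \<in> words n d"
      define z where "z = (\<lambda>i\<in>{..<n}. ((\<lambda>i\<in>{..<n}. (f i, w i)) i, (\<lambda>i\<in>{..<n}. (f' i, w' i)) i))"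
      have zi: "z i = ((f i, w i), (f' i, w' i))" if "i < n" for i using that by (simp add: z_def)
      have 1: "(\<lambda>i\<in>{..<n}. fst ((\<lambda>i\<in>{..<n}. fst (z i)) i)) = f" "(\<lambda>i\<in>{..<n}. snd ((\<lambda>i\<in>{..<n}. fst (z i)) i)) = w"
        "(\<lambda>i\<in>{..<n}. fst ((\<lambda>i\<in>{..<n}. snd (z i)) i)) = f'" "(\<lambda>i\<in>{..<n}. snd ((\<lambda>i\<in>{..<n}. snd (z i)) i)) = w'"
        using m zi by (auto simp: fun_eq_iff restrict_def PiE_iff extensional_def)
      have 2: "(\<lambda>i\<in>{..<n}. fst ((\<lambda>i\<in>{..<n}. fst (swap_on S n z i)) i)) = merge_on S n f f'"
        "(\<lambda>i\<in>{..<n}. snd ((\<lambda>i\<in>{..<n}. fst (swap_on S n z i)) i)) = merge_on S n w w'"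
        "(\<lambda>i\<in>{..<n}. fst ((\<lambda>i\<in>{..<n}. snd (swap_on S n z i)) i)) = merge_on S n f' f"
        "(\<lambda>i\<in>{..<n}. snd ((\<lambda>i\<in>{..<n}. snd (swap_on S n z i)) i)) = merge_on S n w' w"
        using zi by (auto simp: fun_eq_iff restrict_def merge_on_def swap_on_def)
      show "cmod (det_coeff A R n (\<lambda>i\<in>{..<n}. fst (z i)) * det_coeff A R n (\<lambda>i\<in>{..<n}. snd (z i))) *
         cmod (det_coeff A R n (\<lambda>i\<in>{..<n}. fst (swap_on S n z i)) * det_coeff A R n (\<lambda>i\<in>{..<n}. snd (swap_on S n z i))) =
         (?g f * ?h w) * (?g f' * ?h w') *
         ((?g (merge_on S n f f') * ?h (merge_on S n w w')) * (?g (merge_on S n f' f) * ?h (merge_on S n w' w)))"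
        unfolding norm_mult det 1 2 ..
    qed
    also have "\<dots> \<le> (\<Sum>f\<in>?F. \<Sum>w\<in>words n d. \<Sum>f'\<in>?F. \<Sum>w'\<in>words n d.
         ?g f * (?g f' * (?h w * ?h w' * (?h (merge_on S n w w') * ?h (merge_on S n w' w)))))"
    proof (intro sum_mono)
      fix f w f' w'
      let ?m = "?g (merge_on S n f f')" and ?m' = "?g (merge_on S n f' f)"
      let ?B = "?g f * (?g f' * (?h w * ?h w' * (?h (merge_on S n w w') * ?h (merge_on S n w' w))))"
      have "?B * (?m * ?m') \<le> ?B * 1"
        using g1 by (intro mult_left_mono mult_le_one mult_nonneg_nonneg order_weight_nonneg) auto
      then show "(?g f * ?h w) * (?g f' * ?h w') *
         ((?g (merge_on S n f f') * ?h (merge_on S n w w')) * (?g (merge_on S n f' f) * ?h (merge_on S n w' w))) \<le> ?B"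
        by (simp only: mult_ac mult_1_right mult_1_left)
    qed
    also have "\<dots> = (\<Sum>f\<in>?F. \<Sum>f'\<in>?F. \<Sum>w\<in>words n d. \<Sum>w'\<in>words n d.
         ?g f * (?g f' * (?h w * ?h w' * (?h (merge_on S n w w') * ?h (merge_on S n w' w)))))"
      by (intro sum.cong refl sum.swap)
    also have "\<dots> = (\<Sum>f\<in>?F. ?g f)\<^sup>2 * (\<Sum>w\<in>words n d. \<Sum>w'\<in>words n d. ?h w * ?h w' * (?h (merge_on S n w w') * ?h (merge_on S n w' w)))"
      by (simp only: sum_distrib_left[symmetric] sum_distrib_right[symmetric] power2_eq_square mult.assoc)
    finally show ?thesis .
  qed
  show ?thesis unfolding switched_energy_def sum_distrib_left by (intro sum_mono order_trans[OF row]) (simp add: sum_distrib_left)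
qed

lemma space_haar_or_gaussian: "haar_or_gaussian d \<mu> \<Longrightarrow> space \<mu> = carrier_mat d d"
  unfolding haar_or_gaussian_def by (auto simp: haar_space gaussian_measure_def)

text \<open>The powers of \<open>1 / d\<close> and the permanent \<open>N\<close> cancel between the
  two moments; \<open>nz\<close> makes \<open>N\<close> and the word energy nonzero. The lower bound
  1 is nonnegativity of the variance of \<open>X\<close>.\<close>

lemma critical_ratio_bounds:
  assumes A: "zero_one_mat n A" and \<mu>: "haar_or_gaussian d \<mu>" and d: "d \<ge> 1" and n: "n \<ge> 1"
    and R: "\<And>\<pi>. \<pi> \<in> R \<Longrightarrow> \<pi> permutes {..<n}"
    and X: "\<And>\<rho>. (\<And>ij. ij \<in> {..<n} \<times> {..<n} \<Longrightarrow> \<rho> ij \<in> carrier_mat d d) \<Longrightarrow> X \<rho> = (cmod (ordered_det_trace A R d n \<rho>))\<^sup>2"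
    and nz: "(\<integral>\<rho>. X \<rho> \<partial>iid_family n \<mu>) \<noteq> 0"
  shows "1 \<le> critical_ratio (iid_family n \<mu>) X"
    and "critical_ratio (iid_family n \<mu>) X \<le> haar_factor d ^ n * (switched_energy R n d / (word_energy R n d)\<^sup>2)"
    and "word_energy R n d > 0"
proof -
  note blk = circular_block_haar_or_gaussian[OF \<mu> d]
  note K = haar_factor_ge_1[OF d]
  interpret M: prob_space \<mu> by (rule circular_blockD(1)[OF blk])
  interpret prob_space "iid_family n \<mu>"
    unfolding iid_family_def by (intro prob_space_PiM) (rule M.prob_space_axioms)
  define c where "c = det_coeff A R n"
  define q where "q = multilinear ({..<d} \<times> {..<d}) (\<lambda>ab M. M $$ ab) {..<n} n c"
  define N where "N = (\<Sum>f\<in>PiE {..<n} (\<lambda>_. {..<n}). cmod (signed_diagonal A n f))"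
  let ?H = "word_energy R n d" and ?\<Phi> = "switched_energy R n d"
  have Xq: "X \<rho> = (cmod (q \<rho>))\<^sup>2" if "\<rho> \<in> space (iid_family n \<mu>)" for \<rho>
  proof -
    have \<rho>: "\<rho> ij \<in> carrier_mat d d" if "ij \<in> {..<n} \<times> {..<n}" for ij
      using \<open>\<rho> \<in> space (iid_family n \<mu>)\<close> that unfolding iid_family_def space_PiM space_haar_or_gaussian[OF \<mu>]
      by (rule PiE_mem)
    have "ordered_det_trace A R d n \<rho> = q \<rho>"
      unfolding q_def c_def by (rule ordered_det_trace_eq_multilinear[OF n]) (fact R \<rho>)+
    then show ?thesis by (simp only: X[OF \<rho>])
  qed
  have N2: "(\<Sum>f\<in>PiE {..<n} (\<lambda>_. {..<n}). (cmod (signed_diagonal A n f))\<^sup>2) = N"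
    unfolding N_def
  proof (intro sum.cong refl)
    fix f show "(cmod (signed_diagonal A n f))\<^sup>2 = cmod (signed_diagonal A n f)"
      using signed_diagonal_norm[OF A, of f] by auto
  qed
  have EX: "(\<integral>\<rho>. X \<rho> \<partial>iid_family n \<mu>) = (1 / real d) ^ n * (N * ?H)"
  proof -
    have "(\<integral>\<rho>. X \<rho> \<partial>iid_family n \<mu>) = (\<integral>\<rho>. (cmod (q \<rho>))\<^sup>2 \<partial>iid_family n \<mu>)"
      by (intro Bochner_Integration.integral_cong refl Xq)
    also have "\<dots> = (1 / real d) ^ n * (\<Sum>t\<in>PiE {..<n} (\<lambda>_. {..<n} \<times> ({..<d} \<times> {..<d})). (cmod (c t))\<^sup>2)"
      unfolding q_def iid_family_def by (rule second_moment_multilinear[OF blk _ K]) simp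
    finally show ?thesis unfolding c_def sum_det_coeff_square N2 .
  qed
  have EX2: "(\<integral>\<rho>. (X \<rho>)\<^sup>2 \<partial>iid_family n \<mu>) = (\<integral>\<rho>. cmod (q \<rho>) ^ 4 \<partial>iid_family n \<mu>)"
    by (intro Bochner_Integration.integral_cong refl) (simp add: Xq flip: power_mult)
  have "(\<integral>\<rho>. cmod (q \<rho>) ^ 4 \<partial>iid_family n \<mu>) \<le> (haar_factor d * (1 / real d)\<^sup>2) ^ n *
    (\<Sum>S\<in>Pow {..<n}. \<Sum>z\<in>PiE {..<n} (\<lambda>_. ({..<n} \<times> ({..<d} \<times> {..<d})) \<times> ({..<n} \<times> ({..<d} \<times> {..<d}))).
       cmod (c (\<lambda>i\<in>{..<n}. fst (z i)) * c (\<lambda>i\<in>{..<n}. snd (z i))) *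
       cmod (c (\<lambda>i\<in>{..<n}. fst (swap_on S n z i)) * c (\<lambda>i\<in>{..<n}. snd (swap_on S n z i))))"
    unfolding q_def iid_family_def by (rule fourth_moment_multilinear(2)[OF blk _ K]) simp
  also have "\<dots> \<le> (haar_factor d * (1 / real d)\<^sup>2) ^ n * (N\<^sup>2 * ?\<Phi>)"
    unfolding c_def N_def using K by (intro mult_left_mono sum_det_coeff_switched[OF A] zero_le_power) auto
  finally have EX2_le: "(\<integral>\<rho>. (X \<rho>)\<^sup>2 \<partial>iid_family n \<mu>) \<le> (haar_factor d * (1 / real d)\<^sup>2) ^ n * (N\<^sup>2 * ?\<Phi>)"
    unfolding EX2 .
  have "N * ?H \<noteq> 0" using nz EX by auto
  then have N0: "N \<noteq> 0" and H0: "?H \<noteq> 0" by auto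
  have "?H \<ge> 0" unfolding word_energy_def by (intro sum_nonneg) auto
  then show "?H > 0" using H0 by simp
  show "critical_ratio (iid_family n \<mu>) X \<le> haar_factor d ^ n * (?\<Phi> / ?H\<^sup>2)"
  proof -
    have "critical_ratio (iid_family n \<mu>) X \<le> (haar_factor d * (1 / real d)\<^sup>2) ^ n * (N\<^sup>2 * ?\<Phi>) / ((1 / real d) ^ n * (N * ?H))\<^sup>2"
      unfolding critical_ratio_def EX by (intro divide_right_mono EX2_le) simp
    also have "\<dots> = haar_factor d ^ n * (?\<Phi> / ?H\<^sup>2)"
    proof -
      have cancel: "k * U\<^sup>2 * (N\<^sup>2 * p) / (U * (N * h))\<^sup>2 = k * (p / h\<^sup>2)" if "U \<noteq> 0" "h \<noteq> 0" for k U p h :: real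
        using that N0 by (simp add: power_mult_distrib)
      have "(haar_factor d * (1 / real d)\<^sup>2) ^ n = haar_factor d ^ n * ((1 / real d) ^ n)\<^sup>2"
        unfolding power_mult_distrib power_mult[symmetric] mult.commute[of n 2] ..
      then show ?thesis using cancel[of "(1 / real d) ^ n" ?H "haar_factor d ^ n" ?\<Phi>] H0 d by simp
    qed
    finally show ?thesis .
  qed
  have int4: "integrable (iid_family n \<mu>) (\<lambda>\<rho>. cmod (q \<rho>) ^ 4)"
    unfolding q_def iid_family_def by (rule fourth_moment_multilinear(1)[OF blk _ K]) simp
  have "integrable (iid_family n \<mu>) (\<lambda>\<rho>. (X \<rho>)\<^sup>2)"
    using int4 by (rule Bochner_Integration.integrable_cong[THEN iffD1, rotated 2]) (simp_all add: Xq flip: power_mult)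
  \<comment> \<open>A nonzero Bochner integral already implies integrability.\<close>
  moreover have "integrable (iid_family n \<mu>) X"
    using nz not_integrable_integral_eq by blast
  ultimately have "(\<integral>\<rho>. X \<rho> \<partial>iid_family n \<mu>)\<^sup>2 \<le> (\<integral>\<rho>. (X \<rho>)\<^sup>2 \<partial>iid_family n \<mu>)"
    using variance_positive[of X] variance_eq[of X] by simp
  then show "1 \<le> critical_ratio (iid_family n \<mu>) X"
    unfolding critical_ratio_def using nz by (simp add: le_divide_eq)
qed

section \<open>Counting switched words\<close>

lemma merge_on_in_PiE:
  assumes "w \<in> PiE {..<n} (\<lambda>_. X)" "w' \<in> PiE {..<n} (\<lambda>_. X)"
  shows "merge_on S n w w' \<in> PiE {..<n} (\<lambda>_. X)"
  using assms by (auto simp: merge_on_def PiE_iff)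

lemma merge_on_merge_on:
  assumes "w \<in> PiE {..<n} (\<lambda>_. X)" "w' \<in> PiE {..<n} (\<lambda>_. X)"
  shows "merge_on S n (merge_on S n w w') (merge_on S n w' w) = w"
  using assms by (auto simp: merge_on_def fun_eq_iff restrict_def PiE_iff extensional_def)

text \<open>Exchanging the rows in \<open>S\<close> is an involution on pairs of words and preserves
  the sum of squared weights. By x y \<le> (x^2 + y^2) / 2, each of the \<open>2 ^ n\<close> sets
  contributes at most the squared energy.\<close>

lemma switched_energy_le_power:
  "switched_energy R n d \<le> 2 ^ n * (word_energy R n d)\<^sup>2"
proof -
  let ?h = "order_weight R n" and ?W = "words n d"
  have row: "(\<Sum>w\<in>?W. \<Sum>w'\<in>?W. ?h w * ?h w' * (?h (merge_on S n w w') * ?h (merge_on S n w' w))) \<le> (word_energy R n d)\<^sup>2" for S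
  proof -
    have sq: "(\<Sum>p\<in>?W \<times> ?W. (?h (fst p))\<^sup>2 * (?h (snd p))\<^sup>2) = (word_energy R n d)\<^sup>2"
      unfolding word_energy_def power2_eq_square[of "sum _ _"] sum_product sum.cartesian_product' by simp
    have sq': "(\<Sum>p\<in>?W \<times> ?W. (?h (merge_on S n (fst p) (snd p)))\<^sup>2 * (?h (merge_on S n (snd p) (fst p)))\<^sup>2) =
        (\<Sum>p\<in>?W \<times> ?W. (?h (fst p))\<^sup>2 * (?h (snd p))\<^sup>2)"
    proof -
      define \<phi> where "\<phi> p = (merge_on S n (fst p) (snd p), merge_on S n (snd p) (fst p))" for p :: "(nat \<Rightarrow> nat \<times> nat) \<times> (nat \<Rightarrow> nat \<times> nat)"
      have \<phi>: "\<phi> p \<in> ?W \<times> ?W" "\<phi> (\<phi> p) = p" if "p \<in> ?W \<times> ?W" for p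
      proof -
        have p: "fst p \<in> ?W" "snd p \<in> ?W" using that by (simp_all add: mem_Times_iff)
        show "\<phi> p \<in> ?W \<times> ?W" unfolding \<phi>_def using p by (intro SigmaI merge_on_in_PiE)
        show "\<phi> (\<phi> p) = p"
          unfolding \<phi>_def fst_conv snd_conv merge_on_merge_on[OF p] merge_on_merge_on[OF p(2,1)] by (rule prod.collapse)
      qed
      have "bij_betw \<phi> (?W \<times> ?W) (?W \<times> ?W)"
        by (rule bij_betw_byWitness[where f' = \<phi>]) (intro ballI image_subsetI \<phi>, assumption)+
      from sum.reindex_bij_betw[OF this, of "\<lambda>p. (?h (fst p))\<^sup>2 * (?h (snd p))\<^sup>2"] show ?thesis
        by (simp only: \<phi>_def fst_conv snd_conv)
    qed
    have "(\<Sum>w\<in>?W. \<Sum>w'\<in>?W. ?h w * ?h w' * (?h (merge_on S n w w') * ?h (merge_on S n w' w))) =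
      (\<Sum>p\<in>?W \<times> ?W. (?h (fst p) * ?h (snd p)) * (?h (merge_on S n (fst p) (snd p)) * ?h (merge_on S n (snd p) (fst p))))"
      unfolding sum.cartesian_product' by simp
    also have "\<dots> \<le> (\<Sum>p\<in>?W \<times> ?W. ((?h (fst p))\<^sup>2 * (?h (snd p))\<^sup>2 +
        (?h (merge_on S n (fst p) (snd p)))\<^sup>2 * (?h (merge_on S n (snd p) (fst p)))\<^sup>2) / 2)"
    proof (intro sum_mono)
      fix p
      have "x * y \<le> (x\<^sup>2 + y\<^sup>2) / 2" for x y :: real
        using sum_squares_bound[of x y] by simp
      from this[of "?h (fst p) * ?h (snd p)" "?h (merge_on S n (fst p) (snd p)) * ?h (merge_on S n (snd p) (fst p))"]
      show "(?h (fst p) * ?h (snd p)) * (?h (merge_on S n (fst p) (snd p)) * ?h (merge_on S n (snd p) (fst p))) \<le>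
        ((?h (fst p))\<^sup>2 * (?h (snd p))\<^sup>2 + (?h (merge_on S n (fst p) (snd p)))\<^sup>2 * (?h (merge_on S n (snd p) (fst p)))\<^sup>2) / 2"
        by (simp only: power_mult_distrib)
    qed
    also have "\<dots> = (word_energy R n d)\<^sup>2"
      unfolding sum_divide_distrib[symmetric] sum.distrib sq' sq by simp
    finally show ?thesis .
  qed
  have "switched_energy R n d \<le> (\<Sum>S\<in>Pow {..<n}. (word_energy R n d)\<^sup>2)"
    unfolding switched_energy_def by (intro sum_mono row)
  then show ?thesis by (simp add: card_Pow)
qed

lemma sum_Pow_lessThan_Suc:
  fixes F :: "nat set \<Rightarrow> 'b :: comm_monoid_add"
  shows "(\<Sum>S\<in>Pow {..<Suc k}. F S) = (\<Sum>S\<in>Pow {..<k}. F S + F (insert k S))"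
proof -
  have "(\<Sum>S\<in>Pow {..<Suc k}. F S) = (\<Sum>S\<in>Pow {..<k}. F S) + (\<Sum>S\<in>insert k ` Pow {..<k}. F S)"
    unfolding lessThan_Suc Pow_insert by (intro sum.union_disjoint) auto
  also have "(\<Sum>S\<in>insert k ` Pow {..<k}. F S) = (\<Sum>S\<in>Pow {..<k}. F (insert k S))"
    by (subst sum.reindex) (auto simp: inj_on_def dest!: insert_ident[THEN iffD1, rotated 2])
  finally show ?thesis by (simp add: sum.distrib)
qed

section \<open>Words in the natural order\<close>

lemma order_weight_id: "order_weight {id} n w = (if chained n id w then 1 else 0)"
  by (simp add: order_weight_def)

lemma word_energy_id: "word_energy {id} n d = real d ^ n"
proof -
  have "word_energy {id} n d = (\<Sum>w\<in>words n d. if chained n id w then 1 else 0)"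
    unfolding word_energy_def order_weight_id by (intro sum.cong refl) simp
  also have "\<dots> = real (card {w \<in> words n d. chained n id w})"
    by (subst sum.inter_filter[symmetric]) auto
  finally show ?thesis by (simp add: card_chained permutes_id del: id_apply)
qed

text \<open>The set is built row by row: row 0 gives \<open>y\<close> for either choice, and each
  later row gives \<open>y\<close> or \<open>x\<close> as it keeps or changes the side of its
  predecessor. The guard \<open>i > 0\<close> excludes the truncated difference at row 0.\<close>

lemma sum_switch_changes:
  "(\<Sum>S\<in>Pow {..<Suc m}. \<Prod>i<Suc m. if i > 0 \<and> ((i - 1 \<in> S) \<noteq> (i \<in> S)) then x else y) = 2 * y * (y + x :: real) ^ m"
proof (induction m)
  case 0
  show ?case unfolding sum_Pow_lessThan_Suc by simp
next
  case (Suc m)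
  let ?P = "\<lambda>k S. \<Prod>i<k. if i > 0 \<and> ((i - 1 \<in> S) \<noteq> (i \<in> S)) then x else y"
  have "(\<Sum>S\<in>Pow {..<Suc (Suc m)}. ?P (Suc (Suc m)) S) =
    (\<Sum>S\<in>Pow {..<Suc m}. ?P (Suc (Suc m)) S + ?P (Suc (Suc m)) (insert (Suc m) S))"
    by (rule sum_Pow_lessThan_Suc)
  also have "\<dots> = (\<Sum>S\<in>Pow {..<Suc m}. ?P (Suc m) S * (y + x))"
  proof (intro sum.cong refl)
    fix S assume "S \<in> Pow {..<Suc m}"
    then have S: "Suc m \<notin> S" by auto
    have "?P (Suc m) (insert (Suc m) S) = ?P (Suc m) S"
      by (intro prod.cong refl) auto
    then show "?P (Suc (Suc m)) S + ?P (Suc (Suc m)) (insert (Suc m) S) = ?P (Suc m) S * (y + x)"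
      unfolding prod.lessThan_Suc[of _ "Suc m"] using S by (simp add: algebra_simps)
  qed
  also have "\<dots> = 2 * y * (y + x) ^ Suc m"
    unfolding sum_distrib_right[symmetric] Suc by (simp add: mult_ac)
  finally show ?case .
qed

text \<open>Whenever consecutive rows lie on different sides of the switch, the two words must agree at the
  junction; this costs a factor \<open>1 / d\<close>.\<close>

lemma switched_energy_id:
  assumes n: "n \<ge> 1" and d: "d \<ge> 1"
  shows "switched_energy {id} n d \<le> 2 * (real d)\<^sup>2 ^ n * (1 + 1 / real d) ^ n"
proof -
  let ?W = "words n d" and ?h = "order_weight {id} n"
  have row: "(\<Sum>w\<in>?W. \<Sum>w'\<in>?W. ?h w * ?h w' * (?h (merge_on S n w w') * ?h (merge_on S n w' w)))
    \<le> (\<Prod>i<n. if i > 0 \<and> ((i - 1 \<in> S) \<noteq> (i \<in> S)) then real d else (real d)\<^sup>2)" for S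
  proof -
    \<comment> \<open>For an upper bound the condition on the second switched word is
      relaxed.\<close>
    let ?C = "{p \<in> ?W \<times> ?W. chained n id (fst p) \<and> chained n id (snd p) \<and> chained n id (merge_on S n (fst p) (snd p))}"
    \<comment> \<open>The range of the two first indices in row \<open>i\<close>. At a change of
      side the switched word leads from one word into the other, while both words are themselves
      chained; this forces the two indices to coincide.\<close>
    define E where "E i = (if i > 0 \<and> ((i - 1 \<in> S) \<noteq> (i \<in> S)) then (\<lambda>x. (x, x)) ` {..<d} else {..<d} \<times> {..<d})" for i
    \<comment> \<open>First indices determine the words, since chaining makes each second index the
      first index of the next row.\<close>
    define q where "q p = (\<lambda>i\<in>{..<n}. (fst (fst p i), fst (snd p i)))" for p :: "(nat \<Rightarrow> nat \<times> nat) \<times> (nat \<Rightarrow> nat \<times> nat)"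
    have step: "snd (w i) = fst (w (Suc i mod n))" if "chained n id w" "i < n" for w i
      using that by (simp add: chained_def)
    have finE: "finite (E i)" for i by (simp add: E_def)
    have q_in: "q p \<in> PiE {..<n} E" if p: "p \<in> ?C" for p
      unfolding q_def
    proof (intro restrict_PiE_iff[THEN iffD2] ballI)
      fix i assume "i \<in> {..<n}"
      then have i: "i < n" by simp
      have w: "fst p i \<in> {..<d} \<times> {..<d}" "snd p i \<in> {..<d} \<times> {..<d}"
      proof -
        have "fst p \<in> ?W" "snd p \<in> ?W" using p by (simp_all add: mem_Times_iff)
        then show "fst p i \<in> {..<d} \<times> {..<d}" "snd p i \<in> {..<d} \<times> {..<d}"
          using i by (auto dest: PiE_mem)
      qed
      show "(fst (fst p i), fst (snd p i)) \<in> E i"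
      proof (cases "i > 0 \<and> ((i - 1 \<in> S) \<noteq> (i \<in> S))")
        case True
        then obtain j where j: "i = Suc j" by (cases i) auto
        have jn: "j < n" "Suc j mod n = i" using i j by auto
        have p3: "chained n id (fst p)" "chained n id (snd p)" "chained n id (merge_on S n (fst p) (snd p))"
          using p by simp_all
        have "snd (fst p j) = fst (fst p i)" "snd (snd p j) = fst (snd p i)"
          "snd (merge_on S n (fst p) (snd p) j) = fst (merge_on S n (fst p) (snd p) i)"
          using p3[THEN step, OF jn(1)] unfolding jn(2) .
        then have eq: "fst (fst p i) = fst (snd p i)"
          using True i jn(1) unfolding merge_on_def j by (cases "j \<in> S"; cases "Suc j \<in> S") simp_all
        have "E i = (\<lambda>x. (x, x)) ` {..<d}" unfolding E_def by (rule if_P[OF True])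
        then show ?thesis using w(2) unfolding eq by (simp add: mem_Times_iff)
      next
        case False
        then have "E i = {..<d} \<times> {..<d}" unfolding E_def by (rule if_not_P)
        then show ?thesis using w by (simp add: mem_Times_iff)
      qed
    qed
    have inj: "inj_on q ?C"
    proof (rule inj_onI)
      fix p p' assume p: "p \<in> ?C" and p': "p' \<in> ?C" and eq: "q p = q p'"
      have f: "fst (fst p i) = fst (fst p' i)" "fst (snd p i) = fst (snd p' i)" if "i < n" for i
        using fun_cong[OF eq, of i] that by (simp_all add: q_def)
      have s: "snd (fst p i) = snd (fst p' i)" "snd (snd p i) = snd (snd p' i)" if i: "i < n" for i
      proof -
        have "Suc i mod n < n" using i by simp
        note f = f[OF this]
        have "chained n id (fst p)" "chained n id (snd p)" "chained n id (fst p')" "chained n id (snd p')"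
          using p p' by simp_all
        note this[THEN step, OF i]
        then show "snd (fst p i) = snd (fst p' i)" "snd (snd p i) = snd (snd p' i)"
          using f by (simp_all only:)
      qed
      have W: "fst p \<in> ?W" "snd p \<in> ?W" "fst p' \<in> ?W" "snd p' \<in> ?W"
        using p p' by (simp_all add: mem_Times_iff)
      have "fst p = fst p'" by (rule PiE_ext[OF W(1,3)]) (simp add: prod_eq_iff f s)
      moreover have "snd p = snd p'" by (rule PiE_ext[OF W(2,4)]) (simp add: prod_eq_iff f s)
      ultimately show "p = p'" by (rule prod_eqI)
    qed
    have "(\<Sum>w\<in>?W. \<Sum>w'\<in>?W. ?h w * ?h w' * (?h (merge_on S n w w') * ?h (merge_on S n w' w))) =
      (\<Sum>p\<in>?W \<times> ?W. ?h (fst p) * ?h (snd p) * (?h (merge_on S n (fst p) (snd p)) * ?h (merge_on S n (snd p) (fst p))))"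
      unfolding sum.cartesian_product' by simp
    also have "\<dots> \<le> (\<Sum>p\<in>?W \<times> ?W. if chained n id (fst p) \<and> chained n id (snd p) \<and> chained n id (merge_on S n (fst p) (snd p)) then 1 else 0)"
      unfolding order_weight_id by (intro sum_mono) simp
    also have "\<dots> = real (card ?C)" by (subst sum.inter_filter[symmetric]) auto
    also have "\<dots> \<le> real (card (PiE {..<n} E))"
      using card_inj_on_le[OF inj, of "PiE {..<n} E"] q_in finE by (simp add: finite_PiE image_subset_iff)
    also have "\<dots> = (\<Prod>i<n. real (card (E i)))" by (simp add: card_PiE)
    also have "\<dots> = (\<Prod>i<n. if i > 0 \<and> ((i - 1 \<in> S) \<noteq> (i \<in> S)) then real d else (real d)\<^sup>2)"
    proof (intro prod.cong refl)
      fix i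
      have "card ((\<lambda>x. (x, x)) ` {..<d}) = d" by (subst card_image) (auto simp: inj_on_def)
      then show "real (card (E i)) = (if i > 0 \<and> ((i - 1 \<in> S) \<noteq> (i \<in> S)) then real d else (real d)\<^sup>2)"
        unfolding E_def by (simp add: power2_eq_square)
    qed
    finally show ?thesis .
  qed
  obtain m where m: "n = Suc m" using n by (cases n) auto
  have "switched_energy {id} n d \<le> (\<Sum>S\<in>Pow {..<n}. \<Prod>i<n. if i > 0 \<and> ((i - 1 \<in> S) \<noteq> (i \<in> S)) then real d else (real d)\<^sup>2)"
    unfolding switched_energy_def by (intro sum_mono row)
  also have "\<dots> = 2 * (real d)\<^sup>2 * ((real d)\<^sup>2 + real d) ^ m" unfolding m by (rule sum_switch_changes)
  also have "(real d)\<^sup>2 + real d = (real d)\<^sup>2 * (1 + 1 / real d)" using d by (simp add: power2_eq_square distrib_left)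
  also have "2 * (real d)\<^sup>2 * ((real d)\<^sup>2 * (1 + 1 / real d)) ^ m = 2 * (real d)\<^sup>2 ^ n * (1 + 1 / real d) ^ m"
    unfolding m by (simp add: power_mult_distrib mult_ac)
  \<comment> \<open>One spare factor raises the exponent \<open>m = n - 1\<close> to
    \<open>n\<close>.\<close>
  also have "\<dots> \<le> 2 * (real d)\<^sup>2 ^ n * (1 + 1 / real d) ^ n"
    unfolding m by (intro mult_left_mono power_increasing) auto
  finally show ?thesis .
qed

text \<open>Burnside-type count: inserting a new point \<open>a\<close> into a cycle of \<open>q\<close> (in front of \<open>b\<close>) forces its
  colour, leaving it fixed allows all \<open>d\<close> colours.\<close>

lemma sum_fixed_colourings:
  assumes "finite X"
  shows "(\<Sum>\<xi> | \<xi> permutes X. card {A \<in> PiE X (\<lambda>_. {..<d}). \<forall>x\<in>X. A (\<xi> x) = A x}) \<le> (\<Prod>i<card X. d + i)"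
  using assms
proof (induction X)
  case empty
  have "{\<xi>. \<xi> permutes ({} :: 'a set)} = {id}" by (auto simp: permutes_empty)
  then show ?case by (simp add: card_PiE)
next
  case (insert a X)
  let ?Fix = "\<lambda>X q. {A \<in> PiE X (\<lambda>_. {..<d}). \<forall>x\<in>X. A (q x) = A x}"
  have fin: "finite (?Fix X q)" for q using insert.hyps by (auto intro: finite_subset[OF _ finite_PiE[of X "\<lambda>_. {..<d}"]])
  \<comment> \<open>Deleting \<open>a\<close> from its cycle leaves \<open>q\<close>, and a
    colouring constant along the longer cycle stays constant along the shorter one.\<close>
  have restr: "restrict A X \<in> ?Fix X q"
    if q: "q permutes X" and A: "A \<in> ?Fix (insert a X) (Transposition.transpose a b \<circ> q)" and b: "b \<in> insert a X" for q A b
  proof -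
    have AP: "A x < d" if "x \<in> insert a X" for x
    proof -
      have "A \<in> PiE (insert a X) (\<lambda>_. {..<d})" using A by blast
      from PiE_mem[OF this that] show ?thesis by simp
    qed
    have fixd: "A (Transposition.transpose a b (q x)) = A x" if "x \<in> insert a X" for x
    proof -
      have "\<forall>x\<in>insert a X. A ((Transposition.transpose a b \<circ> q) x) = A x" using A by blast
      from bspec[OF this that] show ?thesis by (simp only: o_apply)
    qed
    have qa: "q a = a" using permutes_not_in[OF q insert.hyps(2)] .
    have ab: "A b = A a" using fixd[of a] qa by simp
    have "A (q x) = A x" if x: "x \<in> X" for x
    proof -
      have qx: "q x \<in> X" using permutes_in_image[OF q] x by blast
      then have "q x \<noteq> a" using insert.hyps(2) by metis
      show ?thesis
      proof (cases "q x = b")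
        case True
        then have "A a = A x" using fixd[of x] x by simp
        then show ?thesis using True ab by simp
      next
        case False
        then have "Transposition.transpose a b (q x) = q x"
          using \<open>q x \<noteq> a\<close> by (simp add: Transposition.transpose_apply_other)
        then show ?thesis using fixd[of x] x by simp
      qed
    qed
    moreover have "q x \<in> X" if "x \<in> X" for x using permutes_in_image[OF q] that by blast
    ultimately show ?thesis using AP by simp
  qed
  have new: "card (?Fix (insert a X) (Transposition.transpose a a \<circ> q)) \<le> d * card (?Fix X q)" if q: "q permutes X" for q
  proof -
    have "card (?Fix (insert a X) (Transposition.transpose a a \<circ> q)) \<le> card ({..<d} \<times> ?Fix X q)"
    proof (rule card_inj_on_le[of "\<lambda>A. (A a, restrict A X)"])
      show "inj_on (\<lambda>A. (A a, restrict A X)) (?Fix (insert a X) (Transposition.transpose a a \<circ> q))"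
      proof (rule inj_onI)
        fix A B assume A: "A \<in> ?Fix (insert a X) (Transposition.transpose a a \<circ> q)"
          and B: "B \<in> ?Fix (insert a X) (Transposition.transpose a a \<circ> q)" and eq: "(A a, restrict A X) = (B a, restrict B X)"
        have P: "A \<in> PiE (insert a X) (\<lambda>_. {..<d})" "B \<in> PiE (insert a X) (\<lambda>_. {..<d})" using A B by blast+
        have eqs: "A a = B a" "restrict A X = restrict B X" using eq by simp_all
        have "A x = B x" if "x \<in> X" for x using fun_cong[OF eqs(2), of x] that by simp
        then have "A x = B x" if "x \<in> insert a X" for x using that eqs(1) by blast
        then show "A = B" by (rule PiE_ext[OF P])
      qed
      show "(\<lambda>A. (A a, restrict A X)) ` ?Fix (insert a X) (Transposition.transpose a a \<circ> q) \<subseteq> {..<d} \<times> ?Fix X q"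
      proof (rule image_subsetI)
        fix A assume A: "A \<in> ?Fix (insert a X) (Transposition.transpose a a \<circ> q)"
        then have "A \<in> PiE (insert a X) (\<lambda>_. {..<d})" by blast
        from PiE_mem[OF this, of a] restr[OF q A] show "(A a, restrict A X) \<in> {..<d} \<times> ?Fix X q" by blast
      qed
      show "finite ({..<d} \<times> ?Fix X q)" using fin by (intro finite_cartesian_product) auto
    qed
    then show ?thesis by (simp add: card_cartesian_product)
  qed
  have old: "card (?Fix (insert a X) (Transposition.transpose a b \<circ> q)) \<le> card (?Fix X q)" if q: "q permutes X" and b: "b \<in> X" for q b
  proof (rule card_inj_on_le[of "\<lambda>A. restrict A X"])
    show "inj_on (\<lambda>A. restrict A X) (?Fix (insert a X) (Transposition.transpose a b \<circ> q))"
    proof (rule inj_onI)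
      fix A B assume A: "A \<in> ?Fix (insert a X) (Transposition.transpose a b \<circ> q)"
        and B: "B \<in> ?Fix (insert a X) (Transposition.transpose a b \<circ> q)" and eq: "restrict A X = restrict B X"
      have P: "A \<in> PiE (insert a X) (\<lambda>_. {..<d})" "B \<in> PiE (insert a X) (\<lambda>_. {..<d})" using A B by blast+
      have X: "A x = B x" if "x \<in> X" for x using fun_cong[OF eq, of x] that by simp
      have "q a = a" using permutes_not_in[OF q insert.hyps(2)] .
      then have "A b = A a" "B b = B a" using A B by simp_all
      then have "A a = B a" using X[OF b] by simp
      then have "A x = B x" if "x \<in> insert a X" for x using that X by blast
      then show "A = B" by (rule PiE_ext[OF P])
    qed
    show "(\<lambda>A. restrict A X) ` ?Fix (insert a X) (Transposition.transpose a b \<circ> q) \<subseteq> ?Fix X q"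
      using restr[OF q] b by (intro image_subsetI) blast
  qed (rule fin)
  have "(\<Sum>\<xi> | \<xi> permutes insert a X. card (?Fix (insert a X) \<xi>)) =
    (\<Sum>b\<in>insert a X. \<Sum>q | q permutes X. card (?Fix (insert a X) (Transposition.transpose a b \<circ> q)))"
    by (rule sum_over_permutations_insert[OF insert.hyps])
  also have "\<dots> = (\<Sum>q | q permutes X. card (?Fix (insert a X) (Transposition.transpose a a \<circ> q))) +
    (\<Sum>b\<in>X. \<Sum>q | q permutes X. card (?Fix (insert a X) (Transposition.transpose a b \<circ> q)))"
    by (rule sum.insert[OF insert.hyps])
  also have "\<dots> \<le> (\<Sum>q | q permutes X. d * card (?Fix X q)) + (\<Sum>b\<in>X. \<Sum>q | q permutes X. card (?Fix X q))"
    by (intro add_mono sum_mono new old) simp_all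
  also have "\<dots> = (d + card X) * (\<Sum>q | q permutes X. card (?Fix X q))"
    by (simp only: sum_distrib_left[symmetric] sum_constant of_nat_id distrib_right)
  also have "\<dots> \<le> (d + card X) * (\<Prod>i<card X. d + i)"
    by (intro mult_left_mono insert.IH) simp
  also have "\<dots> = (\<Prod>i<card (insert a X). d + i)"
    unfolding card_insert_disjoint[OF insert.hyps] by (simp add: mult.commute)
  finally show ?case .
qed

section \<open>Junctions of switched words\<close>

definition rotation_lanes :: "nat \<Rightarrow> nat \<times> bool \<Rightarrow> nat \<times> bool" where
  "rotation_lanes n x = (if fst x < n then (Suc (fst x) mod n, snd x) else x)"

text \<open>Position \<open>(i, b)\<close> of the two switched words reads the letter \<open>(k, c)\<close>: row \<open>k\<close> of the first
  (\<open>c = False\<close>) or second (\<open>c = True\<close>) original word.\<close>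

definition lane_reading :: "nat set \<Rightarrow> (nat \<Rightarrow> nat) \<Rightarrow> (nat \<Rightarrow> nat) \<Rightarrow> nat \<times> bool \<Rightarrow> nat \<times> bool" where
  "lane_reading S p q x =
    ((if snd x then q else p) (fst x), snd x \<noteq> ((if snd x then q else p) (fst x) \<in> S))"

text \<open>The shift of the two lanes, conjugated by the reading map: each letter goes to the
  letter that follows it in the switched words. \<open>S = {}\<close> gives the successors in the
  original words.\<close>

definition junction_perm :: "nat \<Rightarrow> nat set \<Rightarrow> (nat \<Rightarrow> nat) \<Rightarrow> (nat \<Rightarrow> nat) \<Rightarrow> nat \<times> bool \<Rightarrow> nat \<times> bool" where
  "junction_perm n S p q = lane_reading S p q \<circ> rotation_lanes n \<circ> inv_into UNIV (lane_reading S p q)"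

abbreviation positions :: "nat \<Rightarrow> (nat \<times> bool) set" where
  "positions n \<equiv> {..<n} \<times> (UNIV :: bool set)"

lemma Suc_mod_inj:
  assumes "i < n" "j < n" "Suc i mod n = Suc j mod n"
  shows "i = j"
  using assms by (cases "Suc i = n"; cases "Suc j = n") auto

lemma permutes_of_inj:
  assumes X: "finite X" and inj: "inj_on f X" and sub: "f ` X \<subseteq> X" and out: "\<And>x. x \<notin> X \<Longrightarrow> f x = x"
  shows "f permutes X"
proof (rule bij_imp_permutes)
  show "bij_betw f X X" using inj endo_inj_surj[OF X sub inj] by (simp add: bij_betw_def)
qed (rule out)

lemma rotation_lanes_permutes: "rotation_lanes n permutes positions n"
proof (rule permutes_of_inj)
  show "inj_on (rotation_lanes n) (positions n)"
  proof (rule inj_onI)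
    fix x y assume x: "x \<in> positions n" and y: "y \<in> positions n" and eq: "rotation_lanes n x = rotation_lanes n y"
    have "fst x < n" "fst y < n" using x y by (simp_all add: mem_Times_iff)
    with eq have "Suc (fst x) mod n = Suc (fst y) mod n" "snd x = snd y" by (simp_all add: rotation_lanes_def)
    with \<open>fst x < n\<close> \<open>fst y < n\<close> show "x = y" by (intro prod_eqI) (auto intro: Suc_mod_inj)
  qed
  show "rotation_lanes n ` positions n \<subseteq> positions n"
    by (intro image_subsetI) (simp add: rotation_lanes_def mem_Times_iff)
  show "rotation_lanes n x = x" if "x \<notin> positions n" for x
    using that by (simp add: rotation_lanes_def mem_Times_iff)
qed simp

text \<open>A letter (k, c) reveals its lane, which is c altered by whether k lies in
  \<open>S\<close>, and then its position by inverting the order of that lane.\<close>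

lemma lane_reading_permutes:
  assumes p: "p permutes {..<n}" and q: "q permutes {..<n}" and S: "S \<subseteq> {..<n}"
  shows "lane_reading S p q permutes positions n"
proof (rule permutes_of_inj)
  have r: "(if b then q else p) permutes {..<n}" for b using p q by simp
  show "inj_on (lane_reading S p q) (positions n)"
  proof (rule inj_onI)
    fix x y assume eq: "lane_reading S p q x = lane_reading S p q y"
    let ?k = "\<lambda>x. (if snd x then q else p) (fst x)"
    have k: "?k x = ?k y" and "(snd x \<noteq> (?k x \<in> S)) = (snd y \<noteq> (?k y \<in> S))"
      using eq unfolding lane_reading_def prod.inject by blast+
    then have b: "snd x = snd y" unfolding k by (cases "snd x"; cases "snd y") simp_all
    have "inj (if snd y then q else p)" by (rule permutes_inj[OF r])
    then have "fst x = fst y" using k unfolding b by (rule injD)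
    then show "x = y" using b by (rule prod_eqI)
  qed
  show "lane_reading S p q ` positions n \<subseteq> positions n"
  proof (rule image_subsetI)
    fix x assume "x \<in> positions n"
    then have "fst x < n" by (simp add: mem_Times_iff)
    then have "(if snd x then q else p) (fst x) < n" using permutes_in_image[OF r[of "snd x"], of "fst x"] by simp
    then show "lane_reading S p q x \<in> positions n" unfolding lane_reading_def mem_Times_iff fst_conv by simp
  qed
  show "lane_reading S p q x = x" if "x \<notin> positions n" for x
  proof -
    have x: "fst x \<notin> {..<n}" using that by (simp add: mem_Times_iff)
    have "(if snd x then q else p) (fst x) = fst x" by (rule permutes_not_in[OF r x])
    moreover have "fst x \<notin> S" using x S by blast
    ultimately show ?thesis unfolding lane_reading_def by simp
  qed
qed simp

lemma junction_perm_permutes: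
  assumes "p permutes {..<n}" "q permutes {..<n}" "S \<subseteq> {..<n}"
  shows "junction_perm n S p q permutes positions n"
  unfolding junction_perm_def
  by (intro permutes_compose permutes_inv rotation_lanes_permutes lane_reading_permutes assms)

lemma junction_perm_lane:
  assumes "p permutes {..<n}" "q permutes {..<n}" "S \<subseteq> {..<n}"
  shows "junction_perm n S p q (lane_reading S p q x) = lane_reading S p q (rotation_lanes n x)"
  using permutes_inverses(2)[OF lane_reading_permutes[OF assms]] by (simp add: junction_perm_def)

text \<open>The two cycles through \<open>(0, False)\<close> and \<open>(0, True)\<close> recover \<open>S\<close> and both orders.\<close>

lemma junction_perm_inj:
  assumes n: "n \<ge> 1"
  shows "inj_on (\<lambda>t. (junction_perm n (snd (snd t)) (fst t) (fst (snd t)),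
      lane_reading (snd (snd t)) (fst t) (fst (snd t)) (0, False), fst (snd t) 0))
    ({p. p permutes {..<n}} \<times> ({q. q permutes {..<n}} \<times> Pow {..<n}))"
proof (rule inj_onI)
  fix t t'
  assume t: "t \<in> {p. p permutes {..<n}} \<times> ({q. q permutes {..<n}} \<times> Pow {..<n})"
    and t': "t' \<in> {p. p permutes {..<n}} \<times> ({q. q permutes {..<n}} \<times> Pow {..<n})"
    and eq: "(junction_perm n (snd (snd t)) (fst t) (fst (snd t)),
      lane_reading (snd (snd t)) (fst t) (fst (snd t)) (0, False), fst (snd t) 0) =
     (junction_perm n (snd (snd t')) (fst t') (fst (snd t')),
      lane_reading (snd (snd t')) (fst t') (fst (snd t')) (0, False), fst (snd t') 0)"
  obtain p q S where tt: "t = (p, q, S)" by (metis prod.exhaust)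
  obtain p' q' S' where tt': "t' = (p', q', S')" by (metis prod.exhaust)
  have P: "p permutes {..<n}" "q permutes {..<n}" "S \<subseteq> {..<n}" using t by (simp_all add: tt)
  have P': "p' permutes {..<n}" "q' permutes {..<n}" "S' \<subseteq> {..<n}" using t' by (simp_all add: tt')
  let ?e = "lane_reading S p q" and ?e' = "lane_reading S' p' q'"
  have Z: "junction_perm n S p q = junction_perm n S' p' q'" and e0: "?e (0, False) = ?e' (0, False)" and q0: "q 0 = q' 0"
    using eq unfolding tt tt' by simp_all
  \<comment> \<open>From one known position, the junction permutation reproduces the whole
    lane.\<close>
  have step: "?e (i, b) = ?e' (i, b)" if "i < n" "?e (0, b) = ?e' (0, b)" for i b
    using that
  proof (induction i)
    case (Suc i)
    then have "?e (i, b) = ?e' (i, b)" by simp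
    moreover have "rotation_lanes n (i, b) = (Suc i, b)" using Suc.prems(1) by (simp add: rotation_lanes_def)
    ultimately show ?case
      using junction_perm_lane[OF P, of "(i, b)"] junction_perm_lane[OF P', of "(i, b)"] Z by simp
  qed
  have lane0: "?e (i, False) = ?e' (i, False)" if "i < n" for i by (rule step[OF that e0])
  have pp: "p i = p' i" and pS: "(p i \<in> S) = (p' i \<in> S')" if "i < n" for i
    using lane0[OF that] by (auto simp: lane_reading_def)
  have S_eq: "S = S'"
  proof (rule Set.set_eqI)
    fix k
    show "k \<in> S \<longleftrightarrow> k \<in> S'"
    proof (cases "k < n")
      case True
      then obtain i where "i < n" "k = p i" using permutes_image[OF P(1)] by (metis imageE lessThan_iff)
      then show ?thesis using pS[of i] pp[of i] by simp
    next
      case False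
      then show ?thesis using P(3) P'(3) by auto
    qed
  qed
  \<comment> \<open>In the second lane the row \<open>q 0\<close> is enough: \<open>S\<close> is
    known by now and fixes the other component of the letter.\<close>
  have "?e (0, True) = ?e' (0, True)" using q0 S_eq by (simp add: lane_reading_def)
  then have lane1: "?e (i, True) = ?e' (i, True)" if "i < n" for i by (rule step[OF that])
  have qq: "q i = q' i" if "i < n" for i using lane1[OF that] by (simp add: lane_reading_def)
  have "p = p'"
  proof
    fix i show "p i = p' i"
      using pp[of i] permutes_not_in[OF P(1), of i] permutes_not_in[OF P'(1), of i] by (cases "i < n") simp_all
  qed
  moreover have "q = q'"
  proof
    fix i show "q i = q' i"
      using qq[of i] permutes_not_in[OF P(2), of i] permutes_not_in[OF P'(2), of i] by (cases "i < n") simp_all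
  qed
  ultimately show "t = t'" using S_eq tt tt' by simp
qed

text \<open>Every letter occupies exactly one position of the switched words, so their chaining
  conditions become one condition per letter, linking it to its successor.\<close>

lemma chained_junction:
  assumes perm: "p permutes {..<n}" "q permutes {..<n}" "S \<subseteq> {..<n}"
    and c: "chained n p (merge_on S n w w')" "chained n q (merge_on S n w' w)"
    and x: "x \<in> positions n"
  shows "snd ((if snd x then w' else w) (fst x)) =
    fst ((if snd (junction_perm n S p q x) then w' else w) (fst (junction_perm n S p q x)))"
proof -
  let ?e = "lane_reading S p q"
  obtain y where y: "y \<in> positions n" "x = ?e y"
    using permutes_image[OF lane_reading_permutes[OF perm]] x by (metis imageE)
  obtain i b where ib: "y = (i, b)" by (metis prod.exhaust)
  have i: "i < n" using y by (simp add: ib)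
  have si: "Suc i mod n < n" using i by simp
  have m: "(if b then merge_on S n w' w else merge_on S n w w') ((if b then q else p) j) =
      (if snd (?e (j, b)) then w' else w) (fst (?e (j, b)))" if "j < n" for j
  proof -
    have "(if b then q else p) j < n"
      using permutes_in_image[OF perm(1), of j] permutes_in_image[OF perm(2), of j] that by simp
    then show ?thesis by (cases b) (simp_all add: merge_on_def lane_reading_def)
  qed
  have "snd ((if b then merge_on S n w' w else merge_on S n w w') ((if b then q else p) i)) =
    fst ((if b then merge_on S n w' w else merge_on S n w w') ((if b then q else p) (Suc i mod n)))"
    using c i unfolding chained_def by (cases b) simp_all
  moreover have "junction_perm n S p q x = ?e (Suc i mod n, b)"
    unfolding y(2) junction_perm_lane[OF perm] ib using i by (simp add: rotation_lanes_def)
  ultimately show ?thesis unfolding m[OF i] m[OF si] y(2) ib by simp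
qed

lemma merge_on_empty: "w \<in> PiE {..<n} (\<lambda>_. X) \<Longrightarrow> merge_on {} n w w' = w"
  by (auto simp: merge_on_def fun_eq_iff restrict_def PiE_iff extensional_def)

text \<open>A pair of words is recorded by the first indices \<open>A\<close> of its letters, as the
  original junctions recover the second ones. The switched junctions prescribe the second indices
  once more, so \<open>A\<close> agrees at the two successors of each letter.\<close>

lemma card_switched_pairs_le:
  assumes "p1 permutes {..<n}" "p2 permutes {..<n}" and perm: "p permutes {..<n}" "q permutes {..<n}" "S \<subseteq> {..<n}"
  shows "card {u \<in> words n d \<times> words n d. chained n p1 (fst u) \<and> chained n p2 (snd u) \<and>
      chained n p (merge_on S n (fst u) (snd u)) \<and> chained n q (merge_on S n (snd u) (fst u))}
    \<le> card {A \<in> PiE (positions n) (\<lambda>_. {..<d}). \<forall>x\<in>positions n. A (junction_perm n {} p1 p2 x) = A (junction_perm n S p q x)}"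
    (is "card ?G \<le> card ?B")
proof (rule card_inj_on_le)
  let ?X = "positions n"
  define V where "V u x = (if snd x then snd u else fst u) (fst x)"
    for u :: "(nat \<Rightarrow> nat \<times> nat) \<times> (nat \<Rightarrow> nat \<times> nat)" and x :: "nat \<times> bool"
  define \<phi> where "\<phi> u = (\<lambda>x\<in>?X. fst (V u x))" for u
  have perm0: "p1 permutes {..<n}" "p2 permutes {..<n}" "{} \<subseteq> {..<n}" using assms by simp_all
  let ?Zold = "junction_perm n {} p1 p2" and ?Z = "junction_perm n S p q"
  have Z0X: "?Zold x \<in> ?X" if "x \<in> ?X" for x using permutes_in_image[OF junction_perm_permutes[OF perm0]] that by blast
  have ZX: "?Z x \<in> ?X" if "x \<in> ?X" for x using permutes_in_image[OF junction_perm_permutes[OF perm]] that by blast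
  have W: "fst u \<in> words n d" "snd u \<in> words n d" if "u \<in> ?G" for u using that by (simp_all add: mem_Times_iff)
  have Z0_eq: "snd (V u x) = fst (V u (?Zold x))" if u: "u \<in> ?G" and x: "x \<in> ?X" for u x
  proof -
    have "chained n p1 (merge_on {} n (fst u) (snd u))" "chained n p2 (merge_on {} n (snd u) (fst u))"
      unfolding merge_on_empty[OF W(1)[OF u]] merge_on_empty[OF W(2)[OF u]] using u by simp_all
    from chained_junction[OF perm0 this x] show ?thesis unfolding V_def .
  qed
  have Z_eq: "snd (V u x) = fst (V u (?Z x))" if u: "u \<in> ?G" and x: "x \<in> ?X" for u x
  proof -
    have "chained n p (merge_on S n (fst u) (snd u))" "chained n q (merge_on S n (snd u) (fst u))" using u by simp_all
    from chained_junction[OF perm this x] show ?thesis unfolding V_def .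
  qed
  show "\<phi> ` ?G \<subseteq> ?B"
  proof (rule image_subsetI)
    fix u assume u: "u \<in> ?G"
    have "fst (V u x) \<in> {..<d}" if x: "x \<in> ?X" for x
    proof -
      have k: "fst x \<in> {..<n}" using x by (simp add: mem_Times_iff)
      have "fst u (fst x) \<in> {..<d} \<times> {..<d}" "snd u (fst x) \<in> {..<d} \<times> {..<d}"
        by (rule PiE_mem[OF W(1)[OF u] k], rule PiE_mem[OF W(2)[OF u] k])
      then show ?thesis unfolding V_def by (simp add: mem_Times_iff)
    qed
    then have "\<phi> u \<in> PiE ?X (\<lambda>_. {..<d})" unfolding \<phi>_def by (intro restrict_PiE_iff[THEN iffD2] ballI)
    moreover have "\<phi> u (?Zold x) = \<phi> u (?Z x)" if x: "x \<in> ?X" for x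
      unfolding \<phi>_def restrict_apply'[OF Z0X[OF x]] restrict_apply'[OF ZX[OF x]]
      using Z0_eq[OF u x] Z_eq[OF u x] by simp
    ultimately show "\<phi> u \<in> ?B" by blast
  qed
  show "inj_on \<phi> ?G"
  proof (rule inj_onI)
    fix u u' assume u: "u \<in> ?G" and u': "u' \<in> ?G" and eq: "\<phi> u = \<phi> u'"
    have f: "fst (V u x) = fst (V u' x)" if "x \<in> ?X" for x
      using fun_cong[OF eq, of x] unfolding \<phi>_def restrict_apply'[OF that] .
    have V_eq: "V u x = V u' x" if x: "x \<in> ?X" for x
    proof (rule prod_eqI)
      show "fst (V u x) = fst (V u' x)" by (rule f[OF x])
      show "snd (V u x) = snd (V u' x)" unfolding Z0_eq[OF u x] Z0_eq[OF u' x] by (rule f[OF Z0X[OF x]])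
    qed
    have "fst u = fst u'"
    proof (rule PiE_ext[OF W(1)[OF u] W(1)[OF u']])
      fix k assume "k \<in> {..<n}"
      then show "fst u k = fst u' k" using V_eq[of "(k, False)"] by (simp add: V_def)
    qed
    moreover have "snd u = snd u'"
    proof (rule PiE_ext[OF W(2)[OF u] W(2)[OF u']])
      fix k assume "k \<in> {..<n}"
      then show "snd u k = snd u' k" using V_eq[of "(k, True)"] by (simp add: V_def)
    qed
    ultimately show "u = u'" by (rule prod_eqI)
  qed
  show "finite ?B" by (rule finite_subset[of _ "PiE ?X (\<lambda>_. {..<d})"]) (auto intro!: finite_PiE)
qed

text \<open>Composition with the inverse of the original junction permutation turns compatibility of
  two permutations into invariance under one. The triples are encoded by a permutation of the
  \<open>2 * n\<close> letters and two tags with \<open>2 * n\<close> and \<open>n\<close> values;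
  admitting all such codes leaves the sum of \<open>sum_fixed_colourings\<close>.\<close>

lemma sum_compatible_colourings:
  assumes n: "n \<ge> 1" and perm0: "p1 permutes {..<n}" "p2 permutes {..<n}"
  defines "R \<equiv> {\<pi>. \<pi> permutes {..<n}}"
  shows "(\<Sum>t\<in>R \<times> (R \<times> Pow {..<n}).
      card {A \<in> PiE (positions n) (\<lambda>_. {..<d}). \<forall>x\<in>positions n.
        A (junction_perm n {} p1 p2 x) = A (junction_perm n (snd (snd t)) (fst t) (fst (snd t)) x)})
    \<le> 2 * n\<^sup>2 * (\<Prod>i<2 * n. d + i)"
proof -
  let ?X = "positions n" and ?Zold = "junction_perm n {} p1 p2"
  let ?T = "R \<times> (R \<times> Pow {..<n})" and ?Sym = "{\<xi>. \<xi> permutes positions n}"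
  define N where "N Z = card {A \<in> PiE ?X (\<lambda>_. {..<d}). \<forall>x\<in>?X. A (?Zold x) = A (Z x)}" for Z
  define \<Psi> where "\<Psi> t = (junction_perm n (snd (snd t)) (fst t) (fst (snd t)),
      lane_reading (snd (snd t)) (fst t) (fst (snd t)) (0, False), fst (snd t) 0)" for t
  have inj: "inj_on \<Psi> ?T" unfolding \<Psi>_def R_def by (rule junction_perm_inj[OF n])
  have fin: "finite (?Sym \<times> (?X \<times> {..<n}))" by (intro finite_cartesian_product finite_permutations) auto
  have perm_old: "?Zold permutes ?X" using junction_perm_permutes[OF perm0, of "{}"] by simp
  have sub: "\<Psi> ` ?T \<subseteq> ?Sym \<times> (?X \<times> {..<n})"
  proof (rule image_subsetI)
    fix t assume t: "t \<in> ?T"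
    obtain p q S where tt: "t = (p, q, S)" by (metis prod.exhaust)
    have P: "p permutes {..<n}" "q permutes {..<n}" "S \<subseteq> {..<n}" using t by (simp_all add: tt R_def)
    have "junction_perm n S p q \<in> ?Sym" using junction_perm_permutes[OF P] by simp
    moreover have "lane_reading S p q (0, False) \<in> ?X"
      using permutes_in_image[OF lane_reading_permutes[OF P], of "(0, False)"] n by simp
    moreover have "q 0 \<in> {..<n}" using permutes_in_image[OF P(2), of 0] n by simp
    ultimately show "\<Psi> t \<in> ?Sym \<times> (?X \<times> {..<n})" unfolding \<Psi>_def tt fst_conv snd_conv by (intro SigmaI)
  qed
  have "(\<Sum>t\<in>?T. N (fst (\<Psi> t))) = (\<Sum>y\<in>\<Psi> ` ?T. N (fst y))"
    by (subst sum.reindex[OF inj]) (simp add: o_def)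
  also have "\<dots> \<le> (\<Sum>y\<in>?Sym \<times> (?X \<times> {..<n}). N (fst y))"
    by (rule sum_mono2[OF fin sub]) simp
  also have "\<dots> = (\<Sum>Z\<in>?Sym. 2 * n\<^sup>2 * N Z)"
    unfolding sum.cartesian_product'[of _ ?Sym] fst_conv
    by (simp add: card_cartesian_product power2_eq_square mult_ac)
  also have "\<dots> = 2 * n\<^sup>2 * (\<Sum>Z\<in>?Sym. N Z)" by (rule sum_distrib_left[symmetric])
  also have "(\<Sum>Z\<in>?Sym. N Z) = (\<Sum>\<xi>\<in>?Sym. N (\<xi> \<circ> ?Zold))"
    by (rule sum_permutations_compose_right[OF perm_old])
  also have "\<dots> = (\<Sum>\<xi>\<in>?Sym. card {A \<in> PiE ?X (\<lambda>_. {..<d}). \<forall>x\<in>?X. A (\<xi> x) = A x})"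
  proof (rule sum.cong[OF refl])
    fix \<xi>
    have "(\<forall>x\<in>?X. A (?Zold x) = A ((\<xi> \<circ> ?Zold) x)) \<longleftrightarrow> (\<forall>x\<in>?X. A (\<xi> x) = A x)" for A :: "nat \<times> bool \<Rightarrow> nat"
    proof -
      have "(\<forall>x\<in>?X. A (\<xi> x) = A x) \<longleftrightarrow> (\<forall>x\<in>?Zold ` ?X. A (\<xi> x) = A x)"
        unfolding permutes_image[OF perm_old] ..
      also have "\<dots> \<longleftrightarrow> (\<forall>x\<in>?X. A (\<xi> (?Zold x)) = A (?Zold x))" by blast
      finally show ?thesis unfolding o_apply by metis
    qed
    then show "N (\<xi> \<circ> ?Zold) = card {A \<in> PiE ?X (\<lambda>_. {..<d}). \<forall>x\<in>?X. A (\<xi> x) = A x}"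
      unfolding N_def by (simp only:)
  qed
  also have "\<dots> \<le> (\<Prod>i<card ?X. d + i)" by (rule sum_fixed_colourings) simp
  also have "card ?X = 2 * n" by (simp add: card_cartesian_product)
  finally show ?thesis unfolding N_def \<Psi>_def fst_conv by simp
qed

text \<open>The four averaged weights expand into two orders of the original words and two of the
  switched ones. For fixed original orders the rest is counted by
  \<open>sum_compatible_colourings\<close>; the \<open>(fact n)\<^sup>2\<close> original choices
  cancel half of the normalization \<open>fact n ^ 4\<close>.\<close>

lemma switched_energy_perms:
  assumes n: "n \<ge> 1"
  shows "switched_energy {\<pi>. \<pi> permutes {..<n}} n d \<le> 2 * (real n / fact n)\<^sup>2 * (\<Prod>i<2 * n. real d + real i)"
proof -
  let ?R = "{\<pi>. \<pi> permutes {..<n}}" and ?W = "words n d" and ?P = "Pow {..<n}"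
  have cR: "card ?R = fact n" by (simp add: card_permutations)
  define I where "I \<pi> w = (if chained n \<pi> w then 1 else 0 :: real)" for \<pi> w
  have h: "order_weight ?R n w = (\<Sum>\<pi>\<in>?R. I \<pi> w) / fact n" for w
    unfolding order_weight_def cR I_def by simp
  define F where "F p1 p2 p q S u = I p1 (fst u) * I p2 (snd u) *
      (I p (merge_on S n (fst u) (snd u)) * I q (merge_on S n (snd u) (fst u)))" for p1 p2 p q S u
  define G where "G p1 p2 p q S = {u \<in> ?W \<times> ?W. chained n p1 (fst u) \<and> chained n p2 (snd u) \<and>
      chained n p (merge_on S n (fst u) (snd u)) \<and> chained n q (merge_on S n (snd u) (fst u))}" for p1 p2 p q S
  define B where "B p1 p2 p q S = card {A \<in> PiE (positions n) (\<lambda>_. {..<d}). \<forall>x\<in>positions n.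
        A (junction_perm n {} p1 p2 x) = A (junction_perm n S p q x)}" for p1 p2 p q S
  have "switched_energy ?R n d = (\<Sum>S\<in>?P. \<Sum>u\<in>?W \<times> ?W. \<Sum>p1\<in>?R. \<Sum>p2\<in>?R. \<Sum>p\<in>?R. \<Sum>q\<in>?R. F p1 p2 p q S u / fact n ^ 4)"
    unfolding switched_energy_def
  proof (rule sum.cong[OF refl])
    fix S
    have four: "a / f * (b / f) * (c / f * (e / f)) = a * b * (c * e) / f ^ 4" for a b c e f :: real
      by (simp add: eval_nat_numeral)
    have prods: "(\<Sum>x\<in>D. f1 x) * (\<Sum>x\<in>D. f2 x) * ((\<Sum>x\<in>D. f3 x) * (\<Sum>x\<in>D. f4 x)) =
       (\<Sum>x\<in>D. \<Sum>y\<in>D. \<Sum>z\<in>D. \<Sum>w\<in>D. f1 x * f2 y * (f3 z * f4 w))" for f1 f2 f3 f4 :: "(nat \<Rightarrow> nat) \<Rightarrow> real" and D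
      by (simp only: sum_distrib_left[symmetric] sum_distrib_right[symmetric])
    show "(\<Sum>w\<in>?W. \<Sum>w'\<in>?W. order_weight ?R n w * order_weight ?R n w' *
        (order_weight ?R n (merge_on S n w w') * order_weight ?R n (merge_on S n w' w))) =
      (\<Sum>u\<in>?W \<times> ?W. \<Sum>p1\<in>?R. \<Sum>p2\<in>?R. \<Sum>p\<in>?R. \<Sum>q\<in>?R. F p1 p2 p q S u / fact n ^ 4)"
      unfolding sum.cartesian_product'[of _ ?W ?W] h four prods F_def fst_conv snd_conv sum_divide_distrib ..
  qed
  also have "\<dots> = (\<Sum>p1\<in>?R. \<Sum>p2\<in>?R. \<Sum>p\<in>?R. \<Sum>q\<in>?R. \<Sum>S\<in>?P. \<Sum>u\<in>?W \<times> ?W. F p1 p2 p q S u / fact n ^ 4)"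
    by (simp only: sum.swap[of _ ?R "?W \<times> ?W"] sum.swap[of _ ?R ?P])
  also have "\<dots> = (\<Sum>p1\<in>?R. \<Sum>p2\<in>?R. \<Sum>p\<in>?R. \<Sum>q\<in>?R. \<Sum>S\<in>?P. real (card (G p1 p2 p q S)) / fact n ^ 4)"
  proof (intro sum.cong refl)
    fix p1 p2 p q S
    have "(\<Sum>u\<in>?W \<times> ?W. F p1 p2 p q S u) = (\<Sum>u\<in>?W \<times> ?W. if chained n p1 (fst u) \<and> chained n p2 (snd u) \<and>
      chained n p (merge_on S n (fst u) (snd u)) \<and> chained n q (merge_on S n (snd u) (fst u)) then 1 else 0)"
      unfolding F_def I_def by (intro sum.cong refl) simp
    also have "\<dots> = real (card (G p1 p2 p q S))"
      unfolding G_def by (subst sum.inter_filter[symmetric]) auto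
    finally show "(\<Sum>u\<in>?W \<times> ?W. F p1 p2 p q S u / fact n ^ 4) = real (card (G p1 p2 p q S)) / fact n ^ 4"
      unfolding sum_divide_distrib[symmetric] by (rule arg_cong)
  qed
  also have "\<dots> \<le> (\<Sum>p1\<in>?R. \<Sum>p2\<in>?R. \<Sum>p\<in>?R. \<Sum>q\<in>?R. \<Sum>S\<in>?P. real (B p1 p2 p q S) / fact n ^ 4)"
  proof (intro sum_mono divide_right_mono of_nat_mono)
    fix p1 p2 p q S assume "p1 \<in> ?R" "p2 \<in> ?R" "p \<in> ?R" "q \<in> ?R" "S \<in> ?P"
    then show "card (G p1 p2 p q S) \<le> B p1 p2 p q S"
      unfolding G_def B_def by (intro card_switched_pairs_le) simp_all
  qed simp
  also have "\<dots> = (\<Sum>p1\<in>?R. \<Sum>p2\<in>?R. real (\<Sum>p\<in>?R. \<Sum>q\<in>?R. \<Sum>S\<in>?P. B p1 p2 p q S) / fact n ^ 4)"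
    by (simp only: of_nat_sum sum_divide_distrib)
  also have "\<dots> \<le> (\<Sum>p1\<in>?R. \<Sum>p2\<in>?R. real (2 * n\<^sup>2 * (\<Prod>i<2 * n. d + i)) / fact n ^ 4)"
  proof (intro sum_mono divide_right_mono of_nat_mono)
    fix p1 p2 assume p: "p1 \<in> ?R" "p2 \<in> ?R"
    then have perm0: "p1 permutes {..<n}" "p2 permutes {..<n}" by simp_all
    show "(\<Sum>p\<in>?R. \<Sum>q\<in>?R. \<Sum>S\<in>?P. B p1 p2 p q S) \<le> 2 * n\<^sup>2 * (\<Prod>i<2 * n. d + i)"
      using sum_compatible_colourings[OF n perm0, of d]
      unfolding sum.cartesian_product' fst_conv snd_conv B_def .
  qed simp
  also have "\<dots> = 2 * (real n / fact n)\<^sup>2 * (\<Prod>i<2 * n. real d + real i)"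
  proof -
    have "(fact n * (fact n * (2 * (x\<^sup>2 * y)))) / fact n ^ 4 = 2 * (x / fact n)\<^sup>2 * y" for x y :: real
      by (simp add: power_divide eval_nat_numeral)
    then show ?thesis by (simp add: cR mult.assoc)
  qed
  finally show ?thesis .
qed

section \<open>Rotations of the order\<close>

definition rotate_order :: "nat \<Rightarrow> nat \<Rightarrow> nat \<Rightarrow> nat" where
  "rotate_order n r i = (if i < n then (i + r) mod n else i)"

lemma rotate_order_permutes: "rotate_order n r permutes {..<n}"
proof (rule permutes_of_inj)
  show "inj_on (rotate_order n r) {..<n}"
  proof (rule inj_onI)
    fix i j assume ij: "i \<in> {..<n}" "j \<in> {..<n}" "rotate_order n r i = rotate_order n r j"
    then have "[i + r = j + r] (mod n)" by (simp add: rotate_order_def cong_def)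
    then have "[i = j] (mod n)" by (simp only: cong_add_rcancel_nat)
    then show "i = j" using ij by (simp add: cong_def)
  qed
qed (auto simp: rotate_order_def)

lemma chained_rotate:
  assumes "chained n \<pi> w"
  shows "chained n (\<pi> \<circ> rotate_order n r) w"
  unfolding chained_def
proof (intro allI impI)
  fix i assume i: "i < n"
  have "rotate_order n r (Suc i mod n) = Suc (rotate_order n r i) mod n"
    using i by (simp add: rotate_order_def mod_simps)
  moreover have "rotate_order n r i < n" using i by (simp add: rotate_order_def)
  ultimately show "snd (w ((\<pi> \<circ> rotate_order n r) i)) = fst (w ((\<pi> \<circ> rotate_order n r) (Suc i mod n)))"
    using assms unfolding chained_def o_apply by simp
qed

text \<open>Every chained word is chained along all \<open>n\<close> rotations of the order.\<close>

lemma word_energy_perms: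
  assumes n: "n \<ge> 1"
  shows "real n / fact n * real d ^ n \<le> word_energy {\<pi>. \<pi> permutes {..<n}} n d"
proof -
  let ?R = "{\<pi>. \<pi> permutes {..<n}}"
  have cR: "card ?R = fact n" by (simp add: card_permutations)
  have finR: "finite ?R" by (intro finite_permutations) simp
  have h: "order_weight ?R n w = real (card {\<pi> \<in> ?R. chained n \<pi> w}) / fact n" for w
  proof -
    have "(\<Sum>\<pi>\<in>?R. if chained n \<pi> w then 1 else 0 :: real) = real (card {\<pi> \<in> ?R. chained n \<pi> w})"
      using finR by (subst sum.inter_filter[symmetric]) auto
    then show ?thesis unfolding order_weight_def cR by simp
  qed
  \<comment> \<open>A word has weight 0 or at least \<open>n / fact n\<close>, so its squared weight
    is at least that multiple of the weight.\<close>
  have low: "real n / fact n * order_weight ?R n w \<le> (order_weight ?R n w)\<^sup>2" for w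
  proof (cases "{\<pi> \<in> ?R. chained n \<pi> w} = {}")
    case True
    then show ?thesis unfolding h True by simp
  next
    case False
    then obtain \<pi> where \<pi>: "\<pi> permutes {..<n}" "chained n \<pi> w" by blast
    have "card {..<n} \<le> card {\<pi> \<in> ?R. chained n \<pi> w}"
    proof (rule card_inj_on_le[of "\<lambda>r. \<pi> \<circ> rotate_order n r"])
      show "inj_on (\<lambda>r. \<pi> \<circ> rotate_order n r) {..<n}"
      proof (rule inj_onI)
        fix r s assume rs: "r \<in> {..<n}" "s \<in> {..<n}" and eq: "\<pi> \<circ> rotate_order n r = \<pi> \<circ> rotate_order n s"
        have "\<pi> (rotate_order n r 0) = \<pi> (rotate_order n s 0)" using fun_cong[OF eq, of 0] by (simp only: o_apply)
        then have "rotate_order n r 0 = rotate_order n s 0" by (rule injD[OF permutes_inj[OF \<pi>(1)]])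
        then show "r = s" using rs n by (simp add: rotate_order_def)
      qed
      show "(\<lambda>r. \<pi> \<circ> rotate_order n r) ` {..<n} \<subseteq> {\<pi> \<in> ?R. chained n \<pi> w}"
      proof (rule image_subsetI)
        fix r
        show "\<pi> \<circ> rotate_order n r \<in> {\<pi> \<in> ?R. chained n \<pi> w}"
          using permutes_compose[OF rotate_order_permutes \<pi>(1)] chained_rotate[OF \<pi>(2)] by blast
      qed
    qed (use finR in simp)
    then have "real n / fact n \<le> order_weight ?R n w" unfolding h by (simp add: divide_right_mono)
    then show ?thesis unfolding power2_eq_square by (intro mult_right_mono order_weight_nonneg)
  qed
  \<comment> \<open>Double counting: exactly \<open>d ^ n\<close> words close up in each
    order.\<close>
  have "(\<Sum>w\<in>words n d. order_weight ?R n w) = real d ^ n"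
  proof -
    have "(\<Sum>w\<in>words n d. order_weight ?R n w) = (\<Sum>w\<in>words n d. \<Sum>\<pi>\<in>?R. (if chained n \<pi> w then 1 else 0) / fact n)"
      unfolding order_weight_def cR sum_divide_distrib by simp
    also have "\<dots> = (\<Sum>\<pi>\<in>?R. \<Sum>w\<in>words n d. (if chained n \<pi> w then 1 else 0) / fact n)" by (rule sum.swap)
    also have "\<dots> = (\<Sum>\<pi>\<in>?R. real d ^ n / fact n)"
    proof (rule sum.cong[OF refl])
      fix \<pi> assume "\<pi> \<in> ?R"
      then have \<pi>: "\<pi> permutes {..<n}" by simp
      have "(\<Sum>w\<in>words n d. if chained n \<pi> w then 1 else 0 :: real) = real (card {w \<in> words n d. chained n \<pi> w})"
        by (subst sum.inter_filter[symmetric]) auto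
      then show "(\<Sum>w\<in>words n d. (if chained n \<pi> w then 1 else 0) / fact n) = real d ^ n / fact n"
        unfolding card_chained[OF \<pi>] sum_divide_distrib[symmetric] by simp
    qed
    also have "\<dots> = real d ^ n" by (simp add: cR)
    finally show ?thesis .
  qed
  then have "real n / fact n * real d ^ n = (\<Sum>w\<in>words n d. real n / fact n * order_weight ?R n w)"
    by (simp only: sum_distrib_left[symmetric])
  also have "\<dots> \<le> word_energy ?R n d" unfolding word_energy_def by (intro sum_mono low)
  finally show ?thesis .
qed

section \<open>The critical ratios\<close>

text \<open>Apart from \<open>d = 1\<close>, the first three bounds estimate 1 / (1 - x) for x = 1 /
  d at most 1/2. The four bounds serve, in turn, the base 4 for bounded \<open>d\<close>, the
  exponential bound, the determinant, and the base 3 for \<open>d \<ge> 3\<close>.\<close>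

lemma haar_factor_le:
  assumes d: "d \<ge> 1"
  shows "haar_factor d \<le> 2" "haar_factor d \<le> 1 + 2 / real d"
    "haar_factor d * (1 + 1 / real d) \<le> 1 + 4 / real d" "d \<ge> 3 \<Longrightarrow> haar_factor d \<le> 3 / 2"
proof -
  have *: "haar_factor d \<le> 2 \<and> haar_factor d \<le> 1 + 2 / real d \<and> haar_factor d * (1 + 1 / real d) \<le> 1 + 4 / real d"
  proof (cases "d = 1")
    case True
    then show ?thesis by (simp add: haar_factor_def)
  next
    case False
    define x where "x = 1 / real d"
    have x: "0 < x" "x \<le> 1 / 2" using d False by (auto simp: x_def field_simps)
    have dx: "real d * x = 1" using d by (simp add: x_def)
    have "real d - 1 > 0" using d False by simp
    then have hf: "haar_factor d = 1 / (1 - x)"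
      using d False by (simp add: haar_factor_def x_def field_simps)
    have 1: "0 < 1 - x" using x by simp
    have xx: "x * x \<le> x * (1 / 2)" using x by (intro mult_left_mono) auto
    have "1 / (1 - x) \<le> 2" using x 1 by (simp add: pos_divide_le_eq)
    moreover have "1 / (1 - x) \<le> 1 + 2 * x" using x 1 xx by (simp add: pos_divide_le_eq algebra_simps)
    moreover have "1 / (1 - x) * (1 + x) \<le> 1 + 4 * x"
    proof -
      have "1 + x \<le> (1 + 4 * x) * (1 - x)" using x xx by (simp add: algebra_simps)
      then have "(1 + x) / (1 - x) \<le> 1 + 4 * x" using 1 by (simp add: pos_divide_le_eq)
      then show ?thesis by simp
    qed
    ultimately show ?thesis unfolding hf by (simp add: x_def)
  qed
  then show "haar_factor d \<le> 2" "haar_factor d \<le> 1 + 2 / real d"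
    "haar_factor d * (1 + 1 / real d) \<le> 1 + 4 / real d" by blast+
  show "haar_factor d \<le> 3 / 2" if "d \<ge> 3"
    using that by (simp add: haar_factor_def field_simps)
qed

lemma det_ratio_bounds:
  assumes d: "d \<ge> 1" and n: "n \<ge> 1" and A: "zero_one_mat n A" and \<mu>: "haar_or_gaussian d \<mu>"
    and nz: "(\<integral>\<rho>. X_det d A \<rho> \<partial>iid_family n \<mu>) \<noteq> 0"
  shows "1 \<le> critical_ratio (iid_family n \<mu>) (X_det d A)"
    and "critical_ratio (iid_family n \<mu>) (X_det d A) \<le> 2 * (1 + 4 / real d) ^ n"
proof -
  have AC: "A \<in> carrier_mat n n" using A by (simp add: zero_one_mat_def)
  have R: "\<pi> permutes {..<n}" if "\<pi> \<in> {id}" for \<pi> using that permutes_id[of "{..<n}"] by (simp del: id_apply)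
  have X: "X_det d A \<rho> = (cmod (ordered_det_trace A {id} d n \<rho>))\<^sup>2"
    if "\<And>ij. ij \<in> {..<n} \<times> {..<n} \<Longrightarrow> \<rho> ij \<in> carrier_mat d d" for \<rho>
    unfolding X_det_def by (simp only: trace_cayley_det_random_mat[OF AC that])
  note b = critical_ratio_bounds[OF A \<mu> d n R X nz]
  show "1 \<le> critical_ratio (iid_family n \<mu>) (X_det d A)" by (rule b(1))
  have d0: "real d > 0" using d by simp
  have "critical_ratio (iid_family n \<mu>) (X_det d A) \<le>
      haar_factor d ^ n * (2 * (real d)\<^sup>2 ^ n * (1 + 1 / real d) ^ n / (real d ^ n)\<^sup>2)"
    using haar_factor_ge_1[OF d]
    by (intro order_trans[OF b(2)[unfolded word_energy_id]] mult_left_mono divide_right_mono switched_energy_id n d) auto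
  also have "\<dots> = 2 * (haar_factor d * (1 + 1 / real d)) ^ n"
    using d0 by (simp add: power_mult_distrib power_mult[symmetric] mult.commute[of n])
  also have "\<dots> \<le> 2 * (1 + 4 / real d) ^ n"
    using haar_factor_le(3)[OF d] haar_factor_ge_1[OF d] by (intro mult_left_mono power_mono mult_nonneg_nonneg) auto
  finally show "critical_ratio (iid_family n \<mu>) (X_det d A) \<le> 2 * (1 + 4 / real d) ^ n" .
qed

text \<open>For the exponential bound, n^2 / (n!)^2 cancels between the two energies and leaves
  twice the product of 1 + i/d over i < 2 n, at most 2 exp (2 n^2 / d). The Haar factors contribute
  exp (2 n / d), relaxed to exp (2 n^2 / d), whence the 4 in the exponent.\<close>

lemma sdet_ratio_bounds:
  assumes d: "d \<ge> 1" and n: "n \<ge> 1" and A: "zero_one_mat n A" and \<mu>: "haar_or_gaussian d \<mu>"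
    and nz: "(\<integral>\<rho>. X_sdet d A \<rho> \<partial>iid_family n \<mu>) \<noteq> 0"
  shows "critical_ratio (iid_family n \<mu>) (X_sdet d A) \<le> (2 * haar_factor d) ^ n"
    and "critical_ratio (iid_family n \<mu>) (X_sdet d A) \<le> 2 * exp (4 * (real n)\<^sup>2 / real d)"
proof -
  let ?R = "{\<pi>. \<pi> permutes {..<n}}"
  have AC: "A \<in> carrier_mat n n" using A by (simp add: zero_one_mat_def)
  have R: "\<pi> permutes {..<n}" if "\<pi> \<in> ?R" for \<pi> using that by simp
  have X: "X_sdet d A \<rho> = (cmod (ordered_det_trace A ?R d n \<rho>))\<^sup>2"
    if "\<And>ij. ij \<in> {..<n} \<times> {..<n} \<Longrightarrow> \<rho> ij \<in> carrier_mat d d" for \<rho>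
    unfolding X_sdet_def by (simp only: trace_sdet_random_mat[OF AC that])
  note b = critical_ratio_bounds[OF A \<mu> d n R X nz]
  have K: "haar_factor d \<ge> 1" by (rule haar_factor_ge_1[OF d])
  have d0: "real d > 0" using d by simp
  let ?H = "word_energy ?R n d"
  have "switched_energy ?R n d / ?H\<^sup>2 \<le> 2 ^ n"
    using switched_energy_le_power[of ?R n d] b(3) by (simp add: pos_divide_le_eq)
  then have "haar_factor d ^ n * (switched_energy ?R n d / ?H\<^sup>2) \<le> haar_factor d ^ n * 2 ^ n"
    using K by (intro mult_left_mono) auto
  with b(2) show "critical_ratio (iid_family n \<mu>) (X_sdet d A) \<le> (2 * haar_factor d) ^ n"
    by (simp add: power_mult_distrib mult.commute)
  define L where "L = real n / fact n * real d ^ n"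
  have L0: "L > 0" using n d0 by (simp add: L_def)
  have "switched_energy ?R n d / ?H\<^sup>2 \<le> 2 * (real n / fact n)\<^sup>2 * (\<Prod>i<2 * n. real d + real i) / L\<^sup>2"
  proof (rule frac_le)
    show "L\<^sup>2 \<le> ?H\<^sup>2" using L0 word_energy_perms[OF n, of d] unfolding L_def by (intro power_mono) auto
    show "0 < L\<^sup>2" using L0 by simp
    show "switched_energy ?R n d \<le> 2 * (real n / fact n)\<^sup>2 * (\<Prod>i<2 * n. real d + real i)"
      by (rule switched_energy_perms[OF n])
    show "0 \<le> 2 * (real n / fact n)\<^sup>2 * (\<Prod>i<2 * n. real d + real i)"
      by (intro mult_nonneg_nonneg prod_nonneg) auto
  qed
  also have "\<dots> = 2 * (\<Prod>i<2 * n. 1 + real i / real d)"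
  proof -
    have "(\<Prod>i<2 * n. real d + real i) = (\<Prod>i<2 * n. real d * (1 + real i / real d))"
      using d0 by (intro prod.cong refl) (simp add: distrib_left)
    also have "\<dots> = (real d ^ n)\<^sup>2 * (\<Prod>i<2 * n. 1 + real i / real d)"
      by (simp add: prod.distrib power_mult[symmetric] mult.commute)
    finally have e: "(\<Prod>i<2 * n. real d + real i) = (real d ^ n)\<^sup>2 * (\<Prod>i<2 * n. 1 + real i / real d)" .
    have cancel: "2 * x\<^sup>2 * (y\<^sup>2 * z) / (x * y)\<^sup>2 = 2 * z" if "x \<noteq> 0" "y \<noteq> 0" for x y z :: real
      using that by (simp add: power_mult_distrib)
    show ?thesis unfolding e L_def by (rule cancel) (use n d0 in auto)
  qed
  also have "(\<Prod>i<2 * n. 1 + real i / real d) \<le> (\<Prod>i<2 * n. exp (real i / real d))"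
    using d0 by (intro prod_mono conjI exp_ge_add_one_self) (auto intro!: add_nonneg_nonneg)
  also have "\<dots> = exp (\<Sum>i<2 * n. real i / real d)" by (simp add: exp_sum)
  also have "(\<Sum>i<2 * n. real i / real d) \<le> 2 * (real n)\<^sup>2 / real d"
  proof -
    have "(\<Sum>i<m. real i) \<le> (real m)\<^sup>2 / 2" for m by (induction m) (auto simp: power2_eq_square field_simps)
    from this[of "2 * n"] have "(\<Sum>i<2 * n. real i) \<le> 2 * (real n)\<^sup>2" by (simp add: power2_eq_square)
    then show ?thesis unfolding sum_divide_distrib[symmetric] using d0 by (intro divide_right_mono) auto
  qed
  finally have \<Phi>: "switched_energy ?R n d / ?H\<^sup>2 \<le> 2 * exp (2 * (real n)\<^sup>2 / real d)" by simp
  have "haar_factor d ^ n \<le> exp (2 / real d) ^ n"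
    using K by (intro power_mono order_trans[OF haar_factor_le(2)[OF d] exp_ge_add_one_self]) auto
  also have "\<dots> = exp (2 * real n / real d)" by (simp add: exp_of_nat_mult[symmetric])
  also have "\<dots> \<le> exp (2 * (real n)\<^sup>2 / real d)"
    using n d0 by (auto simp: power2_eq_square intro!: divide_right_mono)
  finally have "haar_factor d ^ n * (switched_energy ?R n d / ?H\<^sup>2) \<le> exp (2 * (real n)\<^sup>2 / real d) * (2 * exp (2 * (real n)\<^sup>2 / real d))"
    by (intro mult_mono' \<Phi> divide_nonneg_nonneg zero_le_power)
       (use K less_imp_le[OF b(3)] in \<open>auto simp: switched_energy_def intro!: sum_nonneg mult_nonneg_nonneg order_weight_nonneg\<close>)
  also have "\<dots> = 2 * exp (4 * (real n)\<^sup>2 / real d)" by (simp add: exp_add[symmetric])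
  finally show "critical_ratio (iid_family n \<mu>) (X_sdet d A) \<le> 2 * exp (4 * (real n)\<^sup>2 / real d)"
    using b(2) by (rule order_trans[rotated])
qed

lemma nth_root_error:
  fixes r b :: real
  assumes n: "n \<ge> 1" and r: "1 \<le> r" "r \<le> (1 + b) ^ n" and b: "0 \<le> b"
  shows "\<exists>\<epsilon>. \<bar>\<epsilon>\<bar> \<le> b \<and> r = (1 + \<epsilon>) ^ n"
proof (intro exI conjI)
  have "root n r \<le> root n ((1 + b) ^ n)" using n r by (intro real_root_le_mono) auto
  then have "root n r \<le> 1 + b" using n b by (simp add: real_root_power_cancel)
  moreover have "1 \<le> root n r" using n r by simp
  ultimately show "\<bar>root n r - 1\<bar> \<le> b" by simp
  show "r = (1 + (root n r - 1)) ^ n" using n r by simp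
qed

text \<open>4/3 is the quotient of the base 4 in the claim and the base 3 available for
  \<open>d \<ge> 3\<close>.\<close>

lemma eventually_power_le_exponential:
  "\<exists>N::nat. \<forall>n\<ge>N. real n ^ D \<le> (4 / 3) ^ n"
proof -
  define c where "c = ln (4 / 3 :: real)"
  have c: "c > 0" by (simp add: c_def)
  have "eventually (\<lambda>x. x ^ D / exp x < c ^ D) at_top"
    using tendsto_power_div_exp_0[of D] c by (intro order_tendstoD) auto
  then obtain x0 where x0: "\<And>x. x \<ge> x0 \<Longrightarrow> x ^ D / exp x < c ^ D"
    unfolding eventually_at_top_linorder by blast
  have "real n ^ D \<le> (4 / 3) ^ n" if "n \<ge> nat \<lceil>x0 / c\<rceil>" for n
  proof -
    have "x0 / c \<le> real n" using that by linarith
    then have "x0 \<le> c * real n" using c by (simp add: pos_divide_le_eq mult.commute)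
    from x0[OF this] have "c ^ D * real n ^ D < c ^ D * exp (c * real n)"
      by (simp add: pos_divide_less_eq power_mult_distrib)
    then have "real n ^ D < exp (c * real n)" using c by simp
    also have "\<dots> = (4 / 3) ^ n" unfolding c_def by (simp add: exp_of_nat2_mult)
    finally show ?thesis by simp
  qed
  then show ?thesis by blast
qed

text \<open>A constant factor has the form (1 + O(1/d))^n when n is at least d, but not uniformly
  for smaller n; hence the second reading with a bounded \<kappa>. For d = O(1) the exponent is read
  in two ways: with one constant for all \<open>D\<close> and n large, and with a constant depending
  on \<open>D\<close> and all n. The nonzero mean excludes a vanishing denominator.\<close>

theorem theorem1:
  shows
    "(\<exists>C::real. \<forall>d\<ge>1. \<forall>n\<ge>1. \<forall>A \<mu>.
        zero_one_mat n A \<longrightarrow> haar_or_gaussian d \<mu> \<longrightarrow>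
        (\<integral>\<rho>. X_det d A \<rho> \<partial>iid_family n \<mu>) \<noteq> 0 \<longrightarrow>
          (n \<ge> d \<longrightarrow>
             (\<exists>\<epsilon>::real. \<bar>\<epsilon>\<bar> \<le> C / real d \<and>
                critical_ratio (iid_family n \<mu>) (X_det d A) = (1 + \<epsilon>) ^ n)) \<and>
          (\<exists>(\<kappa>::real) (\<epsilon>::real). 1 \<le> \<kappa> \<and> \<kappa> \<le> C \<and> \<bar>\<epsilon>\<bar> \<le> C / real d \<and>
                critical_ratio (iid_family n \<mu>) (X_det d A) = \<kappa> * (1 + \<epsilon>) ^ n))
   \<and> (\<exists>C::real. \<forall>D::nat. \<exists>N::nat. \<forall>d\<in>{1..D}. \<forall>n\<ge>max 1 N. \<forall>A \<mu>.
        zero_one_mat n A \<longrightarrow> haar_or_gaussian d \<mu> \<longrightarrow>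
        (\<integral>\<rho>. X_sdet d A \<rho> \<partial>iid_family n \<mu>) \<noteq> 0 \<longrightarrow>
          critical_ratio (iid_family n \<mu>) (X_sdet d A)
            \<le> 2 ^ (2 * n) * real n powr (- real d + C))
   \<and> (\<forall>D::nat. \<exists>C::real. \<forall>d\<in>{1..D}. \<forall>n\<ge>1. \<forall>A \<mu>.
        zero_one_mat n A \<longrightarrow> haar_or_gaussian d \<mu> \<longrightarrow>
        (\<integral>\<rho>. X_sdet d A \<rho> \<partial>iid_family n \<mu>) \<noteq> 0 \<longrightarrow>
          critical_ratio (iid_family n \<mu>) (X_sdet d A)
            \<le> 2 ^ (2 * n) * real n powr (- real d + C))
   \<and> (\<exists>K::real. \<forall>d\<ge>1. \<forall>n\<ge>1. \<forall>A \<mu>.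
        zero_one_mat n A \<longrightarrow> haar_or_gaussian d \<mu> \<longrightarrow>
        (\<integral>\<rho>. X_sdet d A \<rho> \<partial>iid_family n \<mu>) \<noteq> 0 \<longrightarrow>
          critical_ratio (iid_family n \<mu>) (X_sdet d A)
            \<le> K * exp (4 * (real n)\<^sup>2 / real d))"
proof (intro conjI, goal_cases)
  case 1
  show ?case
  \<comment> \<open>For x = 1/d at most 1, (1 + 4 x)^2 \<le> 1 + 24 x; the square comes from
    absorbing the factor 2.\<close>
  proof (rule exI[of _ 24], intro allI impI)
    fix d n A \<mu>
    assume d: "(1::nat) \<le> d" and n: "(1::nat) \<le> n" and A: "zero_one_mat n A" and \<mu>: "haar_or_gaussian d \<mu>"
      and nz: "(\<integral>\<rho>. X_det d A \<rho> \<partial>iid_family n \<mu>) \<noteq> 0"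
    let ?r = "critical_ratio (iid_family n \<mu>) (X_det d A)"
    have r: "1 \<le> ?r" "?r \<le> 2 * (1 + 4 / real d) ^ n" by (rule det_ratio_bounds[OF d n A \<mu> nz])+
    have d0: "real d \<ge> 1" using d by simp
    have small: "4 / real d \<le> 24 / real d" using d0 by (intro divide_right_mono) auto
    show "(n \<ge> d \<longrightarrow> (\<exists>\<epsilon>::real. \<bar>\<epsilon>\<bar> \<le> 24 / real d \<and> ?r = (1 + \<epsilon>) ^ n)) \<and>
      (\<exists>(\<kappa>::real) (\<epsilon>::real). 1 \<le> \<kappa> \<and> \<kappa> \<le> 24 \<and> \<bar>\<epsilon>\<bar> \<le> 24 / real d \<and> ?r = \<kappa> * (1 + \<epsilon>) ^ n)"
    proof (intro conjI impI)
      assume nd: "n \<ge> d"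
      \<comment> \<open>By Bernoulli's inequality the power is at least 1 + 4 n / d, hence at least
        2 for n \<ge> d.\<close>
      have "4 / real d * real d \<le> 4 / real d * real n" using nd by (intro mult_left_mono) auto
      moreover have "4 / real d * real d = 4" using d0 by simp
      ultimately have "2 \<le> 1 + real n * (4 / real d)" unfolding mult.commute[of "real n"] by linarith
      also have "\<dots> \<le> (1 + 4 / real d) ^ n"
        using d0 by (intro Bernoulli_inequality) (auto intro: order_trans[of _ 0])
      finally have "2 * (1 + 4 / real d) ^ n \<le> (1 + 4 / real d) ^ n * (1 + 4 / real d) ^ n"
        by (intro mult_right_mono) auto
      also have "\<dots> = ((1 + 4 / real d) * (1 + 4 / real d)) ^ n" by (simp only: power_mult_distrib)
      also have "\<dots> \<le> (1 + 24 / real d) ^ n"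
      proof (rule power_mono)
        have "1 / (real d * real d) \<le> 1 / real d" using d0 by (intro divide_left_mono) auto
        then show "(1 + 4 / real d) * (1 + 4 / real d) \<le> 1 + 24 / real d" by (simp add: algebra_simps)
      qed simp
      finally have "?r \<le> (1 + 24 / real d) ^ n" using r(2) by simp
      with n r(1) show "\<exists>\<epsilon>::real. \<bar>\<epsilon>\<bar> \<le> 24 / real d \<and> ?r = (1 + \<epsilon>) ^ n" by (intro nth_root_error) auto
    next
      show "\<exists>(\<kappa>::real) (\<epsilon>::real). 1 \<le> \<kappa> \<and> \<kappa> \<le> 24 \<and> \<bar>\<epsilon>\<bar> \<le> 24 / real d \<and> ?r = \<kappa> * (1 + \<epsilon>) ^ n"
      proof (cases "?r \<le> (1 + 4 / real d) ^ n")
        case True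
        then obtain \<epsilon> where "\<bar>\<epsilon>\<bar> \<le> 4 / real d" "?r = (1 + \<epsilon>) ^ n" using nth_root_error[OF n r(1) True] by auto
        then show ?thesis using small by (intro exI[of _ 1] exI[of _ \<epsilon>]) auto
      next
        \<comment> \<open>The error is taken to be 4/d, and \<kappa> is the remaining quotient,
          which lies between 1 and 2.\<close>
        case False
        define p where "p = (1 + 4 / real d) ^ n"
        have p: "p > 0" unfolding p_def using d0 by (intro zero_less_power) (auto intro: add_pos_nonneg)
        have "1 \<le> ?r / p" "?r / p \<le> 24" "?r = ?r / p * p"
          using False r(2) p unfolding p_def[symmetric] by (simp_all add: le_divide_eq divide_le_eq)
        then show ?thesis using small d0 unfolding p_def by (intro exI[of _ "?r / (1 + 4 / real d) ^ n"] exI[of _ "4 / real d"]) auto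
      qed
    qed
  qed
next
  case 2
  show ?case
  \<comment> \<open>The constant 2 makes the exponent of \<open>n\<close> nonnegative for
    \<open>d \<le> 2\<close>, where the available base is 4; for larger \<open>d\<close> it is
    3.\<close>
  proof (rule exI[of _ 2], rule allI, goal_cases)
    case (1 D)
    obtain N :: nat where N: "\<And>n. n \<ge> N \<Longrightarrow> real n ^ D \<le> (4 / 3) ^ n"
      using eventually_power_le_exponential[of D] by blast
    show ?case
    proof (rule exI[of _ N], intro ballI allI impI)
      fix d n A \<mu>
      assume dD: "d \<in> {1..D}" and nN: "max 1 N \<le> n" and A: "zero_one_mat n A" and \<mu>: "haar_or_gaussian d \<mu>"
        and nz: "(\<integral>\<rho>. X_sdet d A \<rho> \<partial>iid_family n \<mu>) \<noteq> 0"
      have d: "d \<ge> 1" "d \<le> D" and n: "n \<ge> 1" "n \<ge> N" using dD nN by auto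
      have four: "(2::real) ^ (2 * n) = 4 ^ n" by (simp add: power_mult)
      have K: "haar_factor d \<ge> 1" by (rule haar_factor_ge_1[OF d(1)])
      have "(2 * haar_factor d) ^ n \<le> 2 ^ (2 * n) * real n powr (- real d + 2)"
      proof (cases "d \<ge> 3")
        case False
        have "(2 * haar_factor d) ^ n \<le> 4 ^ n"
          using K haar_factor_le(1)[OF d(1)] by (intro power_mono) auto
        also have "\<dots> = 4 ^ n * 1" by simp
        also have "\<dots> \<le> 4 ^ n * real n powr (- real d + 2)"
          using False n by (intro mult_left_mono ge_one_powr_ge_zero) auto
        finally show ?thesis unfolding four .
      next
        case True
        have pos: "real n > 0" using n by simp
        have "(2 * haar_factor d) ^ n \<le> 3 ^ n"
          using K haar_factor_le(4)[OF d(1) True] by (intro power_mono) auto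
        also have "\<dots> = 4 ^ n / (4 / 3) ^ n" by (simp add: power_divide)
        also have "\<dots> \<le> 4 ^ n / real n ^ D"
          using N[OF n(2)] pos by (intro divide_left_mono) auto
        also have "\<dots> = 4 ^ n * real n powr (- real D)"
          using pos by (simp add: powr_minus powr_realpow divide_inverse)
        also have "\<dots> \<le> 4 ^ n * real n powr (- real d + 2)"
          using n d by (intro mult_left_mono powr_mono) auto
        finally show ?thesis unfolding four .
      qed
      with sdet_ratio_bounds(1)[OF d(1) n(1) A \<mu> nz]
      show "critical_ratio (iid_family n \<mu>) (X_sdet d A) \<le> 2 ^ (2 * n) * real n powr (- real d + 2)"
        by (rule order_trans)
    qed
  qed
next
  case 3
  show ?case
  proof (rule allI, goal_cases)
    case (1 D)
    show ?case
    \<comment> \<open>With this constant the exponent of \<open>n\<close> is nonnegative for every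
      admissible \<open>d\<close>, so \<open>4 ^ n\<close> is enough.\<close>
    proof (rule exI[of _ "real D"], intro ballI allI impI)
      fix d n A \<mu>
      assume dD: "d \<in> {1..D}" and n: "(1::nat) \<le> n" and A: "zero_one_mat n A" and \<mu>: "haar_or_gaussian d \<mu>"
        and nz: "(\<integral>\<rho>. X_sdet d A \<rho> \<partial>iid_family n \<mu>) \<noteq> 0"
      have d: "d \<ge> 1" "d \<le> D" using dD by auto
      have "critical_ratio (iid_family n \<mu>) (X_sdet d A) \<le> (2 * haar_factor d) ^ n"
        by (rule sdet_ratio_bounds(1)[OF d(1) n A \<mu> nz])
      also have "\<dots> \<le> 4 ^ n"
        using haar_factor_ge_1[OF d(1)] haar_factor_le(1)[OF d(1)] by (intro power_mono) auto
      also have "\<dots> = 2 ^ (2 * n) * 1" by (simp add: power_mult)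
      also have "\<dots> \<le> 2 ^ (2 * n) * real n powr (- real d + real D)"
        using n d by (intro mult_left_mono ge_one_powr_ge_zero) auto
      finally show "critical_ratio (iid_family n \<mu>) (X_sdet d A) \<le> 2 ^ (2 * n) * real n powr (- real d + real D)" .
    qed
  qed
next
  case 4
  show ?case
    using sdet_ratio_bounds(2) by blast
qed

end
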